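(* Let $p,q\in\mathbb{F}[t]$ be monic polynomials of degree $2$, and assume that $p$ and $q$ are irreducible over $\mathbb{F}$ with the same splitting field in $\overline{\mathbb{F}}$. Let $(b,u)$ be a symplectic pair over $\mathbb{F}$ in which $u$ is $(p,q)$-exceptional. The following conditions are equivalent: (i) $(b,u)$ is a symplectic $(p,q)$-difference; (ii) for every $z\in\mathbb{F}\cap(\operatorname{Root}(p)-\operatorname{Root}(q))$ and every odd integer $k\geq1$, the number of Jordan cells of $u$ of size $k$ for the eigenvalue $z$ is a multiple of $4$.
   Context: $\mathbb{F}$ is an arbitrary field (characteristic $2$ allowed), with a fixed algebraic closure $\overline{\mathbb{F}}$; all vector spaces are finite-dimensional over $\mathbb{F}$. $\operatorname{Root}(r)$ is the set of roots of $r$ in $\overline{\mathbb{F}}$; $\operatorname{Root}(p)-\operatorname{Root}(q):=\{x-y : x\in\operatorname{Root}(p),\,y\in\operatorname{Root}(q)\}$. An endomorphism is $(p,q)$-exceptional if all its eigenvalues in $\overline{\mathbb{F}}$ belong to $\operatorname{Root}(p)-\operatorname{Root}(q)$. For $z\in\mathbb{F}$, the number of Jordan cells of $u$ of size $k$ for $z$ is the number of elementary divisors of $u$ equal to $(t-z)^k$. A symplectic form is a non-degenerate alternating bilinear form. Given a symplectic form $b$ on $V$, an endomorphism $u$ of $V$ is $b$-alternating if $b(x,u(x))=0$ for all $x\in V$. A symplectic pair $(b,u)$ consists of a symplectic form $b$ on a vector space and a $b$-alternating endomorphism $u$ of it. It is a symplectic $(p,q)$-difference if there are $b$-alternating endomorphisms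 $u_1,u_2$ with $u=u_1-u_2$, $p(u_1)=0$ and $q(u_2)=0$. *)

theory Defs
  imports "HOL-Algebra.Algebraic_Closure_Type" "HOL-Algebra.Generated_Fields"
begin

text \<open>
  A vector space over the field \<open>'a\<close> is a type \<open>'v\<close> with a scalar multiplication \<open>scale\<close>; the
  fixed algebraic closure of \<open>'a\<close> is the type \<open>'a alg_closure\<close>, with embedding \<open>to_ac\<close>.
\<close>

definition Root :: "'a::field poly \<Rightarrow> 'a alg_closure set" where
  "Root r = {x. poly (map_poly to_ac r) x = 0}"

definition root_diff :: "'a::field poly \<Rightarrow> 'a poly \<Rightarrow> 'a alg_closure set" where
  "root_diff p q = {x - y | x y. x \<in> Root p \<and> y \<in> Root q}"

definition splitting_field :: "'a::field poly \<Rightarrow> 'a alg_closure set" where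
  "splitting_field r = generate_field ring_of_type_algebra (range to_ac \<union> Root r)"

definition poly_endo ::
  "('a::field \<Rightarrow> 'v::ab_group_add \<Rightarrow> 'v) \<Rightarrow> 'a poly \<Rightarrow> ('v \<Rightarrow> 'v) \<Rightarrow> 'v \<Rightarrow> 'v" where
  "poly_endo scale r u x = (\<Sum>i\<le>Polynomial.degree r. scale (Polynomial.coeff r i) ((u ^^ i) x))"

text \<open>
  A family \<open>w\<close> of elements of the closure, indexed by a finite basis \<open>B\<close>, stands for the vector
  \<open>\<Sum>c\<in>B. c \<otimes> w c\<close> of the scalar extension of the space to the closure. The equation below says
  that this vector is mapped by the scalar extension of \<open>u\<close> to \<open>z\<close> times itself. The choice of
  the basis \<open>B\<close> is immaterial.
\<close>

definition eigenvalue_in_closure ::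
  "('a::field \<Rightarrow> 'v::ab_group_add \<Rightarrow> 'v) \<Rightarrow> 'v set \<Rightarrow> ('v \<Rightarrow> 'v) \<Rightarrow> 'a alg_closure \<Rightarrow> bool" where
  "eigenvalue_in_closure scale B u z \<longleftrightarrow>
     (\<exists>w :: 'v \<Rightarrow> 'a alg_closure. (\<exists>c\<in>B. w c \<noteq> 0) \<and>
        (\<forall>c\<in>B. (\<Sum>d\<in>B. to_ac (module.representation scale B (u d) c) * w d) = z * w c))"

definition exceptional ::
  "('a::field \<Rightarrow> 'v::ab_group_add \<Rightarrow> 'v) \<Rightarrow> 'v set \<Rightarrow> 'a poly \<Rightarrow> 'a poly \<Rightarrow> ('v \<Rightarrow> 'v) \<Rightarrow> bool" where
  "exceptional scale B p q u \<longleftrightarrow>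
     Vector_Spaces.linear scale scale u \<and>
     (\<forall>z. eigenvalue_in_closure scale B u z \<longrightarrow> z \<in> root_diff p q)"

text \<open>
  The list \<open>ds\<close> consists of powers of monic irreducible polynomials, and the space, seen as a
  module over the polynomial ring through \<open>u\<close>, is isomorphic to the direct sum of the quotients of
  that ring by the ideals generated by the entries of \<open>ds\<close>: the \<open>x i\<close> are the images of the
  canonical generators.
\<close>

definition elementary_divisor_list ::
  "('a::field \<Rightarrow> 'v::ab_group_add \<Rightarrow> 'v) \<Rightarrow> ('v \<Rightarrow> 'v) \<Rightarrow> 'a poly list \<Rightarrow> bool" where
  "elementary_divisor_list scale u ds \<longleftrightarrow>
     (\<forall>d\<in>set ds. \<exists>\<pi> e. Polynomial.lead_coeff \<pi> = 1 \<and> Factorial_Ring.irreducible \<pi> \<and>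
        e > 0 \<and> d = \<pi> ^ e) \<and>
     (\<exists>x :: nat \<Rightarrow> 'v.
        (\<forall>v. \<exists>f. v = (\<Sum>i<length ds. poly_endo scale (f i) u (x i))) \<and>
        (\<forall>f. (\<Sum>i<length ds. poly_endo scale (f i) u (x i)) = 0 \<longleftrightarrow>
             (\<forall>i<length ds. ds ! i dvd f i)))"

text \<open>
  On a finite-dimensional space the multiset exists and is unique by the structure theorem for
  torsion modules over a principal ideal domain.
\<close>

definition elementary_divisors ::
  "('a::field \<Rightarrow> 'v::ab_group_add \<Rightarrow> 'v) \<Rightarrow> ('v \<Rightarrow> 'v) \<Rightarrow> 'a poly multiset" where
  "elementary_divisors scale u = (SOME M. \<exists>ds. elementary_divisor_list scale u ds \<and> M = mset ds)"

definition jordan_cells ::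
  "('a::field \<Rightarrow> 'v::ab_group_add \<Rightarrow> 'v) \<Rightarrow> ('v \<Rightarrow> 'v) \<Rightarrow> 'a \<Rightarrow> nat \<Rightarrow> nat" where
  "jordan_cells scale u z k = count (elementary_divisors scale u) ([:- z, 1:] ^ k)"

definition symplectic_form ::
  "('a::field \<Rightarrow> 'v::ab_group_add \<Rightarrow> 'v) \<Rightarrow> ('v \<Rightarrow> 'v \<Rightarrow> 'a) \<Rightarrow> bool" where
  "symplectic_form scale b \<longleftrightarrow>
     (\<forall>x. Vector_Spaces.linear scale (*) (b x)) \<and>
     (\<forall>y. Vector_Spaces.linear scale (*) (\<lambda>x. b x y)) \<and>
     (\<forall>x. b x x = 0) \<and>
     (\<forall>x. (\<forall>y. b x y = 0) \<longrightarrow> x = 0)"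

definition form_alternating ::
  "('a::field \<Rightarrow> 'v::ab_group_add \<Rightarrow> 'v) \<Rightarrow> ('v \<Rightarrow> 'v \<Rightarrow> 'a) \<Rightarrow> ('v \<Rightarrow> 'v) \<Rightarrow> bool" where
  "form_alternating scale b u \<longleftrightarrow> Vector_Spaces.linear scale scale u \<and> (\<forall>x. b x (u x) = 0)"

definition symplectic_pair ::
  "('a::field \<Rightarrow> 'v::ab_group_add \<Rightarrow> 'v) \<Rightarrow> ('v \<Rightarrow> 'v \<Rightarrow> 'a) \<Rightarrow> ('v \<Rightarrow> 'v) \<Rightarrow> bool" where
  "symplectic_pair scale b u \<longleftrightarrow> symplectic_form scale b \<and> form_alternating scale b u"

definition symplectic_difference ::
  "('a::field \<Rightarrow> 'v::ab_group_add \<Rightarrow> 'v) \<Rightarrow> 'a poly \<Rightarrow> 'a poly \<Rightarrow>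
     ('v \<Rightarrow> 'v \<Rightarrow> 'a) \<Rightarrow> ('v \<Rightarrow> 'v) \<Rightarrow> bool" where
  "symplectic_difference scale p q b u \<longleftrightarrow>
     symplectic_pair scale b u \<and>
     (\<exists>u1 u2. form_alternating scale b u1 \<and> form_alternating scale b u2 \<and>
        (\<forall>x. u x = u1 x - u2 x) \<and>
        (\<forall>x. poly_endo scale p u1 x = 0) \<and> (\<forall>x. poly_endo scale q u2 x = 0))"

end

theory Submission
  imports Defs "HOL-Library.Function_Algebras"
begin

text \<open>
  Write \<open>u = a - c\<close> with \<open>p(a) = q(c) = 0\<close>, \<open>p = t\<^sup>2 + P\<^sub>1 t + P\<^sub>0\<close>, \<open>q = t\<^sup>2 + Q\<^sub>1 t + Q\<^sub>0\<close> and \<open>\<delta> = Q\<^sub>1 - P\<^sub>1\<close>.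
  Given \<open>p(a) = 0\<close>, the equation \<open>q(a - u) = 0\<close> says \<open>a u + u a = \<delta> a + h(u)\<close> with
  \<open>h = t\<^sup>2 - Q\<^sub>1 t + Q\<^sub>0 - P\<^sub>0\<close>, so that \<open>a\<close> is semilinear over \<open>F[u]\<close> for the reflection
  \<open>t \<mapsto> \<delta> - t\<close>, up to a twisted derivation, and commutes with \<open>s = u\<^sup>2 - \<delta> u\<close>.

  Necessity. If \<open>z\<close> is a difference of roots lying in the base field, then \<open>q(t) = p(t + z)\<close>, and with
  \<open>w = u - z\<close> the endomorphism \<open>a\<close> preserves \<open>ker w\<^sup>k\<close>. For odd \<open>k\<close> the form
  \<open>(x, y) \<mapsto> b(x, w\<^sup>k\<^sup>-\<^sup>1 y)\<close> makes \<open>a\<close> alternating on \<open>ker w\<^sup>k\<close>; modulo its radical, whose codimension is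
  the number of cells of size \<open>k\<close>, one gets a symplectic form over the quadratic field \<open>F[a]\<close>.

  Sufficiency. The space is an orthogonal sum of blocks \<open>F[u] x + F[u] y\<close> with \<open>x\<close> and \<open>y\<close> annihilated by the
  same prime power \<open>d\<close>, where \<open>b(f(u) x, y)\<close> is the coefficient of \<open>t\<^sup>n\<^sup>-\<^sup>1\<close> in \<open>f mod d\<close>, \<open>n = deg d\<close>. If \<open>d\<close> is a
  polynomial in \<open>t\<^sup>2 - \<delta> t\<close>, this functional vanishes on such polynomials, and \<open>a x = y\<close>,
  \<open>a y = - P\<^sub>0 x - P\<^sub>1 y\<close> works. By exceptionality the only other \<open>d\<close> are the odd powers of \<open>t - z\<close>;
  condition (ii) groups their blocks in pairs, and \<open>a\<close> is defined on the sum of the two spaces \<open>F[u] x\<close> in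
  the same way and on their duals by taking adjoints.
\<close>

section \<open>Polynomials acting on a vector space\<close>

text \<open>Comaximality with explicit cofactors, so that a Bezout identity can be applied directly
  to a vector, as in \<open>act_bezout\<close>.\<close>

definition bezout_unit :: "'a::field poly \<Rightarrow> 'a poly \<Rightarrow> bool" where
  "bezout_unit f g \<longleftrightarrow> (\<exists>r s. r * f + s * g = 1)"

lemma bezout_unit_sym: "bezout_unit f g \<Longrightarrow> bezout_unit g f"
  unfolding bezout_unit_def by (metis add.commute)

lemma bezout_unit_mult:
  assumes "bezout_unit f h" "bezout_unit g h"
  shows "bezout_unit (f * g) h"
proof -
  obtain r s r' s' where "r * f + s * h = 1" "r' * g + s' * h = 1"
    using assms by (auto simp: bezout_unit_def)
  then have "(r * f + s * h) * (r' * g + s' * h) = 1"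
    by simp
  then have "(r * r') * (f * g) + (r * f * s' + s * r' * g + s * s' * h) * h = 1"
    by (simp add: algebra_simps)
  then show ?thesis
    unfolding bezout_unit_def by blast
qed

lemma bezout_unit_power: "bezout_unit f h \<Longrightarrow> bezout_unit (f ^ n) h"
proof (induction n)
  case 0
  have "1 * 1 + 0 * h = 1" by simp
  then show ?case
    unfolding bezout_unit_def power_0 by blast
qed (auto intro: bezout_unit_mult)

lemma bezout_unit_dvd:
  assumes "bezout_unit f g" "f dvd g * h"
  shows "f dvd h"
proof -
  obtain r s where "r * f + s * g = 1"
    using assms(1) by (auto simp: bezout_unit_def)
  then have "h = (r * f + s * g) * h"
    by simp
  also have "\<dots> = f * (r * h) + s * (g * h)"
    by (simp add: algebra_simps)
  finally show ?thesis
    using assms(2) by (metis dvd_add dvd_mult dvd_triv_left)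
qed

text \<open>The library has the Euclidean algorithm for polynomials only over fields of class
  \<open>field_gcd\<close>.\<close>

lemma bezout_unit_irreducible:
  fixes \<pi> f :: "'a::field poly"
  assumes "Factorial_Ring.irreducible \<pi>" "\<not> \<pi> dvd f"
  shows "bezout_unit \<pi> f"
proof -
  \<comment> \<open>The nonzero elements of the ideal generated by \<open>\<pi>\<close> and
    \<open>f\<close>. One of least degree divides every element of the ideal, since remainders stay
    in it.\<close>
  define I where "I = {g. g \<noteq> 0 \<and> (\<exists>r s. g = r * \<pi> + s * f)}"
  have "1 * \<pi> + 0 * f \<in> I"
    using assms(1) unfolding I_def by (intro CollectI conjI exI[of _ 1] exI[of _ 0]) auto
  then obtain d where d: "d \<in> I" "\<And>d'. d' \<in> I \<Longrightarrow> Polynomial.degree d \<le> Polynomial.degree d'"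
    using ex_has_least_nat[of "\<lambda>x. x \<in> I" _ Polynomial.degree] by blast
  then obtain r s where rs: "d = r * \<pi> + s * f" "d \<noteq> 0"
    by (auto simp: I_def)
  have dvd: "d dvd r' * \<pi> + s' * f" for r' s'
  proof (rule ccontr)
    let ?g = "r' * \<pi> + s' * f"
    assume "\<not> d dvd ?g"
    then have nz: "?g mod d \<noteq> 0"
      by (simp add: dvd_eq_mod_eq_0)
    have "?g mod d = ?g - ?g div d * d"
      by (simp add: minus_div_mult_eq_mod)
    also have "\<dots> = (r' - ?g div d * r) * \<pi> + (s' - ?g div d * s) * f"
      by (subst (2) rs(1)) (simp add: algebra_simps)
    finally have "\<exists>r s. ?g mod d = r * \<pi> + s * f"
      by blast
    with nz have "?g mod d \<in> I"
      unfolding I_def by blast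
    then have "Polynomial.degree d \<le> Polynomial.degree (?g mod d)"
      by (rule d(2))
    then show False
      using degree_mod_less[OF rs(2), of ?g] nz by auto
  qed
  have "d dvd \<pi>" "d dvd f"
    using dvd[of 1 0] dvd[of 0 1] by simp_all
  then have "is_unit d"
    using assms by (metis irreducibleD' dvd_trans)
  then obtain e where "1 = d * e"
    by (elim dvdE)
  then have "(e * r) * \<pi> + (e * s) * f = 1"
    using rs(1) by (simp add: algebra_simps)
  then show ?thesis
    unfolding bezout_unit_def by blast
qed

section \<open>The space as a module over the polynomial ring through \<open>u\<close>\<close>

locale vs_endo = vector_space scale
  for scale :: "'a::field \<Rightarrow> 'v::ab_group_add \<Rightarrow> 'v" (infixr "*s" 75) +
  fixes u :: "'v \<Rightarrow> 'v"
  assumes linear_u: "Vector_Spaces.linear scale scale u"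
begin

abbreviation act :: "'a poly \<Rightarrow> 'v \<Rightarrow> 'v" (infixr "\<star>" 75) where
  "f \<star> x \<equiv> poly_endo scale f u x"

lemma u_add: "u (x + y) = u x + u y"
  and u_scale: "u (c *s x) = c *s u x"
  using linear_u by (simp_all add: Vector_Spaces.linear_iff)

lemma u_zero [simp]: "u 0 = 0"
  using u_scale[of 0 0] by simp

lemma u_minus: "u (- x) = - u x"
  using u_scale[of "-1" x] by simp

lemma u_diff: "u (x - y) = u x - u y"
  using u_add[of x "- y"] by (simp add: u_minus)

lemma u_sum: "u (\<Sum>i\<in>A. g i) = (\<Sum>i\<in>A. u (g i))"
  by (induction A rule: infinite_finite_induct) (auto simp: u_add)

lemma act_zero_left [simp]: "0 \<star> x = 0"
  by (simp add: poly_endo_def)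

lemma act_pCons: "pCons c f \<star> x = c *s x + u (f \<star> x)"
proof (cases "f = 0")
  case True
  then show ?thesis by (simp add: poly_endo_def)
next
  case False
  then have "pCons c f \<star> x = (\<Sum>i\<le>Suc (Polynomial.degree f). coeff (pCons c f) i *s (u ^^ i) x)"
    by (simp add: poly_endo_def)
  also have "\<dots> = c *s x + (\<Sum>i\<le>Polynomial.degree f. coeff f i *s u ((u ^^ i) x))"
    by (subst sum.atMost_Suc_shift) simp
  finally show ?thesis
    by (simp add: poly_endo_def u_sum u_scale)
qed

lemma act_add_left: "(f + g) \<star> x = f \<star> x + g \<star> x"
  by (induction f g rule: poly_induct2) (auto simp: act_pCons u_add scale_left_distrib)

lemma act_smult: "Polynomial.smult c f \<star> x = c *s (f \<star> x)"
  by (induction f) (auto simp: act_pCons u_scale scale_right_distrib)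

lemma act_minus_left: "(- f) \<star> x = - (f \<star> x)"
  using act_smult[of "-1" f x] by simp

lemma act_diff_left: "(f - g) \<star> x = f \<star> x - g \<star> x"
  using act_add_left[of f "- g" x] by (simp add: act_minus_left)

lemma act_sum_left: "(\<Sum>i\<in>A. f i) \<star> x = (\<Sum>i\<in>A. f i \<star> x)"
  by (induction A rule: infinite_finite_induct) (auto simp: act_add_left)

lemma act_mult: "(f * g) \<star> x = f \<star> g \<star> x"
  by (induction f) (auto simp: act_pCons act_add_left act_smult)

lemma act_commute: "f \<star> g \<star> x = g \<star> f \<star> x"
  by (metis act_mult mult.commute)

lemma act_add_right: "f \<star> (x + y) = f \<star> x + f \<star> y"
  by (induction f) (auto simp: act_pCons u_add scale_right_distrib)

lemma act_scale: "f \<star> (c *s x) = c *s (f \<star> x)"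
  by (induction f) (auto simp: act_pCons u_scale scale_right_distrib mult.commute)

lemma act_zero_right [simp]: "f \<star> 0 = 0"
  using act_scale[of f 0 0] by simp

lemma act_minus_right: "f \<star> (- x) = - (f \<star> x)"
  using act_scale[of f "-1" x] by simp

lemma act_diff_right: "f \<star> (x - y) = f \<star> x - f \<star> y"
  using act_add_right[of f x "- y"] by (simp add: act_minus_right)

lemma act_sum_right: "f \<star> (\<Sum>i\<in>A. g i) = (\<Sum>i\<in>A. f \<star> g i)"
  by (induction A rule: infinite_finite_induct) (auto simp: act_add_right)

lemma act_one [simp]: "1 \<star> x = x"
  by (simp add: one_pCons act_pCons)

lemma act_const: "[:c:] \<star> x = c *s x"
  by (simp add: act_pCons)

lemma act_X: "[:0, 1:] \<star> x = u x"
  by (simp add: act_pCons)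

lemma act_monic_quadratic:
  "[:P0, P1, 1:] \<star> v = u (u v) + P1 *s u v + P0 *s v"
  by (simp add: act_pCons u_add u_scale add_ac)

lemma act_u: "f \<star> u x = u (f \<star> x)"
  using act_commute[of f "[:0, 1:]" x] by (simp only: act_X)

lemma act_dvd: "d dvd f \<Longrightarrow> d \<star> x = 0 \<Longrightarrow> f \<star> x = 0"
  by (auto simp: act_mult act_commute[of d] elim!: dvdE)

lemma act_mod: "d \<star> x = 0 \<Longrightarrow> f \<star> x = (f mod d) \<star> x"
  using act_add_left[of "f div d * d" "f mod d" x] act_dvd[of d "f div d * d" x] by simp

lemma act_bezout:
  assumes "bezout_unit f g" "f \<star> x = 0" "g \<star> x = 0"
  shows "x = 0"
proof -
  obtain r s where "r * f + s * g = 1"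
    using assms(1) by (auto simp: bezout_unit_def)
  then have "x = (r * f + s * g) \<star> x"
    by simp
  also have "\<dots> = r \<star> f \<star> x + s \<star> g \<star> x"
    by (simp only: act_add_left act_mult)
  finally show ?thesis
    by (simp add: assms)
qed

end

section \<open>Trace forms on quotients of the polynomial ring\<close>

text \<open>For monic \<open>d\<close> this is the residue functional, the coefficient of 1/t in the
  expansion of f/d at infinity. For \<open>d\<close> of positive degree,
  \<open>top_coeff_mod d (f * g)\<close> induces a nondegenerate symmetric form on F[t]/(d).\<close>

definition top_coeff_mod :: "'a::field poly \<Rightarrow> 'a poly \<Rightarrow> 'a" where
  "top_coeff_mod d f = Polynomial.coeff (f mod d) (Polynomial.degree d - 1)"

lemma top_coeff_mod_add: "top_coeff_mod d (f + g) = top_coeff_mod d f + top_coeff_mod d g"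
  by (simp add: top_coeff_mod_def poly_mod_add_left)

lemma top_coeff_mod_smult: "top_coeff_mod d (Polynomial.smult c f) = c * top_coeff_mod d f"
  by (simp add: top_coeff_mod_def mod_smult_left)

lemma top_coeff_mod_minus: "top_coeff_mod d (- f) = - top_coeff_mod d f"
  by (simp add: top_coeff_mod_def poly_mod_minus_left)

lemma top_coeff_mod_diff: "top_coeff_mod d (f - g) = top_coeff_mod d f - top_coeff_mod d g"
  by (simp add: top_coeff_mod_def poly_mod_diff_left)

lemma top_coeff_mod_zero [simp]: "top_coeff_mod d 0 = 0"
  by (simp add: top_coeff_mod_def)

lemma top_coeff_mod_sum: "top_coeff_mod d (\<Sum>i\<in>A. f i) = (\<Sum>i\<in>A. top_coeff_mod d (f i))"
  by (induction A rule: infinite_finite_induct) (auto simp: top_coeff_mod_add)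

lemma top_coeff_mod_dvd: "d dvd f \<Longrightarrow> top_coeff_mod d f = 0"
  by (simp add: top_coeff_mod_def dvd_eq_mod_eq_0)

lemma top_coeff_mod_cong: "d dvd f - g \<Longrightarrow> top_coeff_mod d f = top_coeff_mod d g"
  using top_coeff_mod_dvd[of d "f - g"] by (simp add: top_coeff_mod_diff)

lemma top_coeff_mod_less:
  "Polynomial.degree f < Polynomial.degree d \<Longrightarrow>
    top_coeff_mod d f = Polynomial.coeff f (Polynomial.degree d - 1)"
  by (simp add: top_coeff_mod_def mod_poly_less)

text \<open>A nonzero remainder \<open>r\<close> is multiplied by the power of t that brings its
  leading term to the top degree; the product is its own remainder, and the functional reads off its
  leading coefficient.\<close>

lemma top_coeff_mod_nondegenerate:
  assumes d: "Polynomial.degree d > 0" and zero: "\<And>h. top_coeff_mod d (f * h) = 0"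
  shows "d dvd f"
proof (rule ccontr)
  assume "\<not> d dvd f"
  define r where "r = f mod d"
  define h where "h = monom (1 :: 'a) (Polynomial.degree d - 1 - Polynomial.degree r)"
  have r: "r \<noteq> 0" "Polynomial.degree r < Polynomial.degree d"
    using \<open>\<not> d dvd f\<close> d degree_mod_less[of d f] by (cases "d = 0"; auto simp: r_def dvd_eq_mod_eq_0)+
  have deg: "Polynomial.degree (r * h) = Polynomial.degree d - 1"
    using r by (simp add: h_def degree_mult_eq degree_monom_eq)
  have "f * h - r * h = f div d * h * d"
    by (simp add: r_def minus_mod_eq_div_mult flip: left_diff_distrib)
  then have "top_coeff_mod d (f * h) = top_coeff_mod d (r * h)"
    by (intro top_coeff_mod_cong) simp
  also have "\<dots> = Polynomial.coeff (r * h) (Polynomial.degree d - 1)"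
    using d deg by (intro top_coeff_mod_less) simp
  also have "\<dots> = Polynomial.lead_coeff (r * h)"
    by (simp add: deg)
  also have "\<dots> \<noteq> 0"
    using r by (simp add: h_def monom_eq_0_iff)
  finally show False
    using zero by simp
qed

text \<open>Every linear form on F[t]/(d) is a translate of \<open>top_coeff_mod d\<close>. The
  multiplier is built one exponent at a time, because the pairing of increasing with decreasing
  powers of t is triangular.\<close>

lemma top_coeff_mod_represents:
  fixes \<phi> :: "'a::field poly \<Rightarrow> 'a"
  assumes add: "\<And>f g. \<phi> (f + g) = \<phi> f + \<phi> g"
    and smult: "\<And>c f. \<phi> (Polynomial.smult c f) = c * \<phi> f"
    and dvd: "\<And>f. d dvd f \<Longrightarrow> \<phi> f = 0"
    and d: "Polynomial.degree d > 0"
  shows "\<exists>g. \<forall>h. \<phi> h = top_coeff_mod d (h * g)"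
proof -
  let ?D = "Polynomial.degree d"
  have "\<exists>g. \<forall>i<k. \<phi> (monom 1 i) = top_coeff_mod d (monom 1 i * g)" if "k \<le> ?D" for k
    using that
  proof (induction k)
    case (Suc k)
    then obtain g where g: "\<And>i. i < k \<Longrightarrow> \<phi> (monom 1 i) = top_coeff_mod d (monom 1 i * g)"
      by auto
    define c where "c = \<phi> (monom 1 k) - top_coeff_mod d (monom 1 k * g)"
    \<comment> \<open>This monomial pairs to 1 with t^k when \<open>d\<close> is monic, and to 0
      with all lower powers, so adding a multiple of it leaves the values already adjusted
      untouched.\<close>
    define g' where "g' = monom (1 :: 'a) (?D - 1 - k)"
    have g': "top_coeff_mod d (monom 1 i * g') = (if i = k then 1 else 0)" if "i \<le> k" for i
    proof -
      have "monom 1 i * g' = monom 1 (i + (?D - 1 - k))"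
        by (simp add: g'_def mult_monom)
      then show ?thesis
        using that Suc.prems d
        by (subst top_coeff_mod_less) (auto simp: degree_monom_eq)
    qed
    have "\<phi> (monom 1 i) = top_coeff_mod d (monom 1 i * (g + Polynomial.smult c g'))"
      if "i < Suc k" for i
      using that g[of i] g'[of i]
      by (cases "i = k")
        (auto simp: distrib_left top_coeff_mod_add top_coeff_mod_smult c_def)
    then show ?case by blast
  qed simp
  then obtain g where g: "\<And>i. i < ?D \<Longrightarrow> \<phi> (monom 1 i) = top_coeff_mod d (monom 1 i * g)"
    by blast
  have sum: "\<phi> (\<Sum>i\<in>A. f i) = (\<Sum>i\<in>A. \<phi> (f i))" for A and f :: "nat \<Rightarrow> 'a poly"
    using smult[of 0 0] by (induction A rule: infinite_finite_induct) (auto simp: add)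
  have low: "\<phi> h = top_coeff_mod d (h * g)" if "Polynomial.degree h < ?D" for h
  proof -
    have h: "h = (\<Sum>i\<le>Polynomial.degree h. Polynomial.smult (Polynomial.coeff h i) (monom 1 i))"
      using poly_as_sum_of_monoms[of h] by (simp add: smult_monom)
    have "\<phi> h = (\<Sum>i\<le>Polynomial.degree h. Polynomial.coeff h i * \<phi> (monom 1 i))"
      by (subst h) (simp add: sum smult)
    also have "\<dots> = (\<Sum>i\<le>Polynomial.degree h. Polynomial.coeff h i * top_coeff_mod d (monom 1 i * g))"
      using that by (intro sum.cong) (auto simp: g)
    also have "\<dots> = top_coeff_mod d ((\<Sum>i\<le>Polynomial.degree h.
        Polynomial.smult (Polynomial.coeff h i) (monom 1 i)) * g)"
      by (simp add: sum_distrib_right top_coeff_mod_sum top_coeff_mod_smult)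
    finally show ?thesis
      using h by simp
  qed
  have "\<phi> h = top_coeff_mod d (h * g)" for h
  proof -
    have deg: "Polynomial.degree (h mod d) < ?D"
      using d degree_mod_less[of d h] by (cases "d = 0"; cases "h mod d = 0") auto
    have "\<phi> h = \<phi> (h div d * d) + \<phi> (h mod d)"
      by (simp flip: add)
    also have "\<dots> = top_coeff_mod d ((h mod d) * g)"
      using deg by (subst dvd, simp, subst low) auto
    also have "\<dots> = top_coeff_mod d (h * g)"
      using dvd_mult2[OF dvd_minus_mod[of d h], of g]
      by (intro top_coeff_mod_cong[symmetric]) (simp add: left_diff_distrib)
    finally show ?thesis .
  qed
  then show ?thesis by blast
qed

section \<open>Symplectic pairs: adjunction and orthogonality\<close>

locale fd_endo = vs_endo scale u + finite_dimensional_vector_space scale Basis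
  for scale :: "'a::field \<Rightarrow> 'v::ab_group_add \<Rightarrow> 'v" (infixr "*s" 75)
    and u :: "'v \<Rightarrow> 'v" and Basis :: "'v set"

locale symplectic_endo = fd_endo scale u Basis
  for scale :: "'a::field \<Rightarrow> 'v::ab_group_add \<Rightarrow> 'v" (infixr "*s" 75)
    and u :: "'v \<Rightarrow> 'v" and Basis :: "'v set" +
  fixes b :: "'v \<Rightarrow> 'v \<Rightarrow> 'a"
  assumes pair: "symplectic_pair scale b u"
begin

lemma b_add_left: "b (x + x') y = b x y + b x' y"
  and b_scale_left: "b (c *s x) y = c * b x y"
  and b_add_right: "b x (y + y') = b x y + b x y'"
  and b_scale_right: "b x (c *s y) = c * b x y"
  using pair by (simp_all add: symplectic_pair_def symplectic_form_def Vector_Spaces.linear_iff)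

lemma b_self [simp]: "b x x = 0"
  using pair by (simp add: symplectic_pair_def symplectic_form_def)

lemma b_nondegenerate: "(\<And>y. b x y = 0) \<Longrightarrow> x = 0"
  using pair by (simp add: symplectic_pair_def symplectic_form_def)

lemma b_alternating [simp]: "b x (u x) = 0"
  using pair by (simp add: symplectic_pair_def form_alternating_def)

lemma b_zero_left [simp]: "b 0 y = 0"
  using b_scale_left[of 0 0 y] by simp

lemma b_zero_right [simp]: "b x 0 = 0"
  using b_scale_right[of x 0 0] by simp

lemma b_minus_left: "b (- x) y = - b x y"
  using b_scale_left[of "-1" x y] by simp

lemma b_minus_right: "b x (- y) = - b x y"
  using b_scale_right[of x "-1" y] by simp

lemma b_diff_left: "b (x - x') y = b x y - b x' y"
  using b_add_left[of x "- x'" y] by (simp add: b_minus_left)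

lemma b_diff_right: "b x (y - y') = b x y - b x y'"
  using b_add_right[of x y "- y'"] by (simp add: b_minus_right)

lemma b_sum_left: "b (\<Sum>i\<in>A. g i) y = (\<Sum>i\<in>A. b (g i) y)"
  by (induction A rule: infinite_finite_induct) (auto simp: b_add_left)

lemma b_sum_right: "b x (\<Sum>i\<in>A. g i) = (\<Sum>i\<in>A. b x (g i))"
  by (induction A rule: infinite_finite_induct) (auto simp: b_add_right)

lemma alternating_skew:
  assumes "Vector_Spaces.linear scale scale a" "\<And>x. b x (a x) = 0"
  shows "b x (a y) = - b y (a x)"
proof -
  have "b (x + y) (a (x + y)) = 0" by (rule assms(2))
  moreover have "a (x + y) = a x + a y"
    using assms(1) by (simp add: Vector_Spaces.linear_iff)
  ultimately have "b x (a y) + b y (a x) = 0"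
    using assms(2) by (simp add: b_add_left b_add_right add.commute)
  then show ?thesis by (simp add: eq_neg_iff_add_eq_0)
qed

lemma b_skew: "b x y = - b y x"
  by (rule alternating_skew[of "\<lambda>x. x"]) (simp_all add: Vector_Spaces.linear_iff vector_space_axioms)

lemma alternating_adjoint:
  assumes "Vector_Spaces.linear scale scale a" "\<And>x. b x (a x) = 0"
  shows "b (a x) y = b x (a y)"
  using alternating_skew[OF assms, of x y] b_skew[of "a x" y] by simp

lemma b_u: "b (u x) y = b x (u y)"
  by (rule alternating_adjoint[OF linear_u]) simp

lemma b_act: "b (f \<star> x) y = b x (f \<star> y)"
  by (induction f arbitrary: x y)
    (auto simp: act_pCons b_add_left b_add_right b_scale_left b_scale_right b_u act_u)

lemma b_funpow: "b ((u ^^ i) x) y = b x ((u ^^ i) y)"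
  by (induction i arbitrary: y) (auto simp: b_u simp flip: funpow_swap1)

text \<open>Half of the exponent is moved across the form: b(x, u^i x) becomes b(v, v) or b(v, u v)
  with v = u^j x, and both vanish. Hence cyclic submodules are totally isotropic, in characteristic
  2 as well.\<close>

lemma b_act_self: "b (f \<star> x) (g \<star> x) = 0"
proof -
  have "b x ((u ^^ i) x) = 0" for i
  proof (cases "even i")
    case True
    then obtain j where "i = 2 * j"
      by (elim evenE)
    then have "(u ^^ i) x = (u ^^ j) ((u ^^ j) x)"
      by (simp add: funpow_add mult_2)
    then show ?thesis by (simp add: b_funpow[of j x, symmetric])
  next
    case False
    then obtain j where "i = 2 * j + 1"
      by (elim oddE)
    then have "(u ^^ i) x = (u ^^ j) (u ((u ^^ j) x))"
      by (simp add: funpow_add mult_2 flip: funpow_swap1)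
    then show ?thesis by (simp add: b_funpow[of j x, symmetric])
  qed
  then have "b x (h \<star> x) = 0" for h
    by (simp add: poly_endo_def b_sum_right b_scale_right)
  then show ?thesis
    by (simp add: b_act flip: act_mult)
qed

definition nondegenerate_on :: "'v set \<Rightarrow> bool" where
  "nondegenerate_on U \<longleftrightarrow> (\<forall>x\<in>U. (\<forall>y\<in>U. b x y = 0) \<longrightarrow> x = 0)"

text \<open>Induction on \<open>S\<close> replaces a dimension count for the double orthogonal
  inside \<open>U\<close>. A vector orthogonal to the smaller set but not to \<open>s\<close> tells
  which multiple of \<open>s\<close> to subtract from \<open>x\<close>; if there is none,
  \<open>s\<close> imposes no new condition.\<close>

lemma in_span_if_perp_perp:
  assumes "finite S" "S \<subseteq> U" "subspace U" "nondegenerate_on U" "x \<in> U"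
    and "\<And>y. y \<in> U \<Longrightarrow> (\<And>s. s \<in> S \<Longrightarrow> b s y = 0) \<Longrightarrow> b x y = 0"
  shows "x \<in> span S"
  using assms
proof (induction S arbitrary: x rule: finite_induct)
  case empty
  then show ?case by (auto simp: nondegenerate_on_def)
next
  case (insert s S)
  show ?case
  proof (cases "\<exists>y\<in>U. (\<forall>s\<in>S. b s y = 0) \<and> b s y \<noteq> 0")
    case True
    then obtain y0 where y0: "y0 \<in> U" "\<And>t. t \<in> S \<Longrightarrow> b t y0 = 0" "b s y0 \<noteq> 0"
      by blast
    define k where "k = b x y0 / b s y0"
    have "x - k *s s \<in> span S"
    proof (rule insert.IH)
      show "x - k *s s \<in> U"
        using insert.prems by (auto intro: subspace_diff subspace_scale)
      fix y assume y: "y \<in> U" "\<And>t. t \<in> S \<Longrightarrow> b t y = 0"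
      let ?y' = "y - (b s y / b s y0) *s y0"
      have "b x ?y' = 0"
      proof (rule insert.prems(5))
        show "?y' \<in> U"
          using insert.prems y y0 by (auto intro: subspace_diff subspace_scale)
        show "b t ?y' = 0" if "t \<in> insert s S" for t
          using that y y0 by (auto simp: b_diff_right b_scale_right)
      qed
      then show "b (x - k *s s) y = 0"
        by (simp add: k_def b_diff_right b_diff_left b_scale_left b_scale_right)
    qed (use insert.prems in auto)
    then show ?thesis
      by (simp add: span_breakdown_eq) blast
  next
    case False
    have "x \<in> span S"
    proof (rule insert.IH)
      fix y assume y: "y \<in> U" "\<And>t. t \<in> S \<Longrightarrow> b t y = 0"
      with False have "b s y = 0" by blast
      then show "b x y = 0"
        using y insert.prems(5)[of y] by auto
    qed (use insert.prems in auto)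
    then show ?thesis
      by (meson span_mono subsetD subset_insertI)
  qed
qed

end

section \<open>Splitting off a symplectic block\<close>

text \<open>A divisor of least positive degree cannot factor further; scaling makes it
  monic.\<close>

lemma irreducible_divisor_exists:
  fixes m :: "'a::field poly"
  assumes "Polynomial.degree m > 0"
  shows "\<exists>\<pi>. Polynomial.lead_coeff \<pi> = 1 \<and> Factorial_Ring.irreducible \<pi> \<and> \<pi> dvd m"
proof -
  let ?P = "\<lambda>d. d dvd m \<and> Polynomial.degree d > 0"
  obtain d where d: "?P d" "\<And>d'. ?P d' \<Longrightarrow> Polynomial.degree d \<le> Polynomial.degree d'"
    using ex_has_least_nat[of ?P m Polynomial.degree] assms by auto
  have "d \<noteq> 0" using d(1) by auto
  have irr: "Factorial_Ring.irreducible d"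
  proof (rule irreducibleI)
    show "\<not> is_unit d"
      using d(1) \<open>d \<noteq> 0\<close> by (auto simp: is_unit_iff_degree)
    fix r s assume rs: "d = r * s"
    then have nz: "r \<noteq> 0" "s \<noteq> 0" using \<open>d \<noteq> 0\<close> by auto
    have "Polynomial.degree r = 0 \<or> Polynomial.degree d \<le> Polynomial.degree r"
      using d(1) d(2)[of r] rs by (metis dvd_trans dvd_triv_left gr0I)
    moreover have "Polynomial.degree d = Polynomial.degree r + Polynomial.degree s"
      using rs nz by (simp add: degree_mult_eq)
    ultimately show "r dvd 1 \<or> s dvd 1"
      using nz by (auto simp: is_unit_iff_degree)
  qed fact
  define c where "c = inverse (Polynomial.lead_coeff d)"
  have c: "is_unit [:c:]" "c \<noteq> 0"
    using \<open>d \<noteq> 0\<close> by (auto simp: c_def is_unit_const_poly_iff dvd_field_iff)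
  have "Factorial_Ring.irreducible ([:c:] * d)"
    using irr c by (simp only: irreducible_mult_unit_left)
  moreover have "[:c:] * d dvd m"
    using d(1) c by (simp add: smult_dvd)
  moreover have "Polynomial.lead_coeff ([:c:] * d) = 1"
    using \<open>d \<noteq> 0\<close> by (simp add: c_def)
  ultimately show ?thesis
    by blast
qed

lemma prime_power_decomposition:
  fixes m \<pi> :: "'a::field poly"
  assumes "m \<noteq> 0" "Polynomial.degree \<pi> > 0"
  shows "\<exists>e m'. m = \<pi> ^ e * m' \<and> \<not> \<pi> dvd m'"
  using assms(1)
proof (induction "Polynomial.degree m" arbitrary: m rule: less_induct)
  case less
  show ?case
  proof (cases "\<pi> dvd m")
    case True
    then obtain k where k: "m = \<pi> * k" by (elim dvdE)
    then have "Polynomial.degree k < Polynomial.degree m"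
      using less.prems assms(2) by (auto simp: degree_mult_eq)
    with less.hyps[of k] k less.prems obtain e m' where "k = \<pi> ^ e * m'" "\<not> \<pi> dvd m'"
      by auto
    with k have "m = \<pi> ^ Suc e * m'" by (simp add: mult.assoc)
    with \<open>\<not> \<pi> dvd m'\<close> show ?thesis by blast
  next
    case False
    then have "m = \<pi> ^ 0 * m \<and> \<not> \<pi> dvd m" by simp
    then show ?thesis by blast
  qed
qed

lemma degree_irreducible_pos:
  "Factorial_Ring.irreducible (\<pi> :: 'a::field poly) \<Longrightarrow> Polynomial.degree \<pi> > 0"
  by (metis irreducible_not_unit irreducible_def is_unit_iff_degree neq0_conv)

context vs_endo
begin

lemma act_bound:
  "Polynomial.degree f \<le> n \<Longrightarrow> f \<star> x = (\<Sum>i\<le>n. Polynomial.coeff f i *s (u ^^ i) x)"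
  unfolding poly_endo_def by (intro sum.mono_neutral_left) (auto simp: coeff_eq_0)

lemma act_monom: "monom c i \<star> x = c *s (u ^^ i) x"
  by (induction i arbitrary: x)
    (auto simp: monom_0 monom_Suc act_pCons u_scale)

lemma act_invariant:
  assumes "subspace U" "\<And>v. v \<in> U \<Longrightarrow> u v \<in> U" "v \<in> U"
  shows "f \<star> v \<in> U"
  by (induction f) (use assms in \<open>auto simp: act_pCons intro: subspace_add subspace_scale subspace_0\<close>)

lemma dvd_if_act_zero:
  assumes \<pi>: "Factorial_Ring.irreducible \<pi>" and "e > 0"
    and "\<pi> ^ e \<star> x = 0" "\<pi> ^ (e - 1) \<star> x \<noteq> 0" "g \<star> x = 0"
  shows "\<pi> ^ e dvd g"
proof (cases "g = 0")
  case False
  with prime_power_decomposition[of g \<pi>] degree_irreducible_pos[OF \<pi>]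
  obtain j h where g: "g = \<pi> ^ j * h" "\<not> \<pi> dvd h" by blast
  have "j \<ge> e"
  proof (rule ccontr)
    assume "\<not> j \<ge> e"
    have "\<pi> ^ j \<star> x = 0"
    proof (rule act_bezout)
      show "bezout_unit (\<pi> ^ e) h"
        using \<pi> g by (intro bezout_unit_power bezout_unit_irreducible)
      show "\<pi> ^ e \<star> \<pi> ^ j \<star> x = 0"
        using assms by (simp add: act_commute[of "\<pi> ^ e"])
      show "h \<star> \<pi> ^ j \<star> x = 0"
        using assms by (simp add: g act_mult act_commute[of h])
    qed
    moreover have "\<pi> ^ j dvd \<pi> ^ (e - 1)"
      using \<open>\<not> j \<ge> e\<close> by (intro le_imp_power_dvd) simp
    ultimately show False
      using act_dvd assms by blast
  qed
  then show ?thesis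
    by (simp add: g dvd_mult2 le_imp_power_dvd)
qed simp

end

context fd_endo
begin

text \<open>Without an annihilator the orbit of \<open>v\<close> would be an infinite independent
  set.\<close>

lemma annihilator_exists: "\<exists>m. m \<noteq> 0 \<and> m \<star> v = 0"
proof (rule ccontr)
  assume "\<not> ?thesis"
  then have nz: "m \<star> v = 0 \<Longrightarrow> m = 0" for m by blast
  define orb where "orb i = (u ^^ i) v" for i
  have comb: "(\<Sum>i\<in>A. c i *s orb i) = (\<Sum>i\<in>A. monom (c i) i) \<star> v" for A c
    by (simp add: orb_def act_sum_left act_monom)
  have inj: "inj orb"
  proof (rule injI)
    fix i j assume "orb i = orb j"
    then have "monom 1 i - monom 1 j = (0 :: 'a poly)"
      by (intro nz) (simp add: orb_def act_diff_left act_monom)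
    then have "Polynomial.coeff (monom 1 i) i = Polynomial.coeff (monom (1 :: 'a) j) i"
      by simp
    then show "i = j"
      by (auto split: if_splits)
  qed
  have "independent (range orb)"
    unfolding independent_explicit_finite_subsets
  proof (intro allI impI ballI)
    fix S c w assume S: "S \<subseteq> range orb" "finite S" "(\<Sum>v\<in>S. c v *s v) = 0" "w \<in> S"
    define A where "A = orb -` S"
    have A: "S = orb ` A" "finite A"
      using S inj by (auto simp: A_def finite_vimageI)
    have "(\<Sum>v\<in>S. c v *s v) = (\<Sum>i\<in>A. c (orb i) *s orb i)"
      unfolding A by (subst sum.reindex) (auto intro: inj_on_subset[OF inj])
    then have "(\<Sum>i\<in>A. monom (c (orb i)) i) = 0"
      using S by (intro nz) (simp add: comb)
    moreover obtain j where j: "j \<in> A" "w = orb j"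
      using S A by auto
    ultimately have "Polynomial.coeff (\<Sum>i\<in>A. monom (c (orb i)) i) j = 0"
      by simp
    then show "c w = 0"
      using A j by (simp add: coeff_sum sum.delta)
  qed
  then have "finite (range orb)"
    by (rule finiteI_independent)
  with inj show False
    using finite_imageD by blast
qed

lemma global_annihilator_exists: "\<exists>m. m \<noteq> 0 \<and> (\<forall>v. m \<star> v = 0)"
proof -
  obtain m where m: "\<And>v. m v \<noteq> 0" "\<And>v. m v \<star> v = 0"
    using annihilator_exists by metis
  define M where "M = (\<Prod>v\<in>Basis. m v)"
  have "subspace {v. M \<star> v = 0}"
    by (auto simp: subspace_def act_add_right act_scale)
  moreover have "Basis \<subseteq> {v. M \<star> v = 0}"
  proof
    fix v assume "v \<in> Basis"
    then have "m v dvd M"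
      by (simp add: M_def finite_Basis dvd_prodI)
    then show "v \<in> {v. M \<star> v = 0}"
      using act_dvd m(2) by blast
  qed
  ultimately have "span Basis \<subseteq> {v. M \<star> v = 0}"
    by (intro span_minimal)
  moreover have "M \<noteq> 0"
    by (simp add: M_def m finite_Basis)
  ultimately show ?thesis
    by (auto simp: span_Basis)
qed

end

context symplectic_endo
begin

text \<open>Take a primary factor \<open>\<pi> ^ e\<close> of the minimal polynomial of
  \<open>u\<close> on \<open>U\<close> and a vector \<open>x\<close> of exact order
  \<open>\<pi> ^ e\<close>. Its first iterates are independent, so nondegeneracy supplies a vector
  whose pairings with them realise \<open>top_coeff_mod\<close>.\<close>

lemma symplectic_block_exists:
  assumes U: "subspace U" "\<And>v. v \<in> U \<Longrightarrow> u v \<in> U" "nondegenerate_on U" "U \<noteq> {0}"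
  shows "\<exists>\<pi> e x y. Polynomial.lead_coeff \<pi> = 1 \<and> Factorial_Ring.irreducible \<pi> \<and> e > 0 \<and>
    x \<in> U \<and> y \<in> U \<and> \<pi> ^ e \<star> x = 0 \<and> \<pi> ^ e \<star> y = 0 \<and>
    (\<forall>f. b (f \<star> x) y = top_coeff_mod (\<pi> ^ e) f)"
proof -
  let ?P = "\<lambda>m. m \<noteq> 0 \<and> (\<forall>v\<in>U. m \<star> v = 0)"
  \<comment> \<open>The minimal polynomial of \<open>u\<close> on \<open>U\<close>, up to a
    scalar.\<close>
  obtain M where M: "?P M" "\<And>m. ?P m \<Longrightarrow> Polynomial.degree M \<le> Polynomial.degree m"
    using ex_has_least_nat[of ?P _ Polynomial.degree] global_annihilator_exists by blast
  have "Polynomial.degree M > 0"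
  proof (rule ccontr)
    assume "\<not> ?thesis"
    then obtain c where "M = [:c:]" "c \<noteq> 0"
      using M(1) by (auto elim: degree_eq_zeroE)
    with M(1) have "\<forall>v\<in>U. v = 0"
      by (simp add: act_const)
    then show False
      using U(1,4) subspace_0 by blast
  qed
  then obtain \<pi> where \<pi>: "Polynomial.lead_coeff \<pi> = 1" "Factorial_Ring.irreducible \<pi>" "\<pi> dvd M"
    using irreducible_divisor_exists by blast
  have deg: "Polynomial.degree \<pi> > 0"
    by (rule degree_irreducible_pos[OF \<pi>(2)])
  obtain e m' where m': "M = \<pi> ^ e * m'" "\<not> \<pi> dvd m'"
    using prime_power_decomposition[of M \<pi>] M(1) deg by blast
  have "e > 0" using m' \<pi>(3) by (cases e) auto
  define d where "d = \<pi> ^ e"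
  define D where "D = Polynomial.degree d"
  have "\<pi> \<noteq> 0" "m' \<noteq> 0" using deg m' M(1) by auto
  have D: "D = e * Polynomial.degree \<pi>" "D > 0"
    using \<open>e > 0\<close> deg \<open>\<pi> \<noteq> 0\<close> by (simp_all add: D_def d_def degree_power_eq)
  have "\<exists>x0\<in>U. (\<pi> ^ (e - 1) * m') \<star> x0 \<noteq> 0"
  proof (rule ccontr)
    assume "\<not> ?thesis"
    then have "Polynomial.degree M \<le> Polynomial.degree (\<pi> ^ (e - 1) * m')"
      using \<open>\<pi> \<noteq> 0\<close> \<open>m' \<noteq> 0\<close> by (intro M(2)) auto
    then show False
      using \<open>e > 0\<close> deg \<open>\<pi> \<noteq> 0\<close> \<open>m' \<noteq> 0\<close>
      by (cases e) (auto simp: m' degree_mult_eq degree_power_eq)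
  qed
  then obtain x0 where x0: "x0 \<in> U" "(\<pi> ^ (e - 1) * m') \<star> x0 \<noteq> 0" by blast
  define x where "x = m' \<star> x0"
  have x: "x \<in> U" "\<pi> ^ (e - 1) \<star> x \<noteq> 0" "d \<star> x = 0"
    using x0 M(1) act_invariant[OF U(1,2)] by (auto simp: x_def d_def m' simp flip: act_mult)
  have uU: "(u ^^ i) x \<in> U" for i
    by (induction i) (auto simp: x U)
  define S where "S = (\<lambda>i. (u ^^ i) x) ` {..<D - 1}"
  \<comment> \<open>Otherwise a nonzero polynomial of degree \<open>D - 1\<close> would kill
    \<open>x\<close>, whereas every annihilator of \<open>x\<close> is a multiple of
    \<open>d\<close>.\<close>
  have "(u ^^ (D - 1)) x \<notin> span S"
  proof
    assume "(u ^^ (D - 1)) x \<in> span S"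
    define W where "W = {g \<star> x | g. \<forall>i\<ge>D - 1. Polynomial.coeff g i = 0}"
    have "subspace W"
      unfolding subspace_def
    proof (intro conjI ballI allI)
      show "0 \<in> W" unfolding W_def by (intro CollectI exI[of _ 0]) auto
      show "v + w \<in> W" if vw: "v \<in> W" "w \<in> W" for v w
      proof -
        obtain g h where "v = g \<star> x" "\<forall>i\<ge>D - 1. Polynomial.coeff g i = 0"
          "w = h \<star> x" "\<forall>i\<ge>D - 1. Polynomial.coeff h i = 0"
          using vw unfolding W_def by blast
        then show ?thesis
          unfolding W_def by (intro CollectI exI[of _ "g + h"]) (auto simp: act_add_left)
      qed
      show "c *s v \<in> W" if v: "v \<in> W" for c v
      proof -
        obtain g where "v = g \<star> x" "\<forall>i\<ge>D - 1. Polynomial.coeff g i = 0"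
          using v unfolding W_def by blast
        then show ?thesis
          unfolding W_def by (intro CollectI exI[of _ "Polynomial.smult c g"]) (auto simp: act_smult)
      qed
    qed
    moreover have "S \<subseteq> W"
    proof
      fix v assume "v \<in> S"
      then obtain i where "i < D - 1" "v = (u ^^ i) x" by (auto simp: S_def)
      then show "v \<in> W"
        unfolding W_def by (intro CollectI exI[of _ "monom 1 i"]) (auto simp: act_monom)
    qed
    ultimately have "span S \<subseteq> W" by (intro span_minimal)
    with \<open>(u ^^ (D - 1)) x \<in> span S\<close> obtain g
      where g: "(u ^^ (D - 1)) x = g \<star> x" "\<forall>i\<ge>D - 1. Polynomial.coeff g i = 0"
      by (auto simp: W_def)
    define h where "h = monom 1 (D - 1) - g"
    have "h \<star> x = 0"
      using g(1) by (simp add: h_def act_diff_left act_monom)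
    then have "d dvd h"
      using dvd_if_act_zero[OF \<pi>(2) \<open>e > 0\<close>] x unfolding d_def by blast
    moreover have "Polynomial.coeff h (D - 1) = 1"
      using g(2) by (simp add: h_def)
    moreover have "Polynomial.degree h \<le> D - 1"
      using g(2) by (intro degree_le) (auto simp: h_def)
    ultimately show False
      using dvd_imp_degree_le[of d h] D(2) by (cases "h = 0") (auto simp: D_def)
  qed
  moreover have "finite S" "S \<subseteq> U"
    using uU by (auto simp: S_def)
  ultimately have "\<exists>y\<in>U. (\<forall>s\<in>S. b s y = 0) \<and> b ((u ^^ (D - 1)) x) y \<noteq> 0"
    using in_span_if_perp_perp[OF _ _ U(1,3) uU[of "D - 1"], of S] by blast
  then obtain y1 where y1: "y1 \<in> U" "\<And>s. s \<in> S \<Longrightarrow> b s y1 = 0" "b ((u ^^ (D - 1)) x) y1 \<noteq> 0"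
    by blast
  define y0 where "y0 = inverse (b ((u ^^ (D - 1)) x) y1) *s y1"
  have "y0 \<in> U"
    using y1 U by (auto simp: y0_def intro: subspace_scale)
  have y0: "b ((u ^^ i) x) y0 = (if i = D - 1 then 1 else 0)" if "i \<le> D - 1" for i
    using y1 that by (auto simp: y0_def S_def b_scale_right)
  have by0: "b (f \<star> x) y0 = top_coeff_mod d f" for f
  proof -
    have "Polynomial.degree (f mod d) \<le> D - 1"
      using D(2) degree_mod_less[of d f] by (cases "d = 0"; cases "f mod d = 0") (auto simp: D_def)
    then have "f \<star> x = (\<Sum>i\<le>D - 1. Polynomial.coeff (f mod d) i *s (u ^^ i) x)"
      using act_mod[OF x(3)] act_bound by metis
    then have "b (f \<star> x) y0 = (\<Sum>i\<le>D - 1. Polynomial.coeff (f mod d) i * (if i = D - 1 then 1 else 0))"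
      using y0 by (simp add: b_sum_left b_scale_left)
    also have "\<dots> = Polynomial.coeff (f mod d) (D - 1)"
      by (subst sum.remove[of _ "D - 1"]) auto
    finally show ?thesis by (simp add: top_coeff_mod_def D_def)
  qed
  \<comment> \<open>The polynomial \<open>r * m'\<close> is 1 modulo \<open>d\<close> and 0 modulo
    \<open>m'\<close>: it projects onto the \<open>\<pi>\<close>-primary component. So
    \<open>y\<close> is killed by \<open>d\<close> and pairs with the multiples of \<open>x\<close>
    as \<open>y0\<close> does.\<close>
  have "bezout_unit m' d"
    unfolding d_def by (intro bezout_unit_sym[OF bezout_unit_power] bezout_unit_irreducible \<pi> m')
  then obtain r s where rs: "r * m' + s * d = 1"
    by (auto simp: bezout_unit_def)
  define y where "y = (r * m') \<star> y0"
  have "y \<in> U"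
    using act_invariant[OF U(1,2) \<open>y0 \<in> U\<close>] by (auto simp: y_def)
  moreover have "d \<star> y = 0"
  proof -
    have "d \<star> y = r \<star> M \<star> y0"
      by (simp add: y_def m' d_def mult_ac flip: act_mult)
    then show ?thesis using M(1) \<open>y0 \<in> U\<close> by simp
  qed
  moreover have "b (f \<star> x) y = top_coeff_mod d f" for f
  proof -
    have "b (f \<star> x) y = top_coeff_mod d (r * m' * f)"
      unfolding y_def by (simp flip: b_act by0 act_mult)
    also have "\<dots> = top_coeff_mod d f"
    proof (rule top_coeff_mod_cong)
      have "r * m' * f - f = (r * m' - (r * m' + s * d)) * f"
        by (simp add: rs left_diff_distrib)
      then show "d dvd r * m' * f - f" by simp
    qed
    finally show ?thesis .
  qed
  ultimately show ?thesis
    using \<pi> \<open>e > 0\<close> x unfolding d_def by blast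
qed

end

section \<open>Structure of symplectic pairs\<close>

context symplectic_endo
begin

text \<open>The block generated by \<open>x\<close> and \<open>y\<close> is nondegenerate, so it
  splits off orthogonally: the pairings of \<open>v\<close> with the block are represented by
  polynomials, which give the component of \<open>v\<close> to be subtracted.\<close>

lemma block_complement:
  assumes U: "subspace U" "\<And>v. v \<in> U \<Longrightarrow> u v \<in> U" "nondegenerate_on U"
    and xy: "x \<in> U" "y \<in> U" "d \<star> x = 0" "d \<star> y = 0" "Polynomial.degree d > 0"
    and pairing: "\<And>f. b (f \<star> x) y = top_coeff_mod d f"
  defines "U' \<equiv> {v \<in> U. \<forall>f. b (f \<star> x) v = 0 \<and> b (f \<star> y) v = 0}"
  shows "subspace U'" "\<And>v. v \<in> U' \<Longrightarrow> u v \<in> U'" "nondegenerate_on U'" "x \<notin> U'"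
    and "\<And>v. v \<in> U \<Longrightarrow> \<exists>f g. v - (f \<star> x + g \<star> y) \<in> U'"
proof -
  show "subspace U'"
    using U(1) by (auto simp: U'_def subspace_def b_add_right b_scale_right)
  show "u v \<in> U'" if "v \<in> U'" for v
  proof -
    have "b (f \<star> x) (u v) = b (pCons 0 f \<star> x) v" "b (f \<star> y) (u v) = b (pCons 0 f \<star> y) v" for f
      by (simp_all add: act_pCons b_u)
    with that show ?thesis
      unfolding U'_def using U(2) by auto
  qed
  have pairing': "b (f \<star> x) (g \<star> y) = top_coeff_mod d (f * g)" for f g
    using pairing[of "f * g"] by (simp add: act_mult b_act act_commute[of f g])
  have decomp: "\<exists>f g. v - (f \<star> x + g \<star> y) \<in> U'" if v: "v \<in> U" for v
  proof -
    have dv: "b (f \<star> w) v = 0" if "d dvd f" "d \<star> w = 0" for f w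
      using act_dvd[OF that] by simp
    obtain g where g: "\<And>h. b (h \<star> x) v = top_coeff_mod d (h * g)"
      using top_coeff_mod_represents[of "\<lambda>h. b (h \<star> x) v" d] dv xy
      by (auto simp: act_add_left act_smult b_add_left b_scale_left)
    obtain f where f: "\<And>h. b (h \<star> y) v = top_coeff_mod d (h * f)"
      using top_coeff_mod_represents[of "\<lambda>h. b (h \<star> y) v" d] dv xy
      by (auto simp: act_add_left act_smult b_add_left b_scale_left)
    \<comment> \<open>The coefficient of \<open>x\<close> is \<open>- f\<close>, because pairing
      \<open>y\<close> with \<open>x\<close> instead of \<open>x\<close> with \<open>y\<close>
      changes the sign.\<close>
    have "b (h \<star> x) (v - (- f \<star> x + g \<star> y)) = 0" for h
      by (simp add: b_diff_right b_add_right pairing' b_act_self g)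
    moreover have "b (h \<star> y) (- f \<star> x) = top_coeff_mod d (h * f)" for h
      by (subst b_skew) (simp add: act_minus_left b_minus_left pairing' mult.commute)
    then have "b (h \<star> y) (v - (- f \<star> x + g \<star> y)) = 0" for h
      by (simp add: b_diff_right b_add_right b_act_self f)
    moreover have "v - (- f \<star> x + g \<star> y) \<in> U"
      using v xy U act_invariant[OF U(1,2)] by (intro subspace_diff subspace_add) auto
    ultimately show ?thesis
      unfolding U'_def by blast
  qed
  then show "\<exists>f g. v - (f \<star> x + g \<star> y) \<in> U'" if "v \<in> U" for v
    using that .
  show "nondegenerate_on U'"
    unfolding nondegenerate_on_def
  proof (intro ballI impI)
    fix v assume v: "v \<in> U'" "\<forall>w\<in>U'. b v w = 0"
    have "b v w = 0" if w: "w \<in> U" for w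
    proof -
      obtain f g where "w - (f \<star> x + g \<star> y) \<in> U'"
        using decomp[OF w] by blast
      then have "b v (w - (f \<star> x + g \<star> y)) = 0"
        using v(2) by blast
      moreover have "b v (f \<star> x) = 0" "b v (g \<star> y) = 0"
        using v(1) b_skew[of v] by (auto simp: U'_def)
      ultimately show ?thesis
        by (simp add: b_diff_right b_add_right)
    qed
    then show "v = 0"
      using v(1) U(3) by (auto simp: U'_def nondegenerate_on_def)
  qed
  show "x \<notin> U'"
  proof
    assume "x \<in> U'"
    then have "b (f \<star> y) x = 0" for f
      by (auto simp: U'_def)
    then have "b x (f \<star> y) = 0" for f
      using b_skew[of x "f \<star> y"] by simp
    then have "top_coeff_mod d (1 * f) = 0" for f
      using pairing'[of 1 f] by simp
    then have "d dvd 1"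
      by (rule top_coeff_mod_nondegenerate[OF xy(5)])
    then show False
      using xy(5) is_unit_iff_degree[of d] by (cases "d = 0") auto
  qed
qed

text \<open>The analogue over F[u] of a symplectic basis. Directness of the sum of the cyclic
  submodules is not stated; \<open>symplectic_generators_kernel\<close> derives it from the
  pairings.\<close>

definition symplectic_generators ::
  "'v set \<Rightarrow> nat \<Rightarrow> (nat \<Rightarrow> 'a poly) \<Rightarrow> (nat \<Rightarrow> 'v) \<Rightarrow> (nat \<Rightarrow> 'v) \<Rightarrow> bool" where
  "symplectic_generators U n d x y \<longleftrightarrow>
    (\<forall>i<n. \<exists>\<pi> e. Polynomial.lead_coeff \<pi> = 1 \<and> Factorial_Ring.irreducible \<pi> \<and> e > 0 \<and> d i = \<pi> ^ e) \<and>
    (\<forall>i<n. x i \<in> U \<and> y i \<in> U \<and> d i \<star> x i = 0 \<and> d i \<star> y i = 0) \<and>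
    (\<forall>v\<in>U. \<exists>f g. v = (\<Sum>i<n. f i \<star> x i + g i \<star> y i)) \<and>
    (\<forall>i<n. \<forall>j<n. \<forall>f. b (f \<star> x i) (x j) = 0 \<and> b (f \<star> y i) (y j) = 0 \<and>
      b (f \<star> x i) (y j) = (if i = j then top_coeff_mod (d i) f else 0))"

text \<open>Induction on the dimension: after a block is split off, its orthogonal complement is
  again stable under \<open>u\<close> and nondegenerate.\<close>

theorem symplectic_generators_exist:
  assumes "subspace U" "\<And>v. v \<in> U \<Longrightarrow> u v \<in> U" "nondegenerate_on U"
  shows "\<exists>n d x y. symplectic_generators U n d x y"
  using assms
proof (induction "dim U" arbitrary: U rule: less_induct)
  case less
  note U = less.prems
  show ?case
  proof (cases "U = {0}")
    case True
    then have "symplectic_generators U 0 d x y" for d x y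
      by (auto simp: symplectic_generators_def)
    then show ?thesis by blast
  next
    case False
    obtain \<pi> e xn yn where blk: "Polynomial.lead_coeff \<pi> = 1" "Factorial_Ring.irreducible \<pi>" "e > 0"
      "xn \<in> U" "yn \<in> U" "\<pi> ^ e \<star> xn = 0" "\<pi> ^ e \<star> yn = 0"
      "\<And>f. b (f \<star> xn) yn = top_coeff_mod (\<pi> ^ e) f"
      using symplectic_block_exists[OF U False] by blast
    define dn where "dn = \<pi> ^ e"
    have "Polynomial.degree dn > 0"
      using degree_irreducible_pos[OF blk(2)] blk(3) unfolding dn_def
      by (metis degree_0 degree_power_eq less_irrefl nat_0_less_mult_iff)
    define U' where "U' = {v \<in> U. \<forall>f. b (f \<star> xn) v = 0 \<and> b (f \<star> yn) v = 0}"
    note compl = block_complement[OF U blk(4-7)[folded dn_def] \<open>Polynomial.degree dn > 0\<close>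
        blk(8)[folded dn_def], folded U'_def]
    have "U' \<subseteq> U" by (auto simp: U'_def)
    have "dim U' < dim U"
      using compl(1,4) U(1) \<open>U' \<subseteq> U\<close> blk(4) by (metis not_less subspace_dim_equal)
    from less.hyps[OF this compl(1-3)] obtain n d x y where
      gens: "symplectic_generators U' n d x y" by blast
    have "symplectic_generators U (Suc n) (d(n := dn)) (x(n := xn)) (y(n := yn))"
      unfolding symplectic_generators_def
    proof (intro conjI)
      show "\<forall>i<Suc n. \<exists>\<pi> e. Polynomial.lead_coeff \<pi> = 1 \<and> Factorial_Ring.irreducible \<pi> \<and> e > 0 \<and>
          (d(n := dn)) i = \<pi> ^ e"
        using gens blk(1-3) by (auto simp: symplectic_generators_def less_Suc_eq dn_def)
      show "\<forall>i<Suc n. (x(n := xn)) i \<in> U \<and> (y(n := yn)) i \<in> U \<and>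
          (d(n := dn)) i \<star> (x(n := xn)) i = 0 \<and> (d(n := dn)) i \<star> (y(n := yn)) i = 0"
        using gens blk(4-7) \<open>U' \<subseteq> U\<close> by (auto simp: symplectic_generators_def less_Suc_eq dn_def)
      show "\<forall>v\<in>U. \<exists>f g. v = (\<Sum>i<Suc n. f i \<star> (x(n := xn)) i + g i \<star> (y(n := yn)) i)"
      proof
        fix v assume "v \<in> U"
        then obtain fn gn where "v - (fn \<star> xn + gn \<star> yn) \<in> U'"
          using compl(5) by blast
        then obtain f g where fg: "v - (fn \<star> xn + gn \<star> yn) = (\<Sum>i<n. f i \<star> x i + g i \<star> y i)"
          using gens unfolding symplectic_generators_def by blast
        then have "v = (\<Sum>i<n. f i \<star> x i + g i \<star> y i) + (fn \<star> xn + gn \<star> yn)"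
          by (metis diff_add_cancel)
        then have "v = (\<Sum>i<Suc n. (f(n := fn)) i \<star> (x(n := xn)) i + (g(n := gn)) i \<star> (y(n := yn)) i)"
          by simp
        then show "\<exists>f g. v = (\<Sum>i<Suc n. f i \<star> (x(n := xn)) i + g i \<star> (y(n := yn)) i)"
          by blast
      qed
      have U'x: "b (f \<star> xn) w = 0" "b (f \<star> yn) w = 0" "b (f \<star> w) xn = 0" "b (f \<star> w) yn = 0"
        if "w \<in> U'" for f w
        using that b_skew[of w] by (auto simp: U'_def b_act)
      show "\<forall>i<Suc n. \<forall>j<Suc n. \<forall>f. b (f \<star> (x(n := xn)) i) ((x(n := xn)) j) = 0 \<and>
          b (f \<star> (y(n := yn)) i) ((y(n := yn)) j) = 0 \<and>
          b (f \<star> (x(n := xn)) i) ((y(n := yn)) j) =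
            (if i = j then top_coeff_mod ((d(n := dn)) i) f else 0)"
        using gens U'x blk(8) b_act_self[of _ _ 1]
        by (auto simp: symplectic_generators_def less_Suc_eq dn_def)
    qed
    then show ?thesis by blast
  qed
qed

text \<open>Pairing the relation with multiples of \<open>y i\<close> isolates \<open>f i\<close>,
  pairing it with multiples of \<open>x i\<close> isolates \<open>g i\<close>; nondegeneracy of
  \<open>top_coeff_mod\<close> gives the divisibility.\<close>

lemma symplectic_generators_kernel:
  assumes gens: "symplectic_generators U n d x y"
    and zero: "(\<Sum>i<n. f i \<star> x i + g i \<star> y i) = 0" and "i < n"
  shows "d i dvd f i \<and> d i dvd g i"
proof -
  obtain \<pi> e where \<pi>: "Factorial_Ring.irreducible \<pi>" "e > 0" "d i = \<pi> ^ e"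
    using gens \<open>i < n\<close> unfolding symplectic_generators_def by blast
  then have deg: "Polynomial.degree (d i) > 0"
    using degree_irreducible_pos[OF \<pi>(1)] by (metis degree_0 degree_power_eq less_irrefl nat_0_less_mult_iff)
  have form: "b (p \<star> x j) (q \<star> x k) = 0" "b (p \<star> y j) (q \<star> y k) = 0"
    "b (p \<star> x j) (q \<star> y k) = (if j = k then top_coeff_mod (d j) (p * q) else 0)"
    if "j < n" "k < n" for p q j k
  proof -
    have *: "b (p \<star> v) (q \<star> w) = b ((p * q) \<star> v) w" for v w
      by (simp add: act_mult b_act act_commute[of p])
    show "b (p \<star> x j) (q \<star> x k) = 0" "b (p \<star> y j) (q \<star> y k) = 0"
      "b (p \<star> x j) (q \<star> y k) = (if j = k then top_coeff_mod (d j) (p * q) else 0)"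
      unfolding * using gens that unfolding symplectic_generators_def by blast+
  qed
  have "top_coeff_mod (d i) (f i * h) = 0" for h
  proof -
    have "0 = b (\<Sum>j<n. f j \<star> x j + g j \<star> y j) (h \<star> y i)"
      by (simp add: zero)
    also have "\<dots> = (\<Sum>j<n. if j = i then top_coeff_mod (d j) (f j * h) else 0)"
      unfolding b_sum_left using \<open>i < n\<close> by (intro sum.cong) (auto simp: b_add_left form)
    also have "\<dots> = top_coeff_mod (d i) (f i * h)"
      using \<open>i < n\<close> by simp
    finally show ?thesis by simp
  qed
  moreover have "top_coeff_mod (d i) (g i * h) = 0" for h
  proof -
    have "0 = b (h \<star> x i) (\<Sum>j<n. f j \<star> x j + g j \<star> y j)"
      by (simp add: zero)
    also have "\<dots> = (\<Sum>j<n. if i = j then top_coeff_mod (d i) (h * g j) else 0)"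
      unfolding b_sum_right using \<open>i < n\<close> by (intro sum.cong) (auto simp: b_add_right form)
    also have "\<dots> = top_coeff_mod (d i) (g i * h)"
      using \<open>i < n\<close> by (simp add: mult.commute)
    finally show ?thesis by simp
  qed
  ultimately show ?thesis
    using top_coeff_mod_nondegenerate[OF deg] by blast
qed

text \<open>Each block contributes its \<open>d i\<close> twice, through \<open>x i\<close> and
  through \<open>y i\<close>. This turns divisibility by 4 of a cell count into evenness of a number
  of blocks.\<close>

lemma elementary_divisor_list_symplectic:
  assumes gens: "symplectic_generators UNIV n d x y"
  shows "elementary_divisor_list scale u (map d [0..<n] @ map d [0..<n])"
  unfolding elementary_divisor_list_def
proof (intro conjI)
  let ?ds = "map d [0..<n] @ map d [0..<n]"
  show "\<forall>d\<in>set ?ds. \<exists>\<pi> e. Polynomial.lead_coeff \<pi> = 1 \<and> Factorial_Ring.irreducible \<pi> \<and> 0 < e \<and> d = \<pi> ^ e"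
    using gens by (auto simp: symplectic_generators_def)
  define z where "z i = (if i < n then x i else y (i - n))" for i
  have split: "(\<Sum>i<n + n. h i) = (\<Sum>i<n. h i) + (\<Sum>i<n. h (i + n))" for h :: "nat \<Rightarrow> 'v"
    by (simp add: sum.atLeastLessThan_concat[of 0 n "n + n" h, symmetric] lessThan_atLeast0
        sum.shift_bounds_nat_ivl[of h 0 n n, simplified])
  have sum: "(\<Sum>i<length ?ds. f i \<star> z i) = (\<Sum>i<n. f i \<star> x i + f (i + n) \<star> y i)" for f
    by (simp add: split z_def sum.distrib)
  have all: "(\<forall>i<length ?ds. ?ds ! i dvd f i) \<longleftrightarrow> (\<forall>i<n. d i dvd f i \<and> d i dvd f (i + n))" for f
  proof safe
    fix i assume *: "\<forall>i<length ?ds. ?ds ! i dvd f i" "i < n"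
    show "d i dvd f i" "d i dvd f (i + n)"
      using *(1)[rule_format, of i] *(1)[rule_format, of "i + n"] *(2) by (auto simp: nth_append)
  next
    fix i assume *: "\<forall>i<n. d i dvd f i \<and> d i dvd f (i + n)" "i < length ?ds"
    show "?ds ! i dvd f i"
      using *(1)[rule_format, of i] *(1)[rule_format, of "i - n"] *(2) by (auto simp: nth_append)
  qed
  show "\<exists>z. (\<forall>v. \<exists>f. v = (\<Sum>i<length ?ds. f i \<star> z i)) \<and>
      (\<forall>f. ((\<Sum>i<length ?ds. f i \<star> z i) = 0) = (\<forall>i<length ?ds. ?ds ! i dvd f i))"
    unfolding all
  proof (intro exI[of _ z] conjI allI)
    fix v
    obtain f g where "v = (\<Sum>i<n. f i \<star> x i + g i \<star> y i)"
      using gens unfolding symplectic_generators_def by blast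
    then have "v = (\<Sum>i<length ?ds. (\<lambda>i. if i < n then f i else g (i - n)) i \<star> z i)"
      unfolding sum by simp
    then show "\<exists>f. v = (\<Sum>i<length ?ds. f i \<star> z i)"
      by (rule exI[of _ "\<lambda>i. if i < n then f i else g (i - n)"])
  next
    fix f
    show "((\<Sum>i<length ?ds. f i \<star> z i) = 0) = (\<forall>i<n. d i dvd f i \<and> d i dvd f (i + n))"
      unfolding sum
    proof
      assume "(\<Sum>i<n. f i \<star> x i + f (i + n) \<star> y i) = 0"
      then show "\<forall>i<n. d i dvd f i \<and> d i dvd f (i + n)"
        using symplectic_generators_kernel[OF gens, of f "\<lambda>i. f (i + n)"] by blast
    next
      assume "\<forall>i<n. d i dvd f i \<and> d i dvd f (i + n)"
      then show "(\<Sum>i<n. f i \<star> x i + f (i + n) \<star> y i) = 0"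
        using gens act_dvd by (intro sum.neutral) (auto simp: symplectic_generators_def)
    qed
  qed
qed

end

section \<open>Counting Jordan cells\<close>

context vector_space
begin

lemma span_Un_image_cases:
  assumes "finite J" "subspace T" "v \<in> span (T \<union> x ` J)"
  shows "\<exists>t\<in>T. \<exists>c. v = t + (\<Sum>i\<in>J. c i *s x i)"
  using assms(1,3)
proof (induction J arbitrary: v rule: finite_induct)
  case empty
  then show ?case
    using assms(2) by (metis Un_empty_right add.right_neutral image_empty span_eq_iff sum.empty)
next
  case (insert j J)
  then have "v \<in> span (insert (x j) (T \<union> x ` J))"
    by simp
  then obtain k where "v - k *s x j \<in> span (T \<union> x ` J)"
    by (auto simp: span_breakdown_eq)
  then obtain t c where "t \<in> T" "v - k *s x j = t + (\<Sum>i\<in>J. c i *s x i)"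
    using insert.IH by blast
  then have "v = t + (\<Sum>i\<in>insert j J. (c(j := k)) i *s x i)"
    using insert.hyps by (simp add: algebra_simps cong: sum.cong_simp) (auto intro!: sum.cong)
  with \<open>t \<in> T\<close> show ?case by blast
qed

end

context finite_dimensional_vector_space
begin

lemma dim_Un_image:
  assumes "finite J" "subspace T"
    and "\<And>c. (\<Sum>i\<in>J. c i *s x i) \<in> T \<Longrightarrow> \<forall>i\<in>J. c i = 0"
  shows "dim (T \<union> x ` J) = dim T + card J"
  using assms(1,3)
proof (induction J rule: finite_induct)
  case (insert j J)
  have "\<forall>i\<in>J. c i = 0" if "(\<Sum>i\<in>J. c i *s x i) \<in> T" for c
  proof -
    have "(\<Sum>i\<in>insert j J. (c(j := 0)) i *s x i) = (\<Sum>i\<in>J. c i *s x i)"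
      using insert.hyps by (auto intro!: sum.cong)
    then show ?thesis
      using insert.prems[of "c(j := 0)"] insert.hyps that by (auto split: if_splits)
  qed
  then have IH: "dim (T \<union> x ` J) = dim T + card J"
    by (rule insert.IH)
  have "x j \<notin> span (T \<union> x ` J)"
  proof
    assume "x j \<in> span (T \<union> x ` J)"
    then obtain t c where tc: "t \<in> T" "x j = t + (\<Sum>i\<in>J. c i *s x i)"
      using span_Un_image_cases[OF insert.hyps(1) assms(2)] by blast
    have "(\<Sum>i\<in>insert j J. ((\<lambda>i. - c i)(j := 1)) i *s x i) = x j - (\<Sum>i\<in>J. c i *s x i)"
      using insert.hyps by (simp flip: sum_negf) (auto intro!: sum.cong)
    also have "\<dots> = t"
      by (subst tc(2)) simp
    finally show False
      using insert.prems[of "(\<lambda>i. - c i)(j := 1)"] tc(1) by auto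
  qed
  then show ?case
    using insert.hyps by (simp add: dim_insert IH)
qed simp

end

context fd_endo
begin

definition kernel :: "'a poly \<Rightarrow> 'v set" where
  "kernel f = {v. f \<star> v = 0}"

text \<open>With w = u - z this is ker w^(k-1) + w ker w^(k+1). For positive \<open>k\<close> it
  lies in ker w^k, and its codimension there is the number of cells of size \<open>k\<close>. It
  depends on \<open>u\<close> only, not on a list of elementary divisors.\<close>

definition jordan_radical :: "'a \<Rightarrow> nat \<Rightarrow> 'v set" where
  "jordan_radical z k = {v + [:- z, 1:] \<star> w | v w. v \<in> kernel ([:- z, 1:] ^ (k - 1)) \<and>
    w \<in> kernel ([:- z, 1:] ^ Suc k)}"

lemma subspace_kernel: "subspace (kernel f)"
  by (auto simp: subspace_def kernel_def act_add_right act_scale)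

lemma subspace_jordan_radical: "subspace (jordan_radical z k)"
proof -
  have "jordan_radical z k = {a + c | a c. a \<in> kernel ([:- z, 1:] ^ (k - 1)) \<and>
      c \<in> (\<star>) [:- z, 1:] ` kernel ([:- z, 1:] ^ Suc k)}"
    unfolding jordan_radical_def by blast
  moreover have "subspace ((\<star>) [:- z, 1:] ` kernel ([:- z, 1:] ^ Suc k))"
  proof -
    have "Vector_Spaces.linear scale scale ((\<star>) [:- z, 1:])"
      by (simp add: Vector_Spaces.linear_iff vector_space_axioms act_add_right act_scale)
    then interpret vector_space_pair_linear: Vector_Spaces.linear scale scale "(\<star>) [:- z, 1:]" .
    show ?thesis
      by (rule vector_space_pair_linear.subspace_image[OF subspace_kernel])
  qed
  ultimately show ?thesis
    using subspace_sums[OF subspace_kernel] by simp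
qed

lemma jordan_radical_subset_kernel:
  assumes "k > 0"
  shows "jordan_radical z k \<subseteq> kernel ([:- z, 1:] ^ k)"
proof
  let ?w = "[:- z, 1:]"
  fix x assume "x \<in> jordan_radical z k"
  then obtain v v' where *: "x = v + ?w \<star> v'" "?w ^ (k - 1) \<star> v = 0" "?w ^ Suc k \<star> v' = 0"
    unfolding jordan_radical_def kernel_def by blast
  have "?w ^ k \<star> ?w \<star> v' = 0"
    using *(3) unfolding power_Suc2 act_mult .
  moreover have "?w ^ k \<star> v = 0"
    using *(2) by (rule act_dvd[rotated]) (simp add: le_imp_power_dvd)
  ultimately show "x \<in> kernel (?w ^ k)"
    by (simp only: kernel_def *(1) act_add_right mem_Collect_eq add_0)
qed

text \<open>The generators whose elementary divisor is exactly \<open>w ^ k\<close> form a basis of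
  ker w^k modulo the radical; the other summands contribute to the radical only.\<close>

lemma count_elementary_divisors:
  assumes ds: "elementary_divisor_list scale u ds" and "k > 0"
  shows "dim (kernel ([:- z, 1:] ^ k)) = dim (jordan_radical z k) + count (mset ds) ([:- z, 1:] ^ k)"
proof -
  define w where "w = [:- z, 1:]"
  let ?n = "length ds"
  have power: "\<exists>\<pi> e. Polynomial.lead_coeff \<pi> = 1 \<and> Factorial_Ring.irreducible \<pi> \<and> e > 0 \<and> ds ! i = \<pi> ^ e"
    if "i < ?n" for i
    using ds that unfolding elementary_divisor_list_def by auto
  obtain x where spanning: "\<And>v. \<exists>f. v = (\<Sum>i<?n. f i \<star> x i)"
    and ker: "\<And>f. (\<Sum>i<?n. f i \<star> x i) = 0 \<longleftrightarrow> (\<forall>i<?n. ds ! i dvd f i)"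
    using ds unfolding elementary_divisor_list_def by blast
  have zero: "f \<star> x i = 0" if "i < ?n" "ds ! i dvd f" for f i
  proof -
    have "(\<Sum>j<?n. (if j = i then f else 0) \<star> x j) = 0"
      using that by (subst ker) auto
    moreover have "(\<Sum>j<?n. (if j = i then f else 0) \<star> x j) = (\<Sum>j<?n. if j = i then f \<star> x i else 0)"
      by (intro sum.cong) auto
    ultimately show ?thesis
      using that by simp
  qed
  define J where "J = {i. i < ?n \<and> ds ! i = w ^ k}"
  define T where "T = jordan_radical z k"
  note T = subspace_jordan_radical[of z k, folded T_def]
  have T1: "v \<in> T" if "w ^ (k - 1) \<star> v = 0" for v
    unfolding T_def jordan_radical_def kernel_def using that
    by (intro CollectI exI[of _ v] exI[of _ 0]) (simp add: w_def)
  have T2: "w \<star> v \<in> T" if "w ^ Suc k \<star> v = 0" for v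
    unfolding T_def jordan_radical_def kernel_def using that
    by (intro CollectI exI[of _ 0] exI[of _ v]) (simp add: w_def del: power_Suc)
  have "finite J" by (simp add: J_def)
  \<comment> \<open>The component vanishes if \<open>\<pi>\<close> does not divide \<open>w\<close>.
    Otherwise the summand is a cell of size \<open>e\<close>: for \<open>e < k\<close> the component
    is in ker w^(k-1), for \<open>e = k\<close> it is f(z) times the generator modulo the radical,
    and for \<open>e > k\<close> it is \<open>w\<close> times an element of ker w^(k+1).\<close>
  have component: "\<exists>t c. t \<in> T \<and> f \<star> x i = t + (if i \<in> J then c *s x i else 0)"
    if i: "i < ?n" and f: "ds ! i dvd w ^ k * f" for i f
  proof -
    have inT: ?thesis if "f \<star> x i \<in> T"
      by (intro exI[of _ "f \<star> x i"] exI[of _ 0]) (use that in auto)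
    obtain \<pi> e where \<pi>: "Polynomial.lead_coeff \<pi> = 1" "Factorial_Ring.irreducible \<pi>" "ds ! i = \<pi> ^ e"
      using power[OF i] by blast
    show ?thesis
    proof (cases "\<pi> dvd w")
      case False
      have "bezout_unit (w ^ k) (\<pi> ^ e)"
        by (rule bezout_unit_power[OF bezout_unit_sym[OF bezout_unit_power[OF
              bezout_unit_irreducible[OF \<pi>(2) False]]]])
      then have "bezout_unit (\<pi> ^ e) (w ^ k)"
        by (rule bezout_unit_sym)
      then have "ds ! i dvd f"
        using bezout_unit_dvd f \<pi>(3) by metis
      then have "f \<star> x i = 0" by (rule zero[OF i])
      then show ?thesis using inT subspace_0[OF T] by simp
    next
      case True
      then obtain c where c: "w = \<pi> * c" by (elim dvdE)
      have nz: "\<pi> \<noteq> 0" "c \<noteq> 0" using c by (auto simp: w_def)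
      then have "Polynomial.degree \<pi> + Polynomial.degree c = 1"
        using arg_cong[OF c, of Polynomial.degree] by (simp add: degree_mult_eq w_def)
      then have "Polynomial.degree c = 0"
        using degree_irreducible_pos[OF \<pi>(2)] by simp
      moreover have "Polynomial.lead_coeff c = 1"
        using arg_cong[OF c, of Polynomial.lead_coeff] \<pi>(1) by (simp add: w_def lead_coeff_mult)
      ultimately have "c = 1"
        by (metis degree_eq_zeroE lead_coeff_pCons(2) one_pCons)
      with c \<pi>(3) have di: "ds ! i = w ^ e" by simp
      consider "e < k" | "e = k" | "e > k" by linarith
      then show ?thesis
      proof cases
        case 1
        then have "ds ! i dvd w ^ (k - 1) * f"
          unfolding di by (intro dvd_mult2 le_imp_power_dvd) simp
        then have "w ^ (k - 1) \<star> f \<star> x i = 0"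
          by (simp only: zero[OF i] flip: act_mult)
        then show ?thesis using inT T1 by blast
      next
        case 2
        define c where "c = poly f z"
        have "w dvd f - [:c:]"
          by (simp add: w_def c_def flip: poly_eq_0_iff_dvd)
        then obtain g where g: "f = [:c:] + w * g"
          by (metis add.commute diff_add_cancel dvdE)
        have "w ^ Suc k \<star> g \<star> x i = 0"
        proof -
          have "ds ! i dvd w ^ Suc k * g"
            unfolding di 2 by (simp add: dvd_mult2)
          then show ?thesis by (simp only: zero[OF i] flip: act_mult)
        qed
        then have "w \<star> g \<star> x i \<in> T" by (rule T2)
        moreover have "f \<star> x i = w \<star> g \<star> x i + c *s x i"
          by (simp only: g act_add_left act_mult act_const add.commute)
        moreover have "i \<in> J" using i di 2 by (simp add: J_def)
        ultimately show ?thesis by auto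
      next
        case 3
        then have "w ^ e = w ^ k * w ^ (e - k)"
          by (simp flip: power_add)
        then have "w ^ (e - k) dvd f"
          using f nz c by (simp add: di)
        moreover have "w dvd w ^ (e - k)"
          using 3 by (intro dvd_power) simp
        ultimately obtain g where g: "f = w * g"
          by (metis dvd_trans dvdE)
        have "ds ! i dvd w ^ Suc k * g"
          using f by (simp add: g mult_ac)
        then have "w ^ Suc k \<star> g \<star> x i = 0"
          by (simp only: zero[OF i] flip: act_mult)
        then have "w \<star> g \<star> x i \<in> T" by (rule T2)
        then show ?thesis
          using inT by (simp add: g act_mult)
      qed
    qed
  qed
  have "span (T \<union> x ` J) = kernel (w ^ k)"
  proof (rule span_subspace)
    have "x i \<in> kernel (w ^ k)" if "i \<in> J" for i
      using that zero[of i "w ^ k"] by (simp add: J_def kernel_def)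
    then show "T \<union> x ` J \<subseteq> kernel (w ^ k)"
      using jordan_radical_subset_kernel[OF \<open>k > 0\<close>, of z] by (auto simp: T_def w_def)
    show "subspace (kernel (w ^ k))" by (rule subspace_kernel)
    show "kernel (w ^ k) \<subseteq> span (T \<union> x ` J)"
    proof
      fix v assume "v \<in> kernel (w ^ k)"
      obtain f where f: "v = (\<Sum>i<?n. f i \<star> x i)"
        using spanning by blast
      have "(\<Sum>i<?n. (w ^ k * f i) \<star> x i) = w ^ k \<star> v"
        by (simp add: f act_sum_right act_mult)
      then have dvd: "\<forall>i<?n. ds ! i dvd w ^ k * f i"
        using \<open>v \<in> kernel (w ^ k)\<close> ker[of "\<lambda>i. w ^ k * f i"] by (simp add: kernel_def)
      have "f i \<star> x i \<in> span (T \<union> x ` J)" if i: "i < ?n" for i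
      proof -
        obtain t c where "t \<in> T" "f i \<star> x i = t + (if i \<in> J then c *s x i else 0)"
          using component[OF i] dvd i by blast
        then show ?thesis
          by (auto intro: span_add span_scale span_base)
      qed
      then show "v \<in> span (T \<union> x ` J)"
        unfolding f by (intro span_sum) auto
    qed
  qed
  then have "dim (kernel (w ^ k)) = dim (T \<union> x ` J)"
    by (metis dim_span)
  \<comment> \<open>Independence modulo the radical: \<open>w\<close> divides \<open>f i\<close>, so
    the relation read in the summand of \<open>i\<close> modulo \<open>w\<close> leaves only the
    constant \<open>c i\<close>.\<close>
  also have "\<dots> = dim T + card J"
  proof (rule dim_Un_image[OF \<open>finite J\<close> T])
    fix c assume "(\<Sum>i\<in>J. c i *s x i) \<in> T"
    then obtain v1 v2 where v: "(\<Sum>i\<in>J. c i *s x i) = v1 + w \<star> v2" "w ^ (k - 1) \<star> v1 = 0"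
      unfolding T_def jordan_radical_def kernel_def w_def by blast
    obtain f g where fg: "v1 = (\<Sum>i<?n. f i \<star> x i)" "v2 = (\<Sum>i<?n. g i \<star> x i)"
      using spanning by metis
    have "(\<Sum>i<?n. (w ^ (k - 1) * f i) \<star> x i) = w ^ (k - 1) \<star> v1"
      by (simp add: fg act_sum_right act_mult)
    then have 1: "\<forall>i<?n. ds ! i dvd w ^ (k - 1) * f i"
      using ker[of "\<lambda>i. w ^ (k - 1) * f i"] v(2) by simp
    have "(\<Sum>i\<in>J. c i *s x i) = (\<Sum>i<?n. (if i \<in> J then [:c i:] else 0) \<star> x i)"
      by (rule sum.mono_neutral_cong_left) (auto simp: J_def act_const)
    then have "(\<Sum>i<?n. ((if i \<in> J then [:c i:] else 0) - f i - w * g i) \<star> x i) = 0"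
      using v(1) by (simp add: fg act_diff_left act_mult act_sum_right sum_subtractf diff_eq_eq)
        (simp only: add.commute)
    then have 2: "\<forall>i<?n. ds ! i dvd (if i \<in> J then [:c i:] else 0) - f i - w * g i"
      using ker[of "\<lambda>i. (if i \<in> J then [:c i:] else 0) - f i - w * g i"] by simp
    show "\<forall>i\<in>J. c i = 0"
    proof
      fix i assume "i \<in> J"
      then have i: "i < ?n" "ds ! i = w ^ k" by (auto simp: J_def)
      have wk: "w ^ k = w ^ (k - 1) * w"
        using \<open>k > 0\<close> by (metis Suc_diff_1 power_Suc2)
      have "w ^ (k - 1) * w dvd w ^ (k - 1) * f i"
        using 1 i wk by metis
      then have "w dvd f i"
        by (subst (asm) dvd_mult_cancel_left) (auto simp: w_def)
      moreover have "w ^ k dvd [:c i:] - f i - w * g i"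
        using 2[rule_format, of i] i \<open>i \<in> J\<close> by simp
      then have "w dvd [:c i:] - f i - w * g i"
        unfolding wk by (rule dvd_mult_right)
      ultimately have "w dvd ([:c i:] - f i - w * g i) + f i + w * g i"
        by (intro dvd_add) auto
      then have "w dvd [:c i:]" by simp
      then show "c i = 0"
        by (simp add: w_def flip: poly_eq_0_iff_dvd)
    qed
  qed
  also have "card J = count (mset ds) (w ^ k)"
    by (auto simp: J_def count_mset count_list_eq_length_filter length_filter_conv_card intro!: arg_cong[of _ _ card])
  finally show ?thesis
    by (simp add: T_def w_def)
qed

text \<open>Both dimensions depend on \<open>u\<close> alone, so all lists of elementary divisors
  give the same count, and the multiset picked by choice may be replaced by that of any list at
  hand.\<close>

lemma jordan_cells_eq:
  assumes ds: "elementary_divisor_list scale u ds" and "k > 0"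
  shows "jordan_cells scale u z k = count (mset ds) ([:- z, 1:] ^ k)"
    and "jordan_cells scale u z k = dim (kernel ([:- z, 1:] ^ k)) - dim (jordan_radical z k)"
proof -
  have "\<exists>ds'. elementary_divisor_list scale u ds' \<and> elementary_divisors scale u = mset ds'"
    unfolding elementary_divisors_def by (rule someI_ex) (use ds in blast)
  then obtain ds' where "elementary_divisor_list scale u ds'" "elementary_divisors scale u = mset ds'"
    by blast
  then show "jordan_cells scale u z k = count (mset ds) ([:- z, 1:] ^ k)"
    and "jordan_cells scale u z k = dim (kernel ([:- z, 1:] ^ k)) - dim (jordan_radical z k)"
    using count_elementary_divisors[OF _ \<open>k > 0\<close>, of _ z] ds
    by (metis add_left_cancel jordan_cells_def, metis add_diff_cancel_left' jordan_cells_def)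
qed

end

section \<open>Necessity\<close>

context finite_dimensional_vector_space
begin

lemma dim_functional_kernel:
  assumes "subspace U" "v \<in> U" "\<phi> v \<noteq> (0 :: 'a)"
    and add: "\<And>x y. \<phi> (x + y) = \<phi> x + \<phi> y" and scale: "\<And>c x. \<phi> (c *s x) = c * \<phi> x"
  shows "subspace {x \<in> U. \<phi> x = 0}"
    and "x \<in> U \<Longrightarrow> \<exists>k. x - k *s v \<in> {x \<in> U. \<phi> x = 0}"
    and "dim U = Suc (dim {x \<in> U. \<phi> x = 0})"
proof -
  have zero: "\<phi> 0 = 0" using scale[of 0 0] by simp
  have diff: "\<phi> (x - y) = \<phi> x - \<phi> y" for x y
    using add[of "x - y" y] by simp
  show sub: "subspace {x \<in> U. \<phi> x = 0}"
    using assms(1) by (auto simp: subspace_def add scale zero)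
  show *: "\<exists>k. x - k *s v \<in> {x \<in> U. \<phi> x = 0}" if "x \<in> U" for x
    using that assms(1-3)
    by (intro exI[of _ "\<phi> x / \<phi> v"]) (auto simp: diff scale intro: subspace_diff subspace_scale)
  have "v \<notin> span {x \<in> U. \<phi> x = 0}"
    unfolding span_eq_iff[THEN iffD2, OF sub] using assms(3) by simp
  moreover have "span (insert v {x \<in> U. \<phi> x = 0}) = U"
  proof (rule span_subspace)
    show "U \<subseteq> span (insert v {x \<in> U. \<phi> x = 0})"
      using * by (force simp: span_breakdown_eq intro: span_base)
  qed (use assms in auto)
  ultimately show "dim U = Suc (dim {x \<in> U. \<phi> x = 0})"
    by (metis dim_insert dim_span Suc_eq_plus1)
qed

text \<open>When \<open>p = t\<^sup>2 + P\<^sub>1 t + P\<^sub>0\<close> is irreducible, \<open>a\<close> turns the quotient of \<open>U\<close> by the radical into a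
  vector space over the quadratic extension \<open>F[t]/(p)\<close>, on which \<open>c\<close> lifts to a symplectic form; hence
  the codimension is twice an even number. The induction splits off two lines of this structure
  at a time.\<close>

lemma four_dvd_codim_radical:
  fixes c :: "'b \<Rightarrow> 'b \<Rightarrow> 'a" and a :: "'b \<Rightarrow> 'b"
  assumes U: "subspace U" "\<And>v. v \<in> U \<Longrightarrow> a v \<in> U"
    and c: "\<And>x y z. c (x + y) z = c x z + c y z" "\<And>k x z. c (k *s x) z = k * c x z"
      "\<And>x y z. c x (y + z) = c x y + c x z" "\<And>k x z. c x (k *s z) = k * c x z" "\<And>x. c x x = 0"
    and a: "\<And>x y. c (a x) y = c x (a y)" "\<And>x. c x (a x) = 0"
      "\<And>x. a (a x) = (- P1) *s a x + (- P0) *s x"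
    and irr: "\<And>t. t\<^sup>2 + P1 * t + P0 \<noteq> 0"
  shows "\<exists>m. dim U = dim {x \<in> U. \<forall>y\<in>U. c x y = 0} + 4 * m"
  using U
proof (induction "dim U" arbitrary: U rule: less_induct)
  case less
  note U = less.prems
  show ?case
  proof (cases "\<exists>x\<in>U. \<exists>y\<in>U. c x y \<noteq> 0")
    case False
    then have "{x \<in> U. \<forall>y\<in>U. c x y = 0} = U" by blast
    then show ?thesis by (intro exI[of _ 0]) simp
  next
    case True
    then obtain x y where xy: "x \<in> U" "y \<in> U" "c x y \<noteq> 0" by blast
    have skew: "c v w = - c w v" for v w
    proof -
      have "c (v + w) (v + w) = c v w + c w v"
        unfolding c(1,3) by (simp add: c(5))
      then have "c v w + c w v = 0"
        by (simp only: c(5))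
      then show ?thesis by (simp add: eq_neg_iff_add_eq_0)
    qed
    have diff: "c (v - w) z = c v z - c w z" "c z (v - w) = c z v - c z w" for v w z
      using c(1)[of "v - w" w z] c(3)[of z "v - w" w] by simp_all
    have neg: "c z (- v) = - c z v" for v z
      using c(4)[of z "-1" v] by simp
    define m r where "m = c x y" and "r = c x (a y)"
    have yx: "c y x = - m" "c y (a x) = - r" "c (a y) x = - r"
      using skew[of y x] skew[of "a y" x] a(1)[of y x] by (simp_all add: m_def r_def)
    \<comment> \<open>This is m^2 p(r/m), nonzero because p has no root in the base field. Up to
      sign it is the determinant of the pairings of x, a x with y, a y.\<close>
    have quad: "m * (P1 * r + P0 * m) + r * r \<noteq> 0"
    proof
      assume *: "m * (P1 * r + P0 * m) + r * r = 0"
      have "(r / m)\<^sup>2 + P1 * (r / m) + P0 = (m * (P1 * r + P0 * m) + r * r) / m\<^sup>2"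
        using xy(3) by (simp add: m_def field_simps power2_eq_square)
      with * irr[of "r / m"] show False by simp
    qed
    \<comment> \<open>The orthogonal of x, a x, y, a y in \<open>U\<close>, cut out by one
      functional at a time. The vectors \<open>y\<close>, \<open>v1\<close>, \<open>x\<close>,
      \<open>v3\<close> show in turn that each functional is nonzero on the space reached:
      \<open>v1\<close> is a combination of y, a y orthogonal to x, and \<open>v3\<close> is a
      combination of x, a x orthogonal to y.\<close>
    define U1 where "U1 = {v \<in> U. c v x = 0}"
    define U2 where "U2 = {v \<in> U1. c v (a x) = 0}"
    define U3 where "U3 = {v \<in> U2. c v y = 0}"
    define U4 where "U4 = {v \<in> U3. c v (a y) = 0}"
    define v1 where "v1 = m *s a y - r *s y"
    define v3 where "v3 = m *s a x - r *s x"
    note simps = diff neg c(1-5) a yx m_def[symmetric] r_def[symmetric]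
    have axx: "c (a x) x = 0" "c (a y) y = 0"
      using a(1)[of x x] a(1)[of y y] a(2) by simp_all
    have "v1 \<in> U" "v3 \<in> U"
      using xy U by (auto simp: v1_def v3_def intro!: subspace_diff subspace_scale)
    have 1: "y \<in> U" "c y x \<noteq> 0"
      using xy yx by (auto simp: m_def)
    note step1 = dim_functional_kernel[OF U(1) 1(1), of "\<lambda>v. c v x", OF 1(2) c(1,2), folded U1_def]
    have 2: "v1 \<in> U1" "c v1 (a x) \<noteq> 0"
      using \<open>v1 \<in> U\<close> quad by (auto simp: U1_def v1_def simps algebra_simps)
    note step2 = dim_functional_kernel[OF step1(1) 2(1), of "\<lambda>v. c v (a x)", OF 2(2) c(1,2), folded U2_def]
    have 3: "x \<in> U2" "c x y \<noteq> 0"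
      using xy by (auto simp: U1_def U2_def simps)
    note step3 = dim_functional_kernel[OF step2(1) 3(1), of "\<lambda>v. c v y", OF 3(2) c(1,2), folded U3_def]
    have "c v3 (a y) = - (m * (P1 * r + P0 * m) + r * r)"
      by (simp add: v3_def simps algebra_simps)
    with quad have "c v3 (a y) \<noteq> 0"
      by (simp only: neg_equal_0_iff_equal not_False_eq_True)
    moreover have "v3 \<in> U3"
      using \<open>v3 \<in> U\<close> by (auto simp: U1_def U2_def U3_def v3_def simps axx)
    ultimately have 4: "v3 \<in> U3" "c v3 (a y) \<noteq> 0"
      by simp_all
    note step4 = dim_functional_kernel[OF step3(1) 4(1), of "\<lambda>v. c v (a y)", OF 4(2) c(1,2), folded U4_def]
    have "U4 \<subseteq> U" by (auto simp: U1_def U2_def U3_def U4_def)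
    have dim: "dim U = dim U4 + 4"
      using step1(3) step2(3) step3(3) step4(3) by simp
    have "a v \<in> U4" if "v \<in> U4" for v
      using that U(2) by (auto simp: U1_def U2_def U3_def U4_def a c neg diff)
    then obtain n where n: "dim U4 = dim {x \<in> U4. \<forall>y\<in>U4. c x y = 0} + 4 * n"
      using less.hyps[of U4] step4(1) dim by auto
    \<comment> \<open>The radical is unchanged: \<open>U\<close> is spanned by \<open>U4\<close> and
      \<open>y\<close>, \<open>v1\<close>, \<open>x\<close>, \<open>v3\<close>, and these four are
      combinations of vectors to which \<open>U4\<close> is orthogonal.\<close>
    have "{x \<in> U4. \<forall>y\<in>U4. c x y = 0} = {x \<in> U. \<forall>y\<in>U. c x y = 0}"
    proof (intro equalityI subsetI CollectI conjI ballI)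
      fix v w assume v: "v \<in> {x \<in> U4. \<forall>y\<in>U4. c x y = 0}" and "w \<in> U"
      then have "v \<in> U4" by simp
      then have vz: "c v x = 0" "c v (a x) = 0" "c v y = 0" "c v (a y) = 0"
        by (auto simp: U1_def U2_def U3_def U4_def)
      then have vv: "c v v1 = 0" "c v v3 = 0"
        by (auto simp: v1_def v3_def diff c)
      obtain k1 where k1: "w - k1 *s y \<in> U1" using step1(2)[OF \<open>w \<in> U\<close>] by blast
      obtain k2 where k2: "w - k1 *s y - k2 *s v1 \<in> U2" using step2(2)[OF k1] by blast
      obtain k3 where k3: "w - k1 *s y - k2 *s v1 - k3 *s x \<in> U3" using step3(2)[OF k2] by blast
      obtain k4 where k4: "w - k1 *s y - k2 *s v1 - k3 *s x - k4 *s v3 \<in> U4"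
        using step4(2)[OF k3] by blast
      then have "c v (w - k1 *s y - k2 *s v1 - k3 *s x - k4 *s v3) = 0"
        using v by blast
      then show "c v w = 0"
        by (simp add: diff c vz vv)
    next
      fix v assume "v \<in> {x \<in> U. \<forall>y\<in>U. c x y = 0}"
      then show "v \<in> U4"
        using xy U by (auto simp: U1_def U2_def U3_def U4_def)
    qed (use \<open>U4 \<subseteq> U\<close> in auto)
    then have "dim U = dim {x \<in> U. \<forall>y\<in>U. c x y = 0} + 4 * Suc n"
      using n dim by simp
    then show ?thesis by blast
  qed
qed

end

section \<open>Jordan cells through the form\<close>

context symplectic_endo
begin

text \<open>The action of \<open>f\<close> is self-adjoint, so the orthogonal of its image is its
  kernel, and the double orthogonal returns the image.\<close>

lemma in_range_act_if_perp_kernel: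
  assumes "\<And>y. y \<in> kernel f \<Longrightarrow> b x y = 0"
  shows "x \<in> range ((\<star>) f)"
proof -
  have "x \<in> span ((\<star>) f ` Basis)"
  proof (rule in_span_if_perp_perp[of _ UNIV])
    fix y assume *: "\<And>s. s \<in> (\<star>) f ` Basis \<Longrightarrow> b s y = 0"
    have "Basis \<subseteq> {v. b v (f \<star> y) = 0}"
      using * by (auto simp flip: b_act)
    moreover have "subspace {v. b v (f \<star> y) = 0}"
      by (auto simp: subspace_def b_add_left b_scale_left)
    ultimately have "span Basis \<subseteq> {v. b v (f \<star> y) = 0}"
      by (rule span_minimal)
    then have "b v (f \<star> y) = 0" for v
      by (auto simp: span_Basis)
    then have "f \<star> y = 0"
      using b_skew[of "f \<star> y"] by (intro b_nondegenerate) simp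
    then show "b x y = 0"
      using assms by (simp add: kernel_def)
  next
    show "nondegenerate_on UNIV"
      using b_nondegenerate by (auto simp: nondegenerate_on_def)
  qed (auto simp: finite_Basis subspace_def)
  moreover have "subspace (range ((\<star>) f))"
    unfolding subspace_def
  proof (intro conjI ballI allI)
    show "0 \<in> range ((\<star>) f)" by (rule range_eqI[of _ _ 0]) simp
    fix v w c assume "v \<in> range ((\<star>) f)"
    then obtain v' where v: "v = f \<star> v'" by blast
    show "c *s v \<in> range ((\<star>) f)"
      by (rule range_eqI[of _ _ "c *s v'"]) (simp add: v act_scale)
    assume "w \<in> range ((\<star>) f)"
    then obtain w' where w: "w = f \<star> w'" by blast
    show "v + w \<in> range ((\<star>) f)"
      by (rule range_eqI[of _ _ "v' + w'"]) (simp add: v w act_add_right)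
  qed
  ultimately show ?thesis
    using span_minimal[of "(\<star>) f ` Basis" "range ((\<star>) f)"] by auto
qed

text \<open>If \<open>x\<close> is in the radical of the form, then
  \<open>w ^ (k - 1) \<star> x\<close> is orthogonal to ker w^k, hence equals
  \<open>w ^ k \<star> v\<close> for some \<open>v\<close>; then \<open>x - w \<star> v\<close> and
  \<open>w \<star> v\<close> are the two summands. The converse is adjunction.\<close>

lemma jordan_radical_eq:
  assumes "k > 0"
  shows "jordan_radical z k = {x \<in> kernel ([:- z, 1:] ^ k).
    \<forall>y\<in>kernel ([:- z, 1:] ^ k). b x ([:- z, 1:] ^ (k - 1) \<star> y) = 0}"
proof -
  define w where "w = [:- z, 1:]"
  have wk: "w ^ k \<star> v = w ^ (k - 1) \<star> w \<star> v" "w ^ k \<star> v = w \<star> w ^ (k - 1) \<star> v" for v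
    using \<open>k > 0\<close> by (metis Suc_diff_1 power_Suc2 act_mult, metis Suc_diff_1 power_Suc act_mult)
  show ?thesis
    unfolding w_def[symmetric]
  proof (intro equalityI subsetI CollectI conjI ballI)
    fix x assume x: "x \<in> jordan_radical z k"
    then show "x \<in> kernel (w ^ k)"
      using jordan_radical_subset_kernel[OF \<open>k > 0\<close>] unfolding w_def by blast
    fix y assume y: "y \<in> kernel (w ^ k)"
    obtain v v' where *: "x = v + w \<star> v'" "w ^ (k - 1) \<star> v = 0"
      using x unfolding jordan_radical_def kernel_def w_def by blast
    have "b x (w ^ (k - 1) \<star> y) = b (w ^ (k - 1) \<star> v) y + b v' (w ^ k \<star> y)"
      by (simp add: *(1) b_add_left b_act wk(2) act_commute[of w])
    then show "b x (w ^ (k - 1) \<star> y) = 0"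
      using y *(2) by (simp add: kernel_def)
  next
    fix x assume x: "x \<in> {x \<in> kernel (w ^ k). \<forall>y\<in>kernel (w ^ k). b x (w ^ (k - 1) \<star> y) = 0}"
    then have "w ^ (k - 1) \<star> x \<in> range ((\<star>) (w ^ k))"
      by (intro in_range_act_if_perp_kernel) (auto simp: b_act)
    then obtain v where v: "w ^ (k - 1) \<star> x = w ^ k \<star> v" by blast
    have "w ^ (k - 1) \<star> (x - w \<star> v) = 0"
      using v by (simp add: act_diff_right wk(1))
    moreover have "w ^ Suc k \<star> v = 0"
    proof -
      have "w ^ Suc k \<star> v = w \<star> w ^ k \<star> v"
        by (simp only: power_Suc act_mult)
      also have "\<dots> = w \<star> w ^ (k - 1) \<star> x"
        by (simp only: v)
      also have "\<dots> = w ^ k \<star> x"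
        by (simp only: wk(2))
      finally show ?thesis using x by (simp add: kernel_def)
    qed
    ultimately show "x \<in> jordan_radical z k"
      unfolding jordan_radical_def kernel_def w_def[symmetric]
      by (intro CollectI exI[of _ "x - w \<star> v"] exI[of _ v]) simp
  qed
qed

text \<open>By \<open>rel\<close>, w intertwines \<open>a\<close> with the alternating map
  \<open>a'\<close>. For \<open>k = 2 * j + 1\<close> the form on ker w^k is the pullback of
  \<open>b\<close> under w^j, so \<open>a\<close> is alternating for it and
  \<open>four_dvd_codim_radical\<close> applies.\<close>

lemma four_dvd_jordan_cells:
  assumes a: "form_alternating scale b a"
    and a2: "\<And>x. a (a x) = (- P1) *s a x + (- P0) *s x"
    and rel: "\<And>x. a ([:- z, 1:] \<star> x) + [:- z, 1:] \<star> a x = [:- z, 1:] \<star> [:- z, 1:] \<star> x - P1 *s ([:- z, 1:] \<star> x)"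
    and irr: "\<And>t. t\<^sup>2 + P1 * t + P0 \<noteq> 0"
    and ds: "elementary_divisor_list scale u ds" and "odd k"
  shows "4 dvd jordan_cells scale u z k"
proof -
  define w where "w = [:- z, 1:]"
  have lin: "Vector_Spaces.linear scale scale a" and alt: "b x (a x) = 0" for x
    using a by (auto simp: form_alternating_def)
  have a_add: "a (x + y) = a x + a y" and a_scale: "a (c *s x) = c *s a x" for x y c
    using lin by (auto simp: Vector_Spaces.linear_iff)
  have a_zero: "a 0 = 0" using a_scale[of 0 0] by simp
  define a' where "a' x = w \<star> x - a x - P1 *s x" for x
  have wa: "w \<star> a x = a' (w \<star> x)" for x
    using rel[of x] unfolding a'_def w_def[symmetric] by (simp add: algebra_simps)
  have wa': "w \<star> a' x = a (w \<star> x)" for x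
    using rel[of x] unfolding a'_def w_def[symmetric]
    by (simp add: act_diff_right act_add_right act_scale algebra_simps)
  have alt': "b x (a' x) = 0" for x
    by (simp add: a'_def w_def act_pCons b_diff_right b_add_right b_scale_right alt)
  \<comment> \<open>Even powers of \<open>w\<close> commute with \<open>a\<close>, odd ones turn
    \<open>a\<close> into \<open>a'\<close>; both maps are alternating.\<close>
  have comm: "(\<forall>x. w ^ j \<star> a x = a (w ^ j \<star> x)) \<or> (\<forall>x. w ^ j \<star> a x = a' (w ^ j \<star> x))" for j
  proof (induction j)
    case (Suc j)
    then show ?case
      by (auto simp: act_mult wa wa')
  qed simp
  obtain j where j: "k = 2 * j + 1"
    using \<open>odd k\<close> by (elim oddE)
  then have "k > 0" by simp
  define c where "c x y = b x (w ^ (k - 1) \<star> y)" for x y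
  have c_eq: "c x y = b (w ^ j \<star> x) (w ^ j \<star> y)" for x y
    by (simp add: c_def j b_act mult_2 power_add act_mult)
  have ca: "c x (a x) = 0" for x
    using comm[of j] alt alt' by (auto simp: c_eq)
  have skew: "c x y = - c y x" for x y
    unfolding c_eq by (rule b_skew)
  have skew_a: "c x (a y) = - c y (a x)" for x y
  proof -
    have "c (x + y) (a (x + y)) = 0" by (rule ca)
    then have "c x (a y) + c y (a x) = 0"
      using ca by (simp add: c_def a_add b_add_left b_add_right act_add_right add.commute)
    then show ?thesis by (simp add: eq_neg_iff_add_eq_0)
  qed
  have adj: "c (a x) y = c x (a y)" for x y
    using skew[of "a x" y] skew_a[of x y] by simp
  have "\<exists>m. dim (kernel (w ^ k)) = dim {x \<in> kernel (w ^ k). \<forall>y\<in>kernel (w ^ k). c x y = 0} + 4 * m"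
  proof (rule four_dvd_codim_radical[where ?P1.0 = P1 and ?P0.0 = P0 and a = a])
    show "a v \<in> kernel (w ^ k)" if "v \<in> kernel (w ^ k)" for v
      using comm[of k] that by (auto simp: kernel_def a'_def a_zero)
    show "c x x = 0" for x by (simp add: c_eq)
  qed (use subspace_kernel adj ca a2 irr in \<open>auto simp: c_def b_add_left b_add_right b_scale_left
        b_scale_right act_add_right act_scale\<close>)
  then have "\<exists>m. dim (kernel (w ^ k)) = dim (jordan_radical z k) + 4 * m"
    unfolding c_def w_def jordan_radical_eq[OF \<open>k > 0\<close>] .
  then show ?thesis
    using jordan_cells_eq(2)[OF ds \<open>k > 0\<close>, of z] by (auto simp: w_def)
qed

end

section \<open>Polynomials under the reflection\<close>

text \<open>The twisted difference quotient \<open>(f(t) - f(\<delta> - t)) / (2 t - \<delta>)\<close>, defined without division so that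
  it makes sense for \<open>2 t = \<delta>\<close>, where it is the derivative.\<close>

definition twisted_diff :: "'a::field \<Rightarrow> 'a poly \<Rightarrow> 'a poly" where
  "twisted_diff \<delta> f = snd (fold_coeffs (\<lambda>c (g, r). (pCons c g, g + [:\<delta>, - 1:] * r)) f (0, 0))"

text \<open>The polynomial f(\<delta> - t), written through the difference quotient by 2 t -
  \<delta>.\<close>

definition reflect :: "'a::field \<Rightarrow> 'a poly \<Rightarrow> 'a poly" where
  "reflect \<delta> f = f - [:- \<delta>, 2:] * twisted_diff \<delta> f"

text \<open>The subring of polynomials in \<open>s = t\<^sup>2 - \<delta> t\<close>, over which \<open>F[t]\<close> is free with basis \<open>1, t\<close>.\<close>

definition sym_polys :: "'a::field \<Rightarrow> 'a poly set" where
  "sym_polys \<delta> = range (\<lambda>g. pcompose g [:0, - \<delta>, 1:])"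

lemma twisted_diff_zero [simp]: "twisted_diff \<delta> 0 = 0"
  by (simp add: twisted_diff_def)

text \<open>The twisted product rule for the factor t, whose reflection is \<delta> - t; the
  inductions below rest on it.\<close>

lemma twisted_diff_pCons: "twisted_diff \<delta> (pCons c f) = f + [:\<delta>, - 1:] * twisted_diff \<delta> f"
proof (cases "c = 0 \<and> f = 0")
  case False
  \<comment> \<open>The first component of the fold rebuilds the polynomial itself.\<close>
  have fst: "fst (fold_coeffs (\<lambda>c (g, r). (pCons c g, g + [:\<delta>, - 1:] * r)) f (0, 0)) = f" for f
  proof (induction f)
    case (pCons a p)
    then show ?case
      by (cases "a = 0") (auto simp: case_prod_beta)
  qed simp
  from False show ?thesis
    by (cases "c = 0") (auto simp: twisted_diff_def case_prod_beta fst
        simp del: mult_pCons_left)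
qed auto

lemma twisted_diff_add: "twisted_diff \<delta> (f + g) = twisted_diff \<delta> f + twisted_diff \<delta> g"
  by (induction f g rule: poly_induct2) (simp_all add: twisted_diff_pCons distrib_left del: mult_pCons_left)

lemma twisted_diff_smult: "twisted_diff \<delta> (Polynomial.smult c f) = Polynomial.smult c (twisted_diff \<delta> f)"
  by (induction f) (simp_all add: twisted_diff_pCons smult_add_right del: mult_pCons_left)

lemma twisted_diff_X_mult: "twisted_diff \<delta> ([:0, 1:] * f) = f + [:\<delta>, - 1:] * twisted_diff \<delta> f"
  by (simp add: twisted_diff_pCons)

lemma twisted_diff_linear_mult:
  "twisted_diff \<delta> ([:c, 1:] * f) = f + [:\<delta> + c, - 1:] * twisted_diff \<delta> f"
  by (simp add: twisted_diff_add twisted_diff_smult twisted_diff_pCons smult_add_left)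

lemma twisted_diff_s_mult: "twisted_diff \<delta> ([:0, - \<delta>, 1:] * f) = [:0, - \<delta>, 1:] * twisted_diff \<delta> f"
proof -
  have "[:0, - \<delta>, 1:] * f = [:0, 1:] * ([:- \<delta>, 1:] * f)"
    by simp
  then show ?thesis
    by (simp only: twisted_diff_linear_mult) (simp add: algebra_simps)
qed

lemma sym_polysI: "pcompose g [:0, - \<delta>, 1:] \<in> sym_polys \<delta>"
  by (simp add: sym_polys_def)

lemma sym_polys_add: "f \<in> sym_polys \<delta> \<Longrightarrow> g \<in> sym_polys \<delta> \<Longrightarrow> f + g \<in> sym_polys \<delta>"
  unfolding sym_polys_def by (auto simp flip: pcompose_add)

lemma sym_polys_diff: "f \<in> sym_polys \<delta> \<Longrightarrow> g \<in> sym_polys \<delta> \<Longrightarrow> f - g \<in> sym_polys \<delta>"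
  unfolding sym_polys_def by (auto simp flip: pcompose_diff)

lemma sym_polys_mult: "f \<in> sym_polys \<delta> \<Longrightarrow> g \<in> sym_polys \<delta> \<Longrightarrow> f * g \<in> sym_polys \<delta>"
  unfolding sym_polys_def by (auto simp flip: pcompose_mult)

lemma sym_polys_smult: "f \<in> sym_polys \<delta> \<Longrightarrow> Polynomial.smult c f \<in> sym_polys \<delta>"
  unfolding sym_polys_def by (auto simp flip: pcompose_smult)

lemma sym_polys_const: "[:c:] \<in> sym_polys \<delta>"
  using sym_polysI[of "[:c:]"] by simp

lemma sym_polys_one: "1 \<in> sym_polys \<delta>"
  using sym_polys_const[of 1] by (simp add: one_pCons)

lemma sym_polys_power: "f \<in> sym_polys \<delta> \<Longrightarrow> f ^ n \<in> sym_polys \<delta>"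
  by (induction n) (auto simp: sym_polys_one sym_polys_mult)

lemma sym_polys_quadratic: "[:c, - \<delta>, 1:] \<in> sym_polys \<delta>"
  using sym_polysI[of "[:c, 1:]"] by (simp add: pcompose_pCons)

text \<open>Polynomials in s = t^2 - \<delta> t are fixed by the reflection, so the twisted
  derivation is linear over them.\<close>

lemma twisted_diff_sym_mult: "r \<in> sym_polys \<delta> \<Longrightarrow> twisted_diff \<delta> (r * f) = r * twisted_diff \<delta> f"
proof -
  have "twisted_diff \<delta> (pcompose g [:0, - \<delta>, 1:] * f) = pcompose g [:0, - \<delta>, 1:] * twisted_diff \<delta> f" for g
  proof (induction g)
    case (pCons c g)
    have "twisted_diff \<delta> (pcompose (pCons c g) [:0, - \<delta>, 1:] * f) =
        twisted_diff \<delta> (Polynomial.smult c f + [:0, - \<delta>, 1:] * (pcompose g [:0, - \<delta>, 1:] * f))"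
      by (simp add: pcompose_pCons distrib_right mult.assoc del: mult_pCons_left) simp
    also have "\<dots> = Polynomial.smult c (twisted_diff \<delta> f) +
        [:0, - \<delta>, 1:] * (pcompose g [:0, - \<delta>, 1:] * twisted_diff \<delta> f)"
      by (simp only: twisted_diff_add twisted_diff_smult twisted_diff_s_mult pCons.IH)
    also have "\<dots> = pcompose (pCons c g) [:0, - \<delta>, 1:] * twisted_diff \<delta> f"
      by (simp add: pcompose_pCons distrib_right mult.assoc del: mult_pCons_left) simp
    finally show ?case .
  qed simp
  then show "r \<in> sym_polys \<delta> \<Longrightarrow> ?thesis"
    by (auto simp: sym_polys_def)
qed

text \<open>These are the two coordinates of \<open>f\<close> in the basis 1, t over the polynomials
  in s: the twisted difference quotient is the coefficient of t.\<close>

lemma twisted_diff_in_sym: "twisted_diff \<delta> f \<in> sym_polys \<delta> \<and> f - [:0, 1:] * twisted_diff \<delta> f \<in> sym_polys \<delta>"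
proof (induction f)
  case (pCons c f)
  have 1: "twisted_diff \<delta> (pCons c f) =
      (f - [:0, 1:] * twisted_diff \<delta> f) + Polynomial.smult \<delta> (twisted_diff \<delta> f)"
    by (simp add: twisted_diff_pCons)
  have "pCons c f - [:0, 1:] * twisted_diff \<delta> (pCons c f) = [:c:] + [:0, - \<delta>, 1:] * twisted_diff \<delta> f"
    by (simp add: twisted_diff_pCons algebra_simps)
  then show ?case
    unfolding 1 using pCons.IH
    by (auto simp only: intro!: sym_polys_add sym_polys_smult sym_polys_const sym_polys_mult
        sym_polys_quadratic)
qed (use sym_polys_const[of 0] in simp)

text \<open>The division by (s + N)^m is carried out in the variable s; degree at most m - 1 in s is
  degree at most 2 m - 2 in t.\<close>

lemma remainder_in_sym_polys:
  assumes "r \<in> sym_polys \<delta>"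
  shows "\<exists>q r'. r = q * [:N, - \<delta>, 1:] ^ m + r' \<and> (r' = 0 \<or> Polynomial.degree r' + 2 \<le> 2 * m)"
proof -
  let ?s = "[:0, - \<delta>, 1:]"
  obtain g where g: "r = pcompose g ?s" using assms by (auto simp: sym_polys_def)
  define M where "M = [:N, 1:] ^ m"
  define r0 where "r0 = g mod M"
  have "M \<noteq> 0" "Polynomial.degree M = m"
    by (simp_all add: M_def degree_power_eq)
  then have "r0 = 0 \<or> Polynomial.degree r0 < m"
    using degree_mod_less[of M g] by (auto simp: r0_def)
  then have deg: "pcompose r0 ?s = 0 \<or> Polynomial.degree (pcompose r0 ?s) + 2 \<le> 2 * m"
    by (auto simp: degree_pcompose)
  have "pcompose M ?s = [:N, - \<delta>, 1:] ^ m"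
    unfolding M_def by (induction m) (simp_all add: pcompose_mult pcompose_1 pcompose_pCons del: mult_pCons_left)
  moreover have "pcompose (g div M * M + r0) ?s = r"
    unfolding g r0_def by simp
  ultimately have "r = pcompose (g div M) ?s * [:N, - \<delta>, 1:] ^ m + pcompose r0 ?s"
    by (simp only: pcompose_add pcompose_mult)
  with deg show ?thesis by blast
qed

text \<open>The functional reads the coefficient of t^(2m-1), while the remainder has degree at most
  2 m - 2.\<close>

lemma top_coeff_mod_sym_even:
  assumes "r \<in> sym_polys \<delta>"
  shows "top_coeff_mod ([:N, - \<delta>, 1:] ^ m) r = 0"
proof -
  let ?d = "[:N, - \<delta>, 1:] ^ m"
  obtain q r' where *: "r = q * ?d + r'" "r' = 0 \<or> Polynomial.degree r' + 2 \<le> 2 * m"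
    using remainder_in_sym_polys[OF assms] by blast
  have deg: "Polynomial.degree ?d = 2 * m"
    by (simp add: degree_power_eq)
  have "top_coeff_mod ?d r = top_coeff_mod ?d r'"
    by (rule top_coeff_mod_cong) (simp add: *(1))
  also have "\<dots> = 0"
    using *(2)
  proof
    assume "Polynomial.degree r' + 2 \<le> 2 * m"
    then show ?thesis
      by (subst top_coeff_mod_less) (auto simp: deg intro: coeff_eq_0)
  qed simp
  finally show ?thesis .
qed

lemma linear_squared: "[:- z, 1:] ^ (2 * j) = [:z\<^sup>2, - (2 * z), 1:] ^ j" for z :: "'a::field"
  by (simp add: power_mult power2_eq_square)

text \<open>For \<delta> = 2 z the square of w = t - z is s + z^2. So w r may be replaced by w times
  the remainder of r modulo w^(2j), of degree at most 2 j - 1, and the functional reads the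
  coefficient of t^(2j).\<close>

lemma top_coeff_mod_sym_odd:
  assumes "r \<in> sym_polys (2 * z)"
  shows "top_coeff_mod ([:- z, 1:] ^ (2 * j + 1)) ([:- z, 1:] * r) = 0"
proof -
  let ?w = "[:- z, 1:]"
  define d where "d = ?w ^ (2 * j + 1)"
  obtain q r' where *: "r = q * [:z\<^sup>2, - (2 * z), 1:] ^ j + r'" "r' = 0 \<or> Polynomial.degree r' + 2 \<le> 2 * j"
    using remainder_in_sym_polys[OF assms] by blast
  have deg: "Polynomial.degree d = 2 * j + 1"
    by (simp add: d_def degree_power_eq del: power_Suc)
  have d: "d = ?w * [:z\<^sup>2, - (2 * z), 1:] ^ j"
    unfolding linear_squared[symmetric] d_def by simp
  have "?w * r - ?w * r' = q * d"
    unfolding d *(1) by (simp add: algebra_simps del: mult_pCons_left mult_pCons_right)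
  then have "top_coeff_mod d (?w * r) = top_coeff_mod d (?w * r')"
    by (intro top_coeff_mod_cong) (metis dvd_triv_right)
  also have "\<dots> = 0"
    using *(2)
  proof
    assume **: "Polynomial.degree r' + 2 \<le> 2 * j"
    have "Polynomial.degree (?w * r') \<le> Polynomial.degree r' + 1"
      using degree_mult_le[of ?w r'] by simp
    then show ?thesis
      using ** by (subst top_coeff_mod_less) (auto simp: deg intro!: coeff_eq_0 simp del: mult_pCons_left power_Suc)
  qed simp
  finally show ?thesis
    unfolding d_def .
qed

text \<open>Expansion in the basis 1, t over the polynomials in s; the coefficient of t is
  alternating in \<open>f\<close> and \<open>g\<close>.\<close>

lemma reflect_times:
  fixes f g :: "'a::field poly" and \<delta> :: 'a
  defines "f1 \<equiv> twisted_diff \<delta> f" and "g1 \<equiv> twisted_diff \<delta> g"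
  defines "f0 \<equiv> f - [:0, 1:] * f1" and "g0 \<equiv> g - [:0, 1:] * g1"
  shows "f * reflect \<delta> g = (f0 * g0 + Polynomial.smult \<delta> (f0 * g1) - [:0, - \<delta>, 1:] * (f1 * g1)) +
    [:0, 1:] * (f1 * g0 - f0 * g1)"
proof -
  have *: "[:- \<delta>, 2:] = [:0, 1:] - [:\<delta>, - 1:]"
    by simp
  have eqs: "f = f0 + [:0, 1:] * f1" "reflect \<delta> g = g0 + [:\<delta>, - 1:] * g1"
    by (simp_all add: f0_def g0_def reflect_def g1_def[symmetric] * left_diff_distrib
        del: mult_pCons_left diff_pCons)
  have ring: "(f0 + t * f1) * (g0 + (e - t) * g1) =
      (f0 * g0 + e * (f0 * g1) - (t * t - e * t) * (f1 * g1)) + t * (f1 * g0 - f0 * g1)" for t e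
    by (simp add: algebra_simps)
  have "[:\<delta>:] - [:0, 1:] = [:\<delta>, - 1:]" "[:0, 1:] * [:0, 1:] - [:\<delta>:] * [:0, 1:] = [:0, - \<delta>, 1:]"
    "[:\<delta>:] * (f0 * g1) = Polynomial.smult \<delta> (f0 * g1)"
    by simp_all
  note ring[of "[:0, 1:]" "[:\<delta>:]", unfolded this]
  with eqs show ?thesis
    by (simp only:)
qed

text \<open>The functional kills polynomials in s, so only the alternating part
  \<open>\<omega>\<close> survives. In the third identity the multiplier is (s + \<nu>) - P1 t, of
  which only P1 t contributes. These identities make \<open>a\<close> alternating on a block with a
  x = y.\<close>

lemma top_coeff_mod_reflect_even:
  fixes f g :: "'a::field poly" and \<delta> N :: 'a and m :: nat
  defines "d \<equiv> [:N, - \<delta>, 1:] ^ m"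
  shows "top_coeff_mod d (f * reflect \<delta> f) = 0"
    and "top_coeff_mod d (f * reflect \<delta> g) + top_coeff_mod d (g * reflect \<delta> f) = 0"
    and "\<delta> = Q1 - P1 \<Longrightarrow> top_coeff_mod d (f * ([:\<nu>, - Q1, 1:] * twisted_diff \<delta> g)) -
      top_coeff_mod d (g * ([:\<nu>, - Q1, 1:] * twisted_diff \<delta> f)) = P1 * top_coeff_mod d (f * reflect \<delta> g)"
proof -
  define c where "c f = f - [:0, 1:] * twisted_diff \<delta> f" for f
  have sym: "c f \<in> sym_polys \<delta>" "twisted_diff \<delta> f \<in> sym_polys \<delta>" for f
    using twisted_diff_in_sym unfolding c_def by blast+
  have tc: "top_coeff_mod d r = 0" if "r \<in> sym_polys \<delta>" for r
    unfolding d_def by (rule top_coeff_mod_sym_even[OF that])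
  define \<omega> where "\<omega> f g = [:0, 1:] * (twisted_diff \<delta> f * c g - c f * twisted_diff \<delta> g)" for f g
  have eq: "top_coeff_mod d (f * reflect \<delta> g) = top_coeff_mod d (\<omega> f g)" for f g
    unfolding reflect_times top_coeff_mod_add c_def[symmetric] \<omega>_def[symmetric]
    by (subst tc) (auto intro!: sym_polys_diff sym_polys_add sym_polys_smult sym_polys_mult sym
        sym_polys_quadratic simp del: mult_pCons_left)
  have "\<omega> g f = - \<omega> f g" "\<omega> f f = 0"
    by (simp_all add: \<omega>_def algebra_simps)
  then show "top_coeff_mod d (f * reflect \<delta> f) = 0"
    "top_coeff_mod d (f * reflect \<delta> g) + top_coeff_mod d (g * reflect \<delta> f) = 0"
    by (simp_all add: eq top_coeff_mod_minus)
  assume \<delta>: "\<delta> = Q1 - P1"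
  let ?h = "[:\<nu>, - Q1, 1:]"
  have h: "?h = ([:\<nu>:] + [:0, - \<delta>, 1:]) - [:P1:] * [:0, 1:]"
    by (simp add: \<delta>)
  have fc: "f = c f + [:0, 1:] * twisted_diff \<delta> f" for f
    by (simp add: c_def)
  have "f * (?h * twisted_diff \<delta> g) - g * (?h * twisted_diff \<delta> f) =
      ?h * (c f * twisted_diff \<delta> g - c g * twisted_diff \<delta> f)"
    by (subst (1) fc[of f], subst (2) fc[of g])
      (simp add: algebra_simps del: mult_pCons_left mult_pCons_right)
  also have "\<dots> = ([:\<nu>:] + [:0, - \<delta>, 1:]) * (c f * twisted_diff \<delta> g - c g * twisted_diff \<delta> f) +
      Polynomial.smult P1 (\<omega> f g)"
    unfolding h left_diff_distrib \<omega>_def by (simp add: algebra_simps smult_diff_right)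
  finally have "top_coeff_mod d (f * (?h * twisted_diff \<delta> g) - g * (?h * twisted_diff \<delta> f)) =
      P1 * top_coeff_mod d (\<omega> f g)"
    by (simp only: top_coeff_mod_add top_coeff_mod_smult)
      (subst tc, auto intro!: sym_polys_diff sym_polys_add sym_polys_mult sym sym_polys_quadratic sym_polys_const
        simp del: mult_pCons_left add_pCons)
  then show "top_coeff_mod d (f * (?h * twisted_diff \<delta> g)) - top_coeff_mod d (g * (?h * twisted_diff \<delta> f)) =
      P1 * top_coeff_mod d (f * reflect \<delta> g)"
    by (simp only: eq top_coeff_mod_diff)
qed

text \<open>With the basis 1, w over the polynomials in s, the functional kills w times such
  polynomials. What remains in the first identity is symmetric instead of alternating, which is why
  these blocks are taken in pairs; the whole combination in the second identity is killed.\<close>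

lemma top_coeff_mod_reflect_odd:
  fixes f g :: "'a::field poly" and z :: 'a and j :: nat
  defines "d \<equiv> [:- z, 1:] ^ (2 * j + 1)"
  shows "top_coeff_mod d (f * reflect (2 * z) g) = top_coeff_mod d (g * reflect (2 * z) f)"
    and "top_coeff_mod d (f * (reflect (2 * z) g * [:- z, 1:])) +
      top_coeff_mod d (f * ([:- z, 1:] * [:- z - P1, 1:] * twisted_diff (2 * z) g)) -
      top_coeff_mod d (g * ([:- z, 1:] * [:- z - P1, 1:] * twisted_diff (2 * z) f)) = 0"
proof -
  let ?\<delta> = "2 * z"
  define w where "w = [:- z, 1:]"
  define D where "D = twisted_diff ?\<delta>"
  define c where "c f = f - w * D f" for f
  have "c f = (f - [:0, 1:] * D f) + Polynomial.smult z (D f)" for f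
    by (simp add: c_def w_def)
  then have sym: "c f \<in> sym_polys ?\<delta>" "D f \<in> sym_polys ?\<delta>" for f
    using twisted_diff_in_sym[of ?\<delta> f] unfolding D_def
    by (simp_all only: sym_polys_add sym_polys_smult)
  have tc: "top_coeff_mod d (w * r) = 0" if "r \<in> sym_polys ?\<delta>" for r
    unfolding d_def w_def by (rule top_coeff_mod_sym_odd[OF that])
  have fc: "f = c f + w * D f" for f
    by (simp add: c_def)
  have rf: "reflect ?\<delta> f = c f - w * D f" for f
  proof -
    have "[:- ?\<delta>, 2:] = w + w" by (simp add: w_def)
    then show ?thesis
      by (simp add: reflect_def c_def D_def distrib_right)
  qed
  have w2: "w * w \<in> sym_polys ?\<delta>"
    using sym_polys_quadratic[of "z * z" ?\<delta>] by (simp add: w_def)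
  have prod: "f * reflect ?\<delta> g = (c f * c g - w * w * (D f * D g)) + w * (D f * c g - c f * D g)" for f g
    unfolding rf by (subst (1) fc[of f]) (simp add: algebra_simps)
  have "top_coeff_mod d (f * reflect ?\<delta> g) = top_coeff_mod d (c f * c g - w * w * (D f * D g))" for f g
    unfolding prod top_coeff_mod_add
    by (subst tc) (auto intro!: sym_polys_diff sym_polys_mult sym)
  then show "top_coeff_mod d (f * reflect (2 * z) g) = top_coeff_mod d (g * reflect (2 * z) f)"
    by (simp add: mult.commute)
  have h: "w * [:- z - P1, 1:] = w * w - [:P1:] * w"
    by (simp add: w_def algebra_simps)
  have "f * (reflect ?\<delta> g * w) + f * (w * [:- z - P1, 1:] * D g) - g * (w * [:- z - P1, 1:] * D f) =
      w * (c f * c g - w * w * (D f * D g) - [:P1:] * (c f * D g - c g * D f))"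
    unfolding h mult.assoc[symmetric] prod
    by (subst (3) fc[of f], subst (5) fc[of g])
      (simp add: algebra_simps del: mult_pCons_left mult_pCons_right)
  then have "top_coeff_mod d (f * (reflect ?\<delta> g * w) + f * (w * [:- z - P1, 1:] * D g) - g * (w * [:- z - P1, 1:] * D f)) = 0"
    using tc by (simp only:) (subst tc, auto intro!: sym_polys_diff sym_polys_mult sym w2 sym_polys_const
        simp del: mult_pCons_left)
  then show "top_coeff_mod d (f * (reflect (2 * z) g * [:- z, 1:])) +
      top_coeff_mod d (f * ([:- z, 1:] * [:- z - P1, 1:] * twisted_diff (2 * z) g)) -
      top_coeff_mod d (g * ([:- z, 1:] * [:- z - P1, 1:] * twisted_diff (2 * z) f)) = 0"
    unfolding D_def w_def by (simp only: top_coeff_mod_diff top_coeff_mod_add)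
qed

lemma dvd_twisted_diff_even:
  assumes "d = [:N, - \<delta>, 1:] ^ m" "d dvd f"
  shows "d dvd twisted_diff \<delta> f"
proof -
  obtain k where "f = d * k" using assms(2) by (elim dvdE)
  moreover have "d \<in> sym_polys \<delta>"
    unfolding assms(1) by (intro sym_polys_power sym_polys_quadratic)
  ultimately show ?thesis by (simp add: twisted_diff_sym_mult)
qed

text \<open>Only the even part w^(2j) of the modulus passes through the derivation; the extra factor
  w restores the rest.\<close>

lemma dvd_twisted_diff_odd:
  assumes "d = [:- z, 1:] ^ (2 * j + 1)" "d dvd f"
  shows "d dvd [:- z, 1:] * twisted_diff (2 * z) f"
proof -
  define r where "r = [:z\<^sup>2, - (2 * z), 1:] ^ j"
  have d: "d = r * [:- z, 1:]"
    unfolding assms(1) r_def linear_squared[symmetric] by (simp add: mult.commute)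
  obtain k where k: "f = d * k" using assms(2) by (elim dvdE)
  have "r \<in> sym_polys (2 * z)"
    unfolding r_def by (intro sym_polys_power sym_polys_quadratic)
  then have "twisted_diff (2 * z) f = r * twisted_diff (2 * z) ([:- z, 1:] * k)"
    unfolding k d mult.assoc by (rule twisted_diff_sym_mult)
  then show ?thesis
    by (simp add: d mult_ac del: mult_pCons_left mult_pCons_right)
qed

section \<open>Twisted extensions\<close>

lemma sum_alternating_eq_zero:
  fixes A :: "'g \<Rightarrow> 'g \<Rightarrow> 'a::ab_group_add"
  assumes "finite G" "\<And>i. i \<in> G \<Longrightarrow> A i i = 0" "\<And>i j. i \<in> G \<Longrightarrow> j \<in> G \<Longrightarrow> A i j + A j i = 0"
  shows "(\<Sum>i\<in>G. \<Sum>j\<in>G. A i j) = 0"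
  using assms
proof (induction G rule: finite_induct)
  case (insert x G)
  have "(\<Sum>i\<in>G. A i x) + (\<Sum>j\<in>G. A x j) = 0"
    using insert.prems by (auto simp flip: sum.distrib intro!: sum.neutral)
  then show ?case
    using insert by (simp add: sum.distrib add.commute)
qed simp

text \<open>An even fibre containing \<open>i\<close> has a second element; exchanging the two and
  removing them keeps all fibres even.\<close>

lemma involution_of_even_fibres:
  fixes \<phi> :: "nat \<Rightarrow> 'c"
  assumes "finite S" "\<And>i. i \<in> S \<Longrightarrow> even (card {j \<in> S. \<phi> j = \<phi> i})"
  shows "\<exists>\<sigma>. \<forall>i\<in>S. \<sigma> i \<in> S \<and> \<sigma> i \<noteq> i \<and> \<sigma> (\<sigma> i) = i \<and> \<phi> (\<sigma> i) = \<phi> i"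
  using assms
proof (induction "card S" arbitrary: S rule: less_induct)
  case less
  show ?case
  proof (cases "S = {}")
    case False
    then obtain i where i: "i \<in> S" by blast
    have "{j \<in> S. \<phi> j = \<phi> i} \<noteq> {i}"
      using less.prems(2)[OF i] by (metis card_1_singleton_iff odd_one One_nat_def)
    with i obtain j where j: "j \<in> S" "j \<noteq> i" "\<phi> j = \<phi> i" by blast
    let ?T = "S - {i, j}"
    have "even (card {k \<in> ?T. \<phi> k = \<phi> l})" if "l \<in> ?T" for l
    proof (cases "\<phi> l = \<phi> i")
      case True
      have "{k \<in> ?T. \<phi> k = \<phi> l} = {k \<in> S. \<phi> k = \<phi> i} - {i, j}"
        using True by auto
      moreover have "card ({k \<in> S. \<phi> k = \<phi> i} - {i, j}) = card {k \<in> S. \<phi> k = \<phi> i} - 2"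
        using i j less.prems(1) by (subst card_Diff_subset) auto
      ultimately show ?thesis
        using less.prems(2)[OF i] by simp
    next
      case False
      then have "{k \<in> ?T. \<phi> k = \<phi> l} = {k \<in> S. \<phi> k = \<phi> l}"
        using j by auto
      then show ?thesis using less.prems(2)[of l] that by simp
    qed
    moreover have "card ?T < card S"
      using i less.prems(1) by (intro psubset_card_mono) auto
    ultimately obtain \<sigma> where \<sigma>: "\<forall>k\<in>?T. \<sigma> k \<in> ?T \<and> \<sigma> k \<noteq> k \<and> \<sigma> (\<sigma> k) = k \<and> \<phi> (\<sigma> k) = \<phi> k"
      using less.hyps[of ?T] less.prems(1) by auto
    have "\<forall>k\<in>S. (\<sigma>(i := j, j := i)) k \<in> S \<and> (\<sigma>(i := j, j := i)) k \<noteq> k \<and>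
        (\<sigma>(i := j, j := i)) ((\<sigma>(i := j, j := i)) k) = k \<and> \<phi> ((\<sigma>(i := j, j := i)) k) = \<phi> k"
      using \<sigma> i j by auto
    then show ?thesis by blast
  qed simp
qed

context vs_endo
begin

text \<open>Once \<open>m g\<close> is chosen as the image of \<open>e g\<close>, the relation for
  \<open>a (u v)\<close> dictates the value at \<open>f \<star> e g\<close>. The hypothesis
  \<open>compat\<close> says that these values vanish on the relations between the generators, so
  they define a map.\<close>

lemma twisted_extension:
  fixes e m :: "'g \<Rightarrow> 'v" and d :: "'g \<Rightarrow> 'a poly"
  assumes "finite G" and spanning: "\<And>v. \<exists>f. v = (\<Sum>g\<in>G. f g \<star> e g)"
    and kernel: "\<And>f g. (\<Sum>g\<in>G. f g \<star> e g) = 0 \<Longrightarrow> g \<in> G \<Longrightarrow> d g dvd f g"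
    and compat: "\<And>g f. g \<in> G \<Longrightarrow> d g dvd f \<Longrightarrow> reflect \<delta> f \<star> m g + (h * twisted_diff \<delta> f) \<star> e g = 0"
  shows "\<exists>a. Vector_Spaces.linear scale scale a \<and>
    (\<forall>g\<in>G. \<forall>f. a (f \<star> e g) = reflect \<delta> f \<star> m g + (h * twisted_diff \<delta> f) \<star> e g) \<and>
    (\<forall>v. a (u v) = \<delta> *s a v - u (a v) + h \<star> v)"
proof -
  define A1 where "A1 g f = reflect \<delta> f \<star> m g + (h * twisted_diff \<delta> f) \<star> e g" for g f
  have A1_add: "A1 g (f + f') = A1 g f + A1 g f'" for g f f'
    by (simp add: A1_def reflect_def twisted_diff_add act_add_left act_diff_left distrib_left
        del: mult_pCons_left)
  have A1_smult: "A1 g (Polynomial.smult c f) = c *s A1 g f" for g c f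
    by (simp add: A1_def reflect_def twisted_diff_smult act_smult act_diff_left scale_right_distrib
        scale_right_diff_distrib del: mult_pCons_left)
  have A1_diff: "A1 g (f - f') = A1 g f - A1 g f'" for g f f'
    using A1_add[of g "f - f'" f'] by simp
  have A1_X: "A1 g ([:0, 1:] * f) = \<delta> *s A1 g f - u (A1 g f) + h \<star> f \<star> e g" for g f
  proof -
    define t where "t = [:0, 1 :: 'a:]"
    define D where "D = twisted_diff \<delta> f"
    have cs: "[:\<delta>, - 1:] = [:\<delta>:] - t" "[:- \<delta>, 2:] = t + t - [:\<delta>:]"
      by (simp_all add: t_def)
    have tD: "twisted_diff \<delta> (t * f) = f + ([:\<delta>:] - t) * D"
      unfolding t_def D_def twisted_diff_X_mult by simp
    have "reflect \<delta> (t * f) = ([:\<delta>:] - t) * reflect \<delta> f"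
      unfolding reflect_def tD cs(2) D_def[symmetric] by (simp only: algebra_simps)
    moreover have "h * twisted_diff \<delta> (t * f) = ([:\<delta>:] - t) * (h * D) + h * f"
      unfolding tD by (simp only: algebra_simps)
    ultimately have "A1 g (t * f) = ([:\<delta>:] - t) \<star> A1 g f + (h * f) \<star> e g"
      unfolding A1_def D_def[symmetric] by (simp only: act_mult act_add_left act_add_right add.assoc)
    then show ?thesis
      by (simp only: t_def act_mult act_diff_left act_const act_X)
  qed
  \<comment> \<open>An arbitrary choice of coordinates; the fact \<open>a\<close> below shows that
    any other choice gives the same value.\<close>
  define F where "F v = (SOME f. v = (\<Sum>g\<in>G. f g \<star> e g))" for v
  define a where "a v = (\<Sum>g\<in>G. A1 g (F v g))" for v
  have F: "v = (\<Sum>g\<in>G. F v g \<star> e g)" for v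
    unfolding F_def by (rule someI_ex[OF spanning])
  have a: "a (\<Sum>g\<in>G. f g \<star> e g) = (\<Sum>g\<in>G. A1 g (f g))" for f
  proof -
    define v where "v = (\<Sum>g\<in>G. f g \<star> e g)"
    have "(\<Sum>g\<in>G. (F v g - f g) \<star> e g) = 0"
      using F[of v] by (simp add: act_diff_left sum_subtractf v_def)
    then have "d g dvd F v g - f g" if "g \<in> G" for g
      using kernel[of "\<lambda>g. F v g - f g"] that by blast
    then have "A1 g (F v g - f g) = 0" if "g \<in> G" for g
      using compat that unfolding A1_def by blast
    then show ?thesis
      unfolding a_def v_def[symmetric] by (intro sum.cong) (auto simp: A1_diff)
  qed
  have "Vector_Spaces.linear scale scale a"
  proof -
    have "a (v + w) = a v + a w" for v w
    proof -
      have "v + w = (\<Sum>g\<in>G. (F v g + F w g) \<star> e g)"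
        using F[of v] F[of w] by (simp add: act_add_left sum.distrib)
      then have "a (v + w) = (\<Sum>g\<in>G. A1 g (F v g + F w g))"
        using a[of "\<lambda>g. F v g + F w g"] by simp
      then show ?thesis
        by (simp add: a_def A1_add sum.distrib)
    qed
    moreover have "a (c *s v) = c *s a v" for c v
    proof -
      have "c *s v = c *s (\<Sum>g\<in>G. F v g \<star> e g)"
        using F[of v] by simp
      also have "\<dots> = (\<Sum>g\<in>G. Polynomial.smult c (F v g) \<star> e g)"
        by (simp add: act_smult scale_sum_right)
      finally have "a (c *s v) = (\<Sum>g\<in>G. A1 g (Polynomial.smult c (F v g)))"
        using a[of "\<lambda>g. Polynomial.smult c (F v g)"] by simp
      then show ?thesis
        by (simp add: a_def A1_smult scale_sum_right)
    qed
    ultimately show ?thesis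
      by (simp add: Vector_Spaces.linear_iff vector_space_axioms)
  qed
  moreover have "a (f \<star> e g) = reflect \<delta> f \<star> m g + (h * twisted_diff \<delta> f) \<star> e g" if "g \<in> G" for g f
  proof -
    have *: "(\<Sum>j\<in>G. (if j = g then f else 0) \<star> e j) = f \<star> e g"
      by (subst sum.remove[OF \<open>finite G\<close> that]) auto
    have "A1 j 0 = 0" for j
      using A1_diff[of j 0 0] by simp
    then have "(\<Sum>j\<in>G. A1 j (if j = g then f else 0)) = A1 g f"
      by (subst sum.remove[OF \<open>finite G\<close> that]) auto
    then show ?thesis
      using a[of "\<lambda>j. if j = g then f else 0"] unfolding * A1_def by simp
  qed
  moreover have "a (u v) = \<delta> *s a v - u (a v) + h \<star> v" for v
  proof -
    have "u v = (\<Sum>g\<in>G. ([:0, 1:] * F v g) \<star> e g)"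
      by (subst F[of v]) (simp only: u_sum act_mult act_X)
    then have "a (u v) = (\<Sum>g\<in>G. A1 g ([:0, 1:] * F v g))"
      using a[of "\<lambda>g. [:0, 1:] * F v g"] by simp
    also have "\<dots> = \<delta> *s a v - u (a v) + h \<star> (\<Sum>g\<in>G. F v g \<star> e g)"
      by (simp only: A1_X sum.distrib sum_subtractf a_def scale_sum_right u_sum act_sum_right)
    finally show ?thesis
      using F[of v] by simp
  qed
  ultimately show ?thesis by blast
qed

text \<open>The defect E = a^2 + P1 a + P0 commutes with \<open>u\<close>, although \<open>a\<close>
  itself need not, so its vanishing at \<open>e\<close> spreads to F[u] e.\<close>

lemma quadratic_of_generators:
  assumes lin: "Vector_Spaces.linear scale scale a"
    and rel: "\<And>v. a (u v) = (Q1 - P1) *s a v - u (a v) + [:Q0 - P0, - Q1, 1:] \<star> v"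
    and e: "a (a e) + P1 *s a e + P0 *s e = 0"
  shows "a (a (f \<star> e)) + P1 *s a (f \<star> e) + P0 *s (f \<star> e) = 0"
proof -
  have add: "a (x + y) = a x + a y" and sc: "a (c *s x) = c *s a x" for x y c
    using lin by (auto simp: Vector_Spaces.linear_iff)
  have minus: "a (- x) = - a x" for x using sc[of "-1" x] by simp
  have diff: "a (x - y) = a x - a y" for x y using add[of x "- y"] by (simp add: minus)
  define E where "E v = a (a v) + P1 *s a v + P0 *s v" for v
  have rel': "a (u v) = Q1 *s a v - P1 *s a v - u (a v) + (Q0 *s v - P0 *s v - Q1 *s u v + u (u v))" for v
    using rel[of v] by (simp add: act_pCons u_add u_scale u_minus u_diff scale_left_diff_distrib algebra_simps)
  note lin_simps = add sc minus diff u_add u_scale u_minus u_diff scale_right_distrib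
    scale_right_diff_distrib mult.commute
  have Eu: "E (u v) = u (E v)" for v
    unfolding E_def by (simp add: rel' lin_simps algebra_simps)
  have "E (f \<star> e) = f \<star> E e"
  proof (induction f)
    case (pCons c f)
    then show ?case
      using Eu[of "f \<star> e"] by (simp add: act_pCons E_def lin_simps algebra_simps)
  qed (use sc[of 0 0] in \<open>simp add: E_def\<close>)
  then show ?thesis
    using e by (simp add: E_def)
qed

end

context symplectic_endo
begin

text \<open>Off-diagonal terms of the expansion cancel in pairs; the diagonal is a separate
  hypothesis because characteristic 2 is allowed.\<close>

lemma alternating_of_generators:
  assumes "finite G" and spanning: "\<And>v. \<exists>f. v = (\<Sum>g\<in>G. f g \<star> e g)"
    and lin: "Vector_Spaces.linear scale scale a"
    and diag: "\<And>g f. g \<in> G \<Longrightarrow> b (f \<star> e g) (a (f \<star> e g)) = 0"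
    and off: "\<And>g g' f f'. g \<in> G \<Longrightarrow> g' \<in> G \<Longrightarrow>
      b (f \<star> e g) (a (f' \<star> e g')) + b (f' \<star> e g') (a (f \<star> e g)) = 0"
  shows "b v (a v) = 0"
proof -
  obtain f where f: "v = (\<Sum>g\<in>G. f g \<star> e g)"
    using spanning by blast
  have add: "a (x + y) = a x + a y" and sc: "a (c *s x) = c *s a x" for x y c
    using lin by (auto simp: Vector_Spaces.linear_iff)
  have "a (\<Sum>g\<in>H. w g) = (\<Sum>g\<in>H. a (w g))" for H and w :: "'b \<Rightarrow> 'v"
    using sc[of 0 0] by (induction H rule: infinite_finite_induct) (auto simp: add)
  then have "b v (a v) = (\<Sum>g\<in>G. \<Sum>g'\<in>G. b (f g \<star> e g) (a (f g' \<star> e g')))"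
    by (simp add: f b_sum_left b_sum_right) (rule sum.swap)
  also have "\<dots> = 0"
    using assms by (intro sum_alternating_eq_zero) auto
  finally show ?thesis .
qed

end

section \<open>Construction of the quadratic endomorphism\<close>

context symplectic_endo
begin

lemma symplectic_generators_pairing:
  assumes "symplectic_generators U n d x y" "i < n" "j < n"
  shows "b (p \<star> x i) (q \<star> x j) = 0" "b (p \<star> y i) (q \<star> y j) = 0"
    and "b (p \<star> x i) (q \<star> y j) = (if i = j then top_coeff_mod (d i) (p * q) else 0)"
    and "b (p \<star> y i) (q \<star> x j) = (if i = j then - top_coeff_mod (d i) (p * q) else 0)"
proof -
  have *: "b (p \<star> v) (q \<star> w) = b ((p * q) \<star> v) w" for v w p q
    by (simp add: act_mult b_act act_commute[of p])
  show "b (p \<star> x i) (q \<star> x j) = 0" "b (p \<star> y i) (q \<star> y j) = 0"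
    using assms unfolding * symplectic_generators_def by blast+
  have xy: "b (p \<star> x i) (q \<star> y j) = (if i = j then top_coeff_mod (d i) (p * q) else 0)"
    if "i < n" "j < n" for i j p q
    using assms(1) that unfolding * symplectic_generators_def by blast
  then show "b (p \<star> x i) (q \<star> y j) = (if i = j then top_coeff_mod (d i) (p * q) else 0)"
    using assms by blast
  show "b (p \<star> y i) (q \<star> x j) = (if i = j then - top_coeff_mod (d i) (p * q) else 0)"
    using xy[OF assms(3,2), of q p] b_skew[of "p \<star> y i"] by (auto simp: mult.commute)
qed

text \<open>On a block \<open>F[u] x\<^sub>i + F[u] y\<^sub>i\<close> with \<open>i \<notin> S\<close> the endomorphism \<open>a\<close> is determined by
  \<open>a x\<^sub>i = y\<^sub>i\<close>. For \<open>i \<in> S\<close> this would not be alternating; there \<open>a\<close> exchanges \<open>x\<^sub>i\<close> and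
  \<open>x\<^bsub>\<sigma> i\<^esub>\<close>, and its values on the \<open>y\<^sub>i\<close> are those of the adjoint.\<close>

lemma quadratic_alternating_exists:
  assumes gens: "symplectic_generators UNIV n d x y"
    and even: "\<And>i. i < n \<Longrightarrow> i \<notin> S \<Longrightarrow> \<exists>N m. d i = [:N, - (Q1 - P1), 1:] ^ m"
    and S: "S \<subseteq> {..<n}"
    and odd: "\<And>i. i \<in> S \<Longrightarrow> \<exists>j. d i = [:- z i, 1:] ^ (2 * j + 1)"
    and z: "\<And>i. i \<in> S \<Longrightarrow> Q1 = P1 + 2 * z i" "\<And>i. i \<in> S \<Longrightarrow> Q0 = P0 + P1 * z i + (z i)\<^sup>2"
    and \<sigma>: "\<And>i. i \<in> S \<Longrightarrow> \<sigma> i \<in> S \<and> \<sigma> i \<noteq> i \<and> \<sigma> (\<sigma> i) = i \<and> d (\<sigma> i) = d i"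
  shows "\<exists>a. form_alternating scale b a \<and> (\<forall>v. a (a v) + P1 *s a v + P0 *s v = 0) \<and>
    (\<forall>v. a (u v) = (Q1 - P1) *s a v - u (a v) + [:Q0 - P0, - Q1, 1:] \<star> v)"
proof -
  define \<delta> h where "\<delta> = Q1 - P1" and "h = [:Q0 - P0, - Q1, 1:]"
  \<comment> \<open>If \<open>i < \<sigma> i\<close>, these constants make \<open>a\<close> act by
    the companion matrix of p: x_i goes to x_j and x_j to - P0 x_i - P1 x_j, where j = \<sigma>
    i.\<close>
  define \<mu> \<kappa> where "\<mu> i = (if i < \<sigma> i then 1 else - P0)" and "\<kappa> i = (if i < \<sigma> i then 0 else - P1)" for i
  define w where "w i = [:- z i, 1:]" for i
  define G where "G = {..<n} \<times> (UNIV :: bool set)"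
  define e where "e = (\<lambda>(i, c). if c then y i else x i)"
  \<comment> \<open>The prescribed images, with \<open>False\<close> standing for \<open>x i\<close>
    and \<open>True\<close> for \<open>y i\<close>. The term \<open>w i \<star> y i\<close>
    compensates the contribution of the twisted derivation to the pairing of \<open>x i\<close> with
    \<open>y i\<close>.\<close>
  define m where "m = (\<lambda>(i, c).
    if c then
      (if i \<in> S then \<mu> (\<sigma> i) *s y (\<sigma> i) + \<kappa> i *s y i + w i \<star> y i else - (P0 *s x i) - P1 *s y i)
    else
      (if i \<in> S then \<mu> i *s x (\<sigma> i) + \<kappa> i *s x i else y i))"
  have z\<delta>: "\<delta> = 2 * z i" if "i \<in> S" for i
    using z(1)[OF that] by (simp add: \<delta>_def)
  \<comment> \<open>Since q(t) = p(t + z), the polynomial \<open>h\<close> has the root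
    \<open>z i\<close>.\<close>
  have h: "h = w i * [:- z i - P1, 1:]" if "i \<in> S" for i
    using z[OF that] by (simp add: h_def w_def power2_eq_square algebra_simps)
  have z\<sigma>: "z (\<sigma> i) = z i" if iS: "i \<in> S" for i
  proof -
    obtain j j' where *: "d i = [:- z i, 1:] ^ (2 * j + 1)" "d (\<sigma> i) = [:- z (\<sigma> i), 1:] ^ (2 * j' + 1)"
      using odd \<sigma>[OF iS] iS by meson
    then have "poly ([:- z i, 1:] ^ (2 * j + 1)) (z i) = poly ([:- z (\<sigma> i), 1:] ^ (2 * j' + 1)) (z i)"
      using \<sigma>[OF iS] by simp
    then show ?thesis by (simp add: poly_power del: power_Suc)
  qed
  have ker: "d i \<star> x i = 0" "d i \<star> y i = 0" if "i < n" for i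
    using gens that by (auto simp: symplectic_generators_def)
  have sumG: "(\<Sum>g\<in>G. F g) = (\<Sum>i<n. F (i, False) + F (i, True))" for F :: "_ \<Rightarrow> 'v"
    unfolding G_def sum.cartesian_product' by (simp add: UNIV_bool add.commute)
  have "finite G" by (simp add: G_def)
  have spanning: "\<exists>f. v = (\<Sum>g\<in>G. f g \<star> e g)" for v
  proof -
    obtain f g where "v = (\<Sum>i<n. f i \<star> x i + g i \<star> y i)"
      using gens unfolding symplectic_generators_def by blast
    then have "v = (\<Sum>p\<in>G. (case p of (i, c) \<Rightarrow> if c then g i else f i) \<star> e p)"
      by (simp add: sumG e_def)
    then show ?thesis
      by (rule exI[of _ "\<lambda>p. case p of (i, c) \<Rightarrow> if c then g i else f i"])
  qed
  have kernel: "d (fst g) dvd f g" if fg: "(\<Sum>g\<in>G. f g \<star> e g) = 0" "g \<in> G" for f g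
  proof -
    have "(\<Sum>i<n. f (i, False) \<star> x i + f (i, True) \<star> y i) = 0"
      using fg(1) by (simp add: sumG e_def)
    then have "d i dvd f (i, c)" if "i < n" for i c
      using symplectic_generators_kernel[OF gens _ that, of "\<lambda>i. f (i, False)" "\<lambda>i. f (i, True)"]
      by (cases c) auto
    then show ?thesis
      using fg(2) by (cases g) (auto simp: G_def)
  qed
  \<comment> \<open>On \<open>S\<close> the derivation respects divisibility by \<open>d i\<close>
    only after multiplication by \<open>w i\<close>; both 2 t - \<delta> and \<open>h\<close> are
    multiples of \<open>w i\<close>.\<close>
  have dvd: "d i dvd [:- \<delta>, 2:] * twisted_diff \<delta> f \<and> d i dvd h * twisted_diff \<delta> f"
    if i: "i < n" and f: "d i dvd f" for i f
  proof (cases "i \<in> S")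
    case True
    then obtain j where "d i = [:- z i, 1:] ^ (2 * j + 1)"
      using odd by blast
    then have "d i dvd w i * twisted_diff \<delta> f"
      unfolding w_def z\<delta>[OF True] using f by (rule dvd_twisted_diff_odd)
    moreover have "[:- \<delta>, 2:] = [:2:] * w i"
      by (simp add: w_def z\<delta>[OF True])
    ultimately show ?thesis
      unfolding h[OF True] by (metis (no_types) dvd_mult mult.assoc mult.commute)
  next
    case False
    then obtain N k where "d i = [:N, - \<delta>, 1:] ^ k"
      using even[OF i] unfolding \<delta>_def by blast
    then have "d i dvd twisted_diff \<delta> f"
      using f by (rule dvd_twisted_diff_even)
    then show ?thesis by (metis dvd_mult)
  qed
  have compat: "reflect \<delta> f \<star> m g + (h * twisted_diff \<delta> f) \<star> e g = 0"
    if g: "g \<in> G" and f: "d (fst g) dvd f" for g f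
  proof -
    obtain i c where ic: "g = (i, c)" "i < n" using g by (cases g) (auto simp: G_def)
    have "d i \<star> x (\<sigma> i) = 0" "d i \<star> y (\<sigma> i) = 0" if "i \<in> S"
      using ker[of "\<sigma> i"] \<sigma>[OF that] S by auto
    then have "d i \<star> m g = 0"
      using ker[OF ic(2)] act_commute[of "d i" "w i" "y i"]
      by (cases c) (auto simp: ic m_def act_add_right act_diff_right act_minus_right act_scale)
    moreover have "d i \<star> e g = 0"
      using ker[OF ic(2)] by (auto simp: ic e_def)
    moreover have "d i dvd reflect \<delta> f"
      unfolding reflect_def using dvd[OF ic(2)] f ic by (metis dvd_diff fst_conv)
    moreover have "d i dvd h * twisted_diff \<delta> f"
      using dvd[OF ic(2)] f ic by simp
    ultimately show ?thesis
      using act_dvd by (metis add.right_neutral)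
  qed
  have "\<exists>a. Vector_Spaces.linear scale scale a \<and>
      (\<forall>g\<in>G. \<forall>f. a (f \<star> e g) = reflect \<delta> f \<star> m g + (h * twisted_diff \<delta> f) \<star> e g) \<and>
      (\<forall>v. a (u v) = \<delta> *s a v - u (a v) + h \<star> v)"
  proof (rule twisted_extension[where d = "\<lambda>g. d (fst g)"])
    show "finite G" by fact
    show "\<exists>f. v = (\<Sum>g\<in>G. f g \<star> e g)" for v by (rule spanning)
    show "d (fst g) dvd f g" if "(\<Sum>g\<in>G. f g \<star> e g) = 0" "g \<in> G" for f g
      using kernel that .
    show "reflect \<delta> f \<star> m g + (h * twisted_diff \<delta> f) \<star> e g = 0"
      if "g \<in> G" "d (fst g) dvd f" for g f
      using compat that .
  qed
  then obtain a where lin: "Vector_Spaces.linear scale scale a"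
    and a: "\<And>g f. g \<in> G \<Longrightarrow> a (f \<star> e g) = reflect \<delta> f \<star> m g + (h * twisted_diff \<delta> f) \<star> e g"
    and rel: "\<And>v. a (u v) = \<delta> *s a v - u (a v) + h \<star> v"
    by blast
  have a_add: "a (v + v') = a v + a v'" and a_scale: "a (c *s v) = c *s a v" for v v' c
    using lin by (auto simp: Vector_Spaces.linear_iff)
  have a_minus: "a (- v) = - a v" for v using a_scale[of "-1" v] by simp
  have a_diff: "a (v - v') = a v - a v'" for v v' using a_add[of v "- v'"] by (simp add: a_minus)
  have G_mem: "(i, c) \<in> G" if "i < n" for i c
    using that by (simp add: G_def)
  have D1: "twisted_diff \<delta> 1 = 0" "reflect \<delta> 1 = 1"
    by (simp_all add: one_pCons twisted_diff_pCons reflect_def)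
  have am: "a (e g) = m g" if "g \<in> G" for g
    using a[OF that, of 1] by (simp add: D1)
  have ax: "a (x i) = m (i, False)" "a (y i) = m (i, True)" if "i < n" for i
    using am[OF G_mem[OF that, of False]] am[OF G_mem[OF that, of True]] by (simp_all add: e_def)
  have quad_e: "a (a (e g)) + P1 *s a (e g) + P0 *s e g = 0" if gG: "g \<in> G" for g
  proof -
    obtain i c where ic: "g = (i, c)" "i < n" using gG by (cases g) (auto simp: G_def)
    show ?thesis
    proof (cases "i \<in> S")
      case False
      then show ?thesis
        using ic by (cases c) (auto simp: e_def ax m_def a_diff a_minus a_scale algebra_simps)
    next
      case True
      have "\<sigma> i < n" using \<sigma>[OF True] S by auto
      have \<mu>\<kappa>: "(\<mu> i = 1 \<and> \<kappa> i = 0 \<and> \<mu> (\<sigma> i) = - P0 \<and> \<kappa> (\<sigma> i) = - P1) \<or>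
          (\<mu> i = - P0 \<and> \<kappa> i = - P1 \<and> \<mu> (\<sigma> i) = 1 \<and> \<kappa> (\<sigma> i) = 0)"
        using \<sigma>[OF True] by (auto simp: \<mu>_def \<kappa>_def)
      have w\<sigma>: "w (\<sigma> i) = w i" by (simp add: w_def z\<sigma>[OF True])
      have h': "h \<star> v = w i \<star> w i \<star> v - P1 *s (w i \<star> v)" for v
      proof -
        have "h = w i * (w i - [:P1:])" by (simp add: h[OF True] w_def)
        then show ?thesis
          by (simp only: act_mult act_diff_left act_diff_right act_const act_scale)
      qed
      \<comment> \<open>The commutation relation rewritten for u - z, where \<delta> = 2 z removes
        the linear term in \<open>a\<close>.\<close>
      have aw: "a (w i \<star> v) = - (w i \<star> a v) + w i \<star> w i \<star> v - P1 *s (w i \<star> v)" for v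
      proof -
        have "a (w i \<star> v) = a (u v) - z i *s a v"
          by (simp add: w_def act_pCons a_add a_diff a_minus a_scale)
        also have "\<dots> = - (w i \<star> a v) + h \<star> v"
          unfolding rel z\<delta>[OF True] mult_2 scale_left_distrib by (simp add: w_def act_pCons)
        finally show ?thesis by (simp add: h')
      qed
      show ?thesis
        using \<mu>\<kappa> \<sigma>[OF True] True \<open>\<sigma> i < n\<close> ic
        by (cases c) (auto simp: e_def ax m_def a_add a_diff a_minus a_scale aw w\<sigma>
            act_add_right act_diff_right act_minus_right act_scale algebra_simps)
    qed
  qed
  have quad: "a (a v) + P1 *s a v + P0 *s v = 0" for v
  proof -
    define E where "E v = a (a v) + P1 *s a v + P0 *s v" for v
    have E_add: "E (v + v') = E v + E v'" for v v'
      by (simp add: E_def a_add algebra_simps)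
    have "E 0 = 0" using E_add[of 0 0] by simp
    then have E_sum: "E (\<Sum>g\<in>H. f g) = (\<Sum>g\<in>H. E (f g))" for f :: "nat \<times> bool \<Rightarrow> 'v" and H
      by (induction H rule: infinite_finite_induct) (auto simp: E_add)
    obtain f where "v = (\<Sum>g\<in>G. f g \<star> e g)" using spanning by blast
    then have "E v = (\<Sum>g\<in>G. E (f g \<star> e g))" by (simp add: E_sum)
    also have "\<dots> = 0"
      using quadratic_of_generators[OF lin rel[unfolded \<delta>_def h_def] quad_e]
      by (intro sum.neutral) (auto simp: E_def)
    finally show ?thesis by (simp add: E_def)
  qed
  note pairing = symplectic_generators_pairing[OF gens]
  let ?T = "\<lambda>i. top_coeff_mod (d i)"
  have \<sigma>n: "\<sigma> i < n" if "i \<in> S" for i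
    using \<sigma>[OF that] S by auto
  have ax_f: "a (f \<star> x i) = (if i \<in> S
      then \<mu> i *s (reflect \<delta> f \<star> x (\<sigma> i)) + \<kappa> i *s (reflect \<delta> f \<star> x i)
      else reflect \<delta> f \<star> y i) + (h * twisted_diff \<delta> f) \<star> x i" if "i < n" for i f
    using a[OF G_mem[OF that, of False], of f] by (simp add: e_def m_def act_add_right act_scale)
  have ay_f: "a (f \<star> y i) = (if i \<in> S
      then \<mu> (\<sigma> i) *s (reflect \<delta> f \<star> y (\<sigma> i)) + \<kappa> i *s (reflect \<delta> f \<star> y i) + (reflect \<delta> f * w i) \<star> y i
      else - (P0 *s (reflect \<delta> f \<star> x i)) - P1 *s (reflect \<delta> f \<star> y i)) +
      (h * twisted_diff \<delta> f) \<star> y i" if "i < n" for i f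
    using a[OF G_mem[OF that, of True], of f]
    by (simp add: e_def m_def act_add_right act_diff_right act_minus_right act_scale act_mult)
  \<comment> \<open>The values of \<open>b\<close> between generators and images under
    \<open>a\<close>: only equal indices and indices exchanged by \<open>\<sigma>\<close> can
    interact.\<close>
  have XX: "b (f \<star> x i) (a (f' \<star> x j)) = (if j \<notin> S \<and> i = j then ?T i (f * reflect \<delta> f') else 0)"
    if "i < n" "j < n" for i j f f'
    using that by (simp add: ax_f b_add_right b_scale_right pairing \<sigma>n)
  have YY: "b (f \<star> y i) (a (f' \<star> y j)) = (if j \<notin> S \<and> i = j then P0 * ?T i (f * reflect \<delta> f') else 0)"
    if "i < n" "j < n" for i j f f'
    using that by (simp add: ay_f b_add_right b_diff_right b_minus_right b_scale_right pairing \<sigma>n)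
  have XY: "b (f \<star> x i) (a (f' \<star> y j)) =
    (if j \<in> S then (if i = \<sigma> j then \<mu> i * ?T i (f * reflect \<delta> f') else 0) +
      (if i = j then \<kappa> j * ?T i (f * reflect \<delta> f') + ?T i (f * (reflect \<delta> f' * w j)) +
        ?T i (f * (h * twisted_diff \<delta> f')) else 0)
     else if i = j then - (P1 * ?T i (f * reflect \<delta> f')) + ?T i (f * (h * twisted_diff \<delta> f')) else 0)"
    if "i < n" "j < n" for i j f f'
    using that by (simp add: ay_f b_add_right b_diff_right b_minus_right b_scale_right pairing \<sigma>n)
  have YX: "b (f \<star> y i) (a (f' \<star> x j)) =
    (if j \<in> S then (if i = \<sigma> j then - (\<mu> j * ?T i (f * reflect \<delta> f')) else 0) +
      (if i = j then - (\<kappa> j * ?T i (f * reflect \<delta> f')) - ?T i (f * (h * twisted_diff \<delta> f')) else 0)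
     else if i = j then - ?T i (f * (h * twisted_diff \<delta> f')) else 0)"
    if "i < n" "j < n" for i j f f'
    using that by (simp add: ax_f b_add_right b_diff_right b_minus_right b_scale_right pairing \<sigma>n)
  have even_id: "?T i (f * reflect \<delta> f) = 0"
    "?T i (f * reflect \<delta> f') + ?T i (f' * reflect \<delta> f) = 0"
    "- (P1 * ?T i (f * reflect \<delta> f')) + ?T i (f * (h * twisted_diff \<delta> f')) -
      ?T i (f' * (h * twisted_diff \<delta> f)) = 0"
    if iS: "i < n" "i \<notin> S" for i f f'
  proof -
    obtain N k where d: "d i = [:N, - \<delta>, 1:] ^ k"
      using even[OF iS] unfolding \<delta>_def by blast
    show "?T i (f * reflect \<delta> f) = 0" "?T i (f * reflect \<delta> f') + ?T i (f' * reflect \<delta> f) = 0"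
      unfolding d by (rule top_coeff_mod_reflect_even)+
    show "- (P1 * ?T i (f * reflect \<delta> f')) + ?T i (f * (h * twisted_diff \<delta> f')) -
      ?T i (f' * (h * twisted_diff \<delta> f)) = 0"
      unfolding d h_def top_coeff_mod_reflect_even(3)[OF \<delta>_def, of N k f "Q0 - P0" f', symmetric]
      by (simp del: mult_pCons_left)
  qed
  have odd_id: "?T i (f * reflect \<delta> f') = ?T i (f' * reflect \<delta> f)"
    "?T i (f * (reflect \<delta> f' * w i)) + ?T i (f * (h * twisted_diff \<delta> f')) -
      ?T i (f' * (h * twisted_diff \<delta> f)) = 0" if iS: "i \<in> S" for i f f'
  proof -
    obtain k where d: "d i = [:- z i, 1:] ^ (2 * k + 1)"
      using odd[OF iS] by blast
    show "?T i (f * reflect \<delta> f') = ?T i (f' * reflect \<delta> f)"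
      "?T i (f * (reflect \<delta> f' * w i)) + ?T i (f * (h * twisted_diff \<delta> f')) -
        ?T i (f' * (h * twisted_diff \<delta> f)) = 0"
      unfolding d z\<delta>[OF iS] h[OF iS] w_def by (rule top_coeff_mod_reflect_odd)+
  qed
  have XY_YX: "b (f \<star> x i) (a (f' \<star> y j)) + b (f' \<star> y j) (a (f \<star> x i)) = 0"
    if ij: "i < n" "j < n" for i j f f'
  proof (cases "i \<in> S \<and> j \<in> S")
    case True
    have "j = \<sigma> i \<longleftrightarrow> i = \<sigma> j"
      using \<sigma> True by metis
    consider "i = j" | "i = \<sigma> j" "j = \<sigma> i" "i \<noteq> j" | "i \<noteq> j" "i \<noteq> \<sigma> j" "j \<noteq> \<sigma> i"
      using \<open>j = \<sigma> i \<longleftrightarrow> i = \<sigma> j\<close> by blast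
    then show ?thesis
    proof cases
      case 1
      then show ?thesis
        using True \<sigma>[of i] ij odd_id[of i f f'] by (simp add: XY YX algebra_simps)
    next
      case 2
      then have "d j = d i" using \<sigma>[of i] True by simp
      with 2 show ?thesis
        using True ij odd_id(1)[of i f f'] by (simp add: XY YX)
    next
      case 3
      then show ?thesis using ij by (simp add: XY YX)
    qed
  next
    case False
    show ?thesis
    proof (cases "i = j")
      case True
      then show ?thesis
        using False ij even_id(3)[of i f f'] by (simp add: XY YX)
    next
      case ne: False
      have "j \<in> S \<Longrightarrow> i \<noteq> \<sigma> j" "i \<in> S \<Longrightarrow> j \<noteq> \<sigma> i"
        using False \<sigma> by auto
      with ne show ?thesis
        using ij by (simp add: XY YX)
    qed
  qed
  have "b v (a v) = 0" for v
  proof (rule alternating_of_generators[OF \<open>finite G\<close> spanning lin])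
    show "b (f \<star> e g) (a (f \<star> e g)) = 0" if "g \<in> G" for g f
      using that even_id(1) by (auto simp: G_def e_def XX YY)
    show "b (f \<star> e g) (a (f' \<star> e g')) + b (f' \<star> e g') (a (f \<star> e g)) = 0"
      if gg: "g \<in> G" "g' \<in> G" for g g' f f'
    proof -
      obtain i c j c' where *: "g = (i, c)" "g' = (j, c')" "i < n" "j < n"
        using gg by (cases g; cases g') (auto simp: G_def)
      have XX0: "b (f \<star> x i) (a (f' \<star> x j)) + b (f' \<star> x j) (a (f \<star> x i)) = 0"
        using * even_id(2)[of i f f'] by (auto simp: XX)
      have YY0: "b (f \<star> y i) (a (f' \<star> y j)) + b (f' \<star> y j) (a (f \<star> y i)) = 0"
        using * even_id(2)[of i f f'] by (auto simp: YY simp flip: distrib_left)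
      show ?thesis
        using XX0 YY0 XY_YX[OF *(3,4), of f f'] XY_YX[OF *(4,3), of f' f]
        by (cases c; cases c') (auto simp: * e_def add.commute)
    qed
  qed
  then show ?thesis
    using lin quad rel unfolding form_alternating_def \<delta>_def h_def by blast
qed

end

section \<open>Roots and eigenvalues\<close>

definition ac_eval :: "'a::field poly \<Rightarrow> 'a alg_closure \<Rightarrow> 'a alg_closure" where
  "ac_eval f x = poly (map_poly to_ac f) x"

lemma ac_eval_zero [simp]: "ac_eval 0 x = 0"
  by (simp add: ac_eval_def)

lemma ac_eval_pCons [simp]: "ac_eval (pCons c f) x = to_ac c + x * ac_eval f x"
  by (simp add: ac_eval_def map_poly_pCons)

lemma ac_eval_one [simp]: "ac_eval 1 x = 1"
  by (simp add: one_pCons)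

lemma ac_eval_add: "ac_eval (f + g) x = ac_eval f x + ac_eval g x"
  by (induction f g rule: poly_induct2) (auto simp: algebra_simps)

lemma ac_eval_smult: "ac_eval (Polynomial.smult c f) x = to_ac c * ac_eval f x"
  by (induction f) (auto simp: algebra_simps)

lemma ac_eval_mult: "ac_eval (f * g) x = ac_eval f x * ac_eval g x"
  by (induction f) (auto simp: ac_eval_add ac_eval_smult algebra_simps)

text \<open>Otherwise a Bezout identity evaluated at the common root would read 0 = 1.\<close>

lemma irreducible_dvd_if_common_root:
  assumes "Factorial_Ring.irreducible \<pi>" "ac_eval \<pi> x = 0" "ac_eval f x = 0"
  shows "\<pi> dvd f"
proof (rule ccontr)
  assume "\<not> \<pi> dvd f"
  then obtain r s where "r * \<pi> + s * f = 1"
    using bezout_unit_irreducible[OF assms(1)] unfolding bezout_unit_def by blast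
  then have "ac_eval (r * \<pi> + s * f) x = 1"
    by simp
  then show False
    by (simp add: ac_eval_add ac_eval_mult assms)
qed

lemma monic_quadratic:
  assumes "Polynomial.lead_coeff p = 1" "Polynomial.degree p = 2"
  shows "p = [:Polynomial.coeff p 0, Polynomial.coeff p 1, 1:]"
  using assms by (auto simp: poly_eq_iff coeff_pCons eval_nat_numeral coeff_eq_0 split: nat.splits)

lemma irreducible_quadratic_no_root:
  assumes "Factorial_Ring.irreducible [:p0, p1, 1 :: 'a::field:]"
  shows "t\<^sup>2 + p1 * t + p0 \<noteq> 0"
proof
  assume *: "t\<^sup>2 + p1 * t + p0 = 0"
  then have "poly [:p0, p1, 1:] t = 0"
    by (simp add: power2_eq_square algebra_simps)
  then have "[:- t, 1:] dvd [:p0, p1, 1:]"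
    by (simp only: poly_eq_0_iff_dvd)
  then obtain k where k: "[:p0, p1, 1:] = [:- t, 1:] * k" by (elim dvdE)
  then have "k \<noteq> 0" by auto
  have "Polynomial.degree [:p0, p1, 1:] = Polynomial.degree [:- t, 1:] + Polynomial.degree k"
    unfolding k using \<open>k \<noteq> 0\<close> by (intro degree_mult_eq) auto
  then have "Polynomial.degree k = 1"
    by simp
  then have "\<not> is_unit [:- t, 1:]" "\<not> is_unit k"
    using \<open>k \<noteq> 0\<close> by (auto simp: is_unit_iff_degree)
  then show False
    using assms k by (metis irreducibleD)
qed

section \<open>The quadratic extension and differences of roots\<close>

text \<open>The combinations of \<beta> and 1 over the base field contain all generators of the
  splitting field and are closed under the field operations.\<close>

lemma splitting_field_quadratic:
  assumes \<beta>: "\<beta>\<^sup>2 + to_ac q1 * \<beta> + to_ac q0 = 0"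
    and x: "x \<in> splitting_field [:q0, q1, 1:]"
  shows "\<exists>c d. x = to_ac c * \<beta> + to_ac d"
proof -
  let ?R = "ring_of_type_algebra :: 'a alg_closure ring"
  interpret R: field ?R by (rule field_from_type_algebra)
  have ops: "carrier ?R = UNIV" "\<one>\<^bsub>?R\<^esub> = 1" "\<zero>\<^bsub>?R\<^esub> = 0" "h \<oplus>\<^bsub>?R\<^esub> h' = h + h'" "h \<otimes>\<^bsub>?R\<^esub> h' = h * h'" for h h'
    by (simp_all add: ring_of_type_algebra_def)
  have minus: "\<ominus>\<^bsub>?R\<^esub> h = - h" for h
    by (rule R.minus_equality) (simp_all add: ops)
  have inv: "inv\<^bsub>?R\<^esub> h = inverse h" if "h \<noteq> 0" for h
    using that by (intro R.comm_inv_char) (simp_all add: ops)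
  have sq: "\<beta> * \<beta> = - (to_ac q1 * \<beta>) - to_ac q0"
    using \<beta> by (simp add: power2_eq_square algebra_simps eq_neg_iff_add_eq_0)
  from x show ?thesis
    unfolding splitting_field_def
  proof (induction rule: generate_field.induct)
    case one
    then show ?case by (intro exI[of _ 0] exI[of _ 1]) (simp add: ops)
  next
    case (incl h)
    then consider c where "h = to_ac c" | "h \<in> Root [:q0, q1, 1:]" by blast
    then show ?case
    proof cases
      case 1
      then show ?thesis by (intro exI[of _ 0] exI[of _ c]) simp
    next
      case 2
      then have "to_ac q0 + h * (to_ac q1 + h) = 0"
        by (simp add: Root_def map_poly_pCons)
      \<comment> \<open>Both \<open>h\<close> and \<open>\<beta>\<close> are roots, so
        \<open>h\<close> is \<open>\<beta>\<close> or its conjugate - \<beta> - q1.\<close>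
      moreover have "(h - \<beta>) * (h + \<beta> + to_ac q1) = (to_ac q0 + h * (to_ac q1 + h)) -
          (\<beta> * \<beta> - (- (to_ac q1 * \<beta>) - to_ac q0))"
        by (simp add: algebra_simps)
      ultimately have "(h - \<beta>) * (h + \<beta> + to_ac q1) = 0"
        by (simp add: sq)
      then have "h - \<beta> = 0 \<or> h + \<beta> + to_ac q1 = 0"
        by (simp only: mult_eq_0_iff)
      then have "h = to_ac 1 * \<beta> + to_ac 0 \<or> h = to_ac (- 1) * \<beta> + to_ac (- q1)"
        by (auto simp: algebra_simps eq_neg_iff_add_eq_0)
      then show ?thesis by blast
    qed
  next
    case (a_inv h)
    then obtain c d where "h = to_ac c * \<beta> + to_ac d" by blast
    then show ?case
      by (intro exI[of _ "- c"] exI[of _ "- d"]) (simp add: minus)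
  next
    case (m_inv h)
    then obtain c d where h: "h = to_ac c * \<beta> + to_ac d" by blast
    have "h \<noteq> 0" using m_inv by (simp add: ops)
    \<comment> \<open>Trace and norm of \<open>h\<close>: the conjugate is \<open>T - h\<close>, and
      h (T - h) = D.\<close>
    define T D where "T = 2 * d - c * q1" and "D = d * d - c * d * q1 + c * c * q0"
    have "h * (to_ac T - h) = to_ac (2 * d - c * q1) * h - (to_ac c * to_ac c) * (\<beta> * \<beta>)
        - 2 * to_ac c * to_ac d * \<beta> - to_ac d * to_ac d"
      by (simp add: h T_def algebra_simps)
    also have "\<dots> = to_ac D"
      unfolding sq by (simp add: h D_def algebra_simps)
    finally have eq: "h * (to_ac T - h) = to_ac D" .
    have "\<exists>c d. inverse h = to_ac c * \<beta> + to_ac d"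
    proof (cases "D = 0")
      case True
      then have "h = to_ac T" using eq \<open>h \<noteq> 0\<close> by simp
      then show ?thesis
        by (intro exI[of _ 0] exI[of _ "inverse T"]) simp
    next
      case False
      then have "h * ((to_ac T - h) / to_ac D) = 1"
        by (simp add: eq)
      then have "inverse h = (to_ac T - h) / to_ac D"
        by (rule inverse_unique)
      also have "\<dots> = to_ac (- c / D) * \<beta> + to_ac ((T - d) / D)"
        by (simp add: h diff_divide_distrib add_divide_distrib)
      finally show ?thesis by blast
    qed
    then show ?case
      using inv[OF \<open>h \<noteq> 0\<close>] by simp
  next
    case (eng_add h h')
    then obtain c d c' d' where "h = to_ac c * \<beta> + to_ac d" "h' = to_ac c' * \<beta> + to_ac d'" by blast
    then show ?case
      by (intro exI[of _ "c + c'"] exI[of _ "d + d'"]) (simp add: ops algebra_simps)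
  next
    case (eng_mult h h')
    then obtain c d c' d' where h: "h = to_ac c * \<beta> + to_ac d" "h' = to_ac c' * \<beta> + to_ac d'" by blast
    have "h * h' = (to_ac c * to_ac c') * (\<beta> * \<beta>) + to_ac (c * d' + d * c') * \<beta> + to_ac (d * d')"
      by (simp add: h algebra_simps)
    also have "\<dots> = to_ac (c * d' + d * c' - c * c' * q1) * \<beta> + to_ac (d * d' - c * c' * q0)"
      unfolding sq by (simp add: algebra_simps)
    finally show ?case
      unfolding ops by blast
  qed
qed

context
  fixes p0 p1 q0 q1 :: "'a::field"
  assumes p: "Factorial_Ring.irreducible [:p0, p1, 1:]" and q: "Factorial_Ring.irreducible [:q0, q1, 1:]"
begin

lemma Root_quadratic: "x \<in> Root [:r0, r1, 1:] \<longleftrightarrow> x * x = - (to_ac r1 * x) - to_ac r0"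
proof -
  have "to_ac r0 + x * (to_ac r1 + x) = x * x - (- (to_ac r1 * x) - to_ac r0)"
    by (simp add: algebra_simps)
  moreover have "x \<in> Root [:r0, r1, 1:] \<longleftrightarrow> to_ac r0 + x * (to_ac r1 + x) = 0"
    by (simp add: Root_def map_poly_pCons)
  ultimately show ?thesis
    by (simp only: right_minus_eq)
qed

lemma root_independent:
  assumes "\<beta> \<in> Root [:q0, q1, 1:]" "to_ac c * \<beta> + to_ac d = 0"
  shows "c = 0 \<and> d = 0"
proof (rule ccontr)
  assume *: "\<not> (c = 0 \<and> d = 0)"
  then have "c \<noteq> 0" using assms(2) by auto
  then have "\<beta> = to_ac (- d / c)"
    using assms(2) by (simp add: field_simps eq_neg_iff_add_eq_0)
  then have "to_ac ((- d / c)\<^sup>2 + q1 * (- d / c) + q0) = 0"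
    using assms(1) by (simp add: Root_quadratic power2_eq_square algebra_simps)
  then have "(- d / c)\<^sup>2 + q1 * (- d / c) + q0 = 0"
    by (simp only: to_ac_eq_0_iff)
  then show False
    using irreducible_quadratic_no_root[OF q] by blast
qed

text \<open>Substituting \<alpha> = \<beta> + z in p(\<alpha>) = 0 and comparing coordinates in the
  basis \<beta>, 1 gives q(t) = p(t + z).\<close>

lemma root_diff_in_base:
  assumes "to_ac z \<in> root_diff [:p0, p1, 1:] [:q0, q1, 1:]"
  shows "q1 = p1 + 2 * z \<and> q0 = p0 + p1 * z + z\<^sup>2"
proof -
  obtain \<alpha> \<beta> where \<alpha>\<beta>: "to_ac z = \<alpha> - \<beta>" "\<alpha> \<in> Root [:p0, p1, 1:]" "\<beta> \<in> Root [:q0, q1, 1:]"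
    using assms by (auto simp: root_diff_def)
  then have "\<alpha> = \<beta> + to_ac z" by simp
  with \<alpha>\<beta> have "(\<beta> + to_ac z) * (\<beta> + to_ac z) = - (to_ac p1 * (\<beta> + to_ac z)) - to_ac p0"
    "\<beta> * \<beta> = - (to_ac q1 * \<beta>) - to_ac q0"
    by (simp_all add: Root_quadratic)
  then have "to_ac (p1 + 2 * z - q1) * \<beta> + to_ac (p0 + p1 * z + z\<^sup>2 - q0) = 0"
    by (simp add: algebra_simps power2_eq_square)
  from root_independent[OF \<alpha>\<beta>(3) this] show ?thesis by simp
qed

text \<open>Equality of the splitting fields gives \<alpha> = c \<beta> + d, and p(\<alpha>) = 0
  then determines p1. The computation is in coordinates only, so it covers inseparable
  extensions.\<close>

lemma root_diff_quadratic:
  assumes split: "splitting_field [:p0, p1, 1:] = splitting_field [:q0, q1, 1:]"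
    and \<theta>: "\<theta> \<in> root_diff [:p0, p1, 1:] [:q0, q1, 1:]"
  shows "\<exists>N. ac_eval [:N, - (q1 - p1), 1:] \<theta> = 0"
proof -
  obtain \<alpha> \<beta> where \<alpha>\<beta>: "\<theta> = \<alpha> - \<beta>" "\<alpha> \<in> Root [:p0, p1, 1:]" "\<beta> \<in> Root [:q0, q1, 1:]"
    using \<theta> by (auto simp: root_diff_def)
  have sq: "\<alpha> * \<alpha> = - (to_ac p1 * \<alpha>) - to_ac p0" "\<beta> * \<beta> = - (to_ac q1 * \<beta>) - to_ac q0"
    using \<alpha>\<beta> by (simp_all add: Root_quadratic)
  have "\<alpha> \<in> splitting_field [:p0, p1, 1:]"
    unfolding splitting_field_def using \<alpha>\<beta>(2) by (intro generate_field.incl) simp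
  then have "\<alpha> \<in> splitting_field [:q0, q1, 1:]"
    by (simp only: split)
  moreover have "\<beta>\<^sup>2 + to_ac q1 * \<beta> + to_ac q0 = 0"
    by (simp add: power2_eq_square sq(2))
  ultimately obtain c d where cd: "\<alpha> = to_ac c * \<beta> + to_ac d"
    using splitting_field_quadratic by blast
  have "c \<noteq> 0"
  proof
    assume "c = 0"
    then have "to_ac (d\<^sup>2 + p1 * d + p0) = 0"
      using sq(1) by (simp add: cd power2_eq_square)
    then show False
      using irreducible_quadratic_no_root[OF p, of d] by (simp only: to_ac_eq_0_iff)
  qed
  have "(to_ac c * to_ac c) * (\<beta> * \<beta>) + 2 * to_ac c * to_ac d * \<beta> + to_ac d * to_ac d =
      - (to_ac p1 * (to_ac c * \<beta> + to_ac d)) - to_ac p0"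
    using sq(1) unfolding cd by (simp add: algebra_simps)
  then have "to_ac (2 * c * d + p1 * c - c * c * q1) * \<beta> + to_ac (d * d + p1 * d + p0 - c * c * q0) = 0"
    unfolding sq(2) by (simp add: algebra_simps)
  from root_independent[OF \<alpha>\<beta>(3) this] have "c * (2 * d + p1 - c * q1) = 0"
    by (simp add: algebra_simps)
  then have tr: "p1 = c * q1 - 2 * d"
    using \<open>c \<noteq> 0\<close> by (simp only: mult_eq_0_iff) (simp add: algebra_simps)
  \<comment> \<open>The norm of \<open>\<theta>\<close>, found by replacing \<open>\<beta>\<close>
    with - \<beta> - q1; its trace is q1 - p1.\<close>
  define N where "N = p0 + q0 + q1 * d - 2 * c * q0"
  have "\<theta> * \<theta> = \<alpha> * \<alpha> + \<beta> * \<beta> - 2 * (\<alpha> * \<beta>)"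
    by (simp add: \<alpha>\<beta>(1) algebra_simps)
  also have "\<alpha> * \<beta> = to_ac c * (\<beta> * \<beta>) + to_ac d * \<beta>"
    by (simp add: cd algebra_simps)
  finally have "\<theta> * \<theta> = - (to_ac p1 * \<alpha>) - to_ac p0 + (1 - 2 * to_ac c) * (- (to_ac q1 * \<beta>) - to_ac q0)
      - 2 * to_ac d * \<beta>"
    unfolding sq by (simp add: algebra_simps)
  then have "to_ac N + \<theta> * (- to_ac (q1 - p1) + \<theta>) = 0"
    by (simp add: distrib_left right_diff_distrib) (simp add: \<alpha>\<beta>(1) cd N_def tr algebra_simps)
  then show ?thesis
    by (intro exI[of _ N]) simp
qed

lemma root_diff_minimal_polynomial:
  assumes split: "splitting_field [:p0, p1, 1:] = splitting_field [:q0, q1, 1:]"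
    and \<theta>: "\<theta> \<in> root_diff [:p0, p1, 1:] [:q0, q1, 1:]"
    and \<pi>: "Polynomial.lead_coeff \<pi> = 1" "Factorial_Ring.irreducible \<pi>" "ac_eval \<pi> \<theta> = 0"
  shows "(\<exists>z. \<pi> = [:- z, 1:] \<and> to_ac z \<in> root_diff [:p0, p1, 1:] [:q0, q1, 1:]) \<or>
    (\<exists>N. \<pi> = [:N, - (q1 - p1), 1:])"
proof -
  obtain N where N: "ac_eval [:N, - (q1 - p1), 1:] \<theta> = 0"
    using root_diff_quadratic[OF split \<theta>] by blast
  have dvd: "\<pi> dvd [:N, - (q1 - p1), 1:]"
    by (rule irreducible_dvd_if_common_root[OF \<pi>(2,3) N])
  then have "Polynomial.degree \<pi> \<le> 2"
    using dvd_imp_degree_le[OF dvd] by simp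
  moreover have "Polynomial.degree \<pi> > 0"
    by (rule degree_irreducible_pos[OF \<pi>(2)])
  ultimately consider "Polynomial.degree \<pi> = 1" | "Polynomial.degree \<pi> = 2" by linarith
  then show ?thesis
  proof cases
    case 1
    define z where "z = - Polynomial.coeff \<pi> 0"
    have "\<pi> = [:- z, 1:]"
      using 1 \<pi>(1) by (auto simp: z_def poly_eq_iff coeff_pCons coeff_eq_0 split: nat.splits)
    moreover from this have "\<theta> = to_ac z"
      using \<pi>(3) by simp
    ultimately show ?thesis using \<theta> by blast
  next
    case 2
    obtain k where k: "[:N, - (q1 - p1), 1:] = \<pi> * k" using dvd by (elim dvdE)
    have "k \<noteq> 0" "\<pi> \<noteq> 0" using k by auto
    then have "Polynomial.degree [:N, - (q1 - p1), 1:] = Polynomial.degree \<pi> + Polynomial.degree k"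
      unfolding k by (intro degree_mult_eq)
    then have "Polynomial.degree k = 0" using 2 by simp
    moreover have "Polynomial.lead_coeff k = 1"
      using arg_cong[OF k, of Polynomial.lead_coeff] \<pi>(1) by (simp add: lead_coeff_mult)
    ultimately have "k = 1"
      by (metis degree_eq_zeroE lead_coeff_pCons(2) one_pCons)
    then show ?thesis using k by auto
  qed
qed

end

section \<open>Eigenvalues in the closure and the commutation relation\<close>

context fd_endo
begin

text \<open>Over the closure, an annihilator of least degree of the coordinate vector of
  \<open>v\<close> divides \<open>\<pi>\<close> and has a root \<open>\<theta>\<close>; its cofactor
  maps the coordinate vector to an eigenvector for \<open>\<theta>\<close>.\<close>

lemma eigenvalue_of_annihilator:
  assumes "v \<noteq> 0" "\<pi> \<star> v = 0" "\<pi> \<noteq> 0"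
  shows "\<exists>\<theta>. ac_eval \<pi> \<theta> = 0 \<and> eigenvalue_in_closure scale Basis u \<theta>"
proof -
  \<comment> \<open>The scalar extension is embedded in the space of all families indexed by the
    type; the vectors used below are supported on \<open>Basis\<close>.\<close>
  define sc :: "'a alg_closure \<Rightarrow> ('v \<Rightarrow> 'a alg_closure) \<Rightarrow> ('v \<Rightarrow> 'a alg_closure)"
    where "sc k w = (\<lambda>c. k * w c)" for k w
  define T where "T w = (\<lambda>c. \<Sum>d\<in>Basis. to_ac (representation Basis (u d) c) * w d)"
    for w :: "'v \<Rightarrow> 'a alg_closure"
  define \<iota> where "\<iota> x = (\<lambda>c. to_ac (representation Basis x c))" for x
  interpret K: vector_space sc
    by unfold_locales (auto simp: sc_def fun_eq_iff algebra_simps)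
  interpret K: vs_endo sc T
    by (intro vs_endo.intro vs_endo_axioms.intro K.vector_space_axioms)
      (auto simp: Vector_Spaces.linear_iff K.vector_space_axioms T_def sc_def fun_eq_iff
        distrib_left sum.distrib sum_distrib_left mult.left_commute)
  note B = independent_Basis span_Basis
  have \<iota>_add: "\<iota> (x + y) = \<iota> x + \<iota> y" for x y
    using B by (auto simp: \<iota>_def fun_eq_iff representation_add)
  have \<iota>_scale: "\<iota> (k *s x) = sc (to_ac k) (\<iota> x)" for k x
    using B by (auto simp: \<iota>_def sc_def fun_eq_iff representation_scale)
  have \<iota>_zero: "\<iota> x = 0 \<longleftrightarrow> x = 0" for x
  proof
    assume "\<iota> x = 0"
    then have "representation Basis x c = 0" for c
      by (auto simp: \<iota>_def fun_eq_iff)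
    moreover have "(\<Sum>c\<in>Basis. representation Basis x c *s c) = x"
      using B by (intro sum_representation_eq) (auto simp: finite_Basis)
    ultimately show "x = 0" by simp
  next
    assume "x = 0"
    then show "\<iota> x = 0" by (simp add: \<iota>_def fun_eq_iff representation_zero)
  qed
  have \<iota>_sum: "\<iota> (\<Sum>i\<in>A. g i) = (\<Sum>i\<in>A. \<iota> (g i))" for A and g :: "'v \<Rightarrow> 'v"
    using \<iota>_zero[of 0] by (induction A rule: infinite_finite_induct) (auto simp: \<iota>_add)
  have \<iota>_u: "\<iota> (u x) = T (\<iota> x)" for x
  proof -
    have "u x = u (\<Sum>d\<in>Basis. representation Basis x d *s d)"
      using B by (subst sum_representation_eq) (auto simp: finite_Basis)
    also have "\<dots> = (\<Sum>d\<in>Basis. representation Basis x d *s u d)"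
      by (simp add: u_sum u_scale)
    finally have "\<iota> (u x) = (\<Sum>d\<in>Basis. sc (to_ac (representation Basis x d)) (\<iota> (u d)))"
      by (simp add: \<iota>_sum \<iota>_scale)
    also have "\<dots> = T (\<iota> x)"
    proof (rule ext)
      fix c
      have app: "(\<Sum>d\<in>A. F d) c = (\<Sum>d\<in>A. F d c)" for A and F :: "'v \<Rightarrow> 'v \<Rightarrow> 'a alg_closure"
        by (induction A rule: infinite_finite_induct) auto
      show "(\<Sum>d\<in>Basis. sc (to_ac (representation Basis x d)) (\<iota> (u d))) c = T (\<iota> x) c"
        by (simp add: app T_def sc_def \<iota>_def mult.commute)
    qed
    finally show ?thesis .
  qed
  have \<iota>_act: "\<iota> (f \<star> x) = K.act (map_poly to_ac f) (\<iota> x)" for f x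
  proof (induction f)
    case (pCons c f)
    then show ?case
      by (simp add: act_pCons map_poly_pCons K.act_pCons \<iota>_add \<iota>_scale \<iota>_u)
  qed (simp add: \<iota>_def representation_zero zero_fun_def)
  let ?P = "\<lambda>\<rho>. \<rho> \<noteq> 0 \<and> K.act \<rho> (\<iota> v) = 0"
  have "?P (map_poly to_ac \<pi>)"
    using assms \<iota>_act[of \<pi> v] \<iota>_zero[of 0] by (simp add: map_poly_eq_0_iff)
  then obtain \<rho> where \<rho>: "?P \<rho>" "\<And>\<rho>'. ?P \<rho>' \<Longrightarrow> Polynomial.degree \<rho> \<le> Polynomial.degree \<rho>'"
    using ex_has_least_nat[of ?P _ Polynomial.degree] by blast
  have "Polynomial.degree \<rho> \<noteq> 0"
  proof
    assume "Polynomial.degree \<rho> = 0"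
    then obtain k where k: "\<rho> = [:k:]" by (elim degree_eq_zeroE)
    with \<rho>(1) have "sc k (\<iota> v) = 0" "k \<noteq> 0"
      by (auto simp: K.act_const)
    then have "\<iota> v = 0"
      by (simp add: K.scale_eq_0_iff)
    then show False using assms(1) \<iota>_zero by blast
  qed
  then obtain \<theta> where "poly \<rho> \<theta> = 0"
    using alg_closed_imp_poly_has_root[of \<rho>] by auto
  then obtain \<rho>' where \<rho>': "\<rho> = [:- \<theta>, 1:] * \<rho>'"
    by (auto simp: poly_eq_0_iff_dvd elim: dvdE)
  define w where "w = K.act \<rho>' (\<iota> v)"
  have "\<rho>' \<noteq> 0" using \<rho>' \<rho>(1) by auto
  then have "Polynomial.degree \<rho>' < Polynomial.degree \<rho>"
    unfolding \<rho>' by (subst degree_mult_eq) auto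
  then have "w \<noteq> 0"
    using \<rho>(2)[of \<rho>'] \<open>\<rho>' \<noteq> 0\<close> by (auto simp: w_def)
  have "K.act [:- \<theta>, 1:] w = 0"
    using \<rho>(1) unfolding \<rho>' w_def by (simp only: K.act_mult)
  then have Tw: "T w = sc \<theta> w"
    by (simp add: K.act_pCons K.u_minus)
  have "\<rho> dvd map_poly to_ac \<pi>"
  proof (rule ccontr)
    assume "\<not> \<rho> dvd map_poly to_ac \<pi>"
    then have nz: "map_poly to_ac \<pi> mod \<rho> \<noteq> 0"
      by (simp add: dvd_eq_mod_eq_0)
    moreover have "K.act (map_poly to_ac \<pi> mod \<rho>) (\<iota> v) = 0"
      using K.act_mod[of \<rho> "\<iota> v" "map_poly to_ac \<pi>"] \<rho>(1) \<open>?P (map_poly to_ac \<pi>)\<close> by simp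
    ultimately have "Polynomial.degree \<rho> \<le> Polynomial.degree (map_poly to_ac \<pi> mod \<rho>)"
      by (intro \<rho>(2)) simp
    then show False
      using degree_mod_less[of \<rho> "map_poly to_ac \<pi>"] \<rho>(1) nz by simp
  qed
  then have "ac_eval \<pi> \<theta> = 0"
    using \<open>poly \<rho> \<theta> = 0\<close> unfolding ac_eval_def by (auto elim!: dvdE)
  moreover have "eigenvalue_in_closure scale Basis u \<theta>"
    unfolding eigenvalue_in_closure_def
  proof (intro exI[of _ w] conjI ballI)
    show "(\<Sum>d\<in>Basis. to_ac (representation Basis (u d) c) * w d) = \<theta> * w c" for c
      using fun_cong[OF Tw, of c] by (simp add: T_def sc_def)
    show "\<exists>c\<in>Basis. w c \<noteq> 0"
    proof (rule ccontr)
      assume *: "\<not> (\<exists>c\<in>Basis. w c \<noteq> 0)"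
      have out: "\<iota> x c = 0" if "c \<notin> Basis" for x c
        using that by (auto simp: \<iota>_def dest: representation_ne_zero)
      have "K.act \<rho>' (\<iota> v) c = 0" if "c \<notin> Basis" for c
      proof (induction \<rho>')
        case (pCons k f)
        have "T y c = 0" for y
          using out[OF that] by (simp add: T_def \<iota>_def)
        then show ?case
          unfolding K.act_pCons using out[OF that] by (simp add: sc_def)
      qed simp
      with * have "w = 0" by (auto simp: w_def fun_eq_iff)
      with \<open>w \<noteq> 0\<close> show False by blast
    qed
  qed
  ultimately show ?thesis by blast
qed

text \<open>Expand q(a - u) and eliminate a^2 by p(a) = 0.\<close>

lemma relation_iff:
  assumes lin: "Vector_Spaces.linear scale scale a"
    and quad: "\<And>v. a (a v) + P1 *s a v + P0 *s v = 0"
  shows "poly_endo scale [:Q0, Q1, 1:] (\<lambda>x. a x - u x) v = 0 \<longleftrightarrow>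
    a (u v) = (Q1 - P1) *s a v - u (a v) + [:Q0 - P0, - Q1, 1:] \<star> v"
proof -
  interpret a: vs_endo scale a
    by (intro vs_endo.intro vs_endo_axioms.intro vector_space_axioms lin)
  interpret D: vs_endo scale "\<lambda>x. a x - u x"
    by (intro vs_endo.intro vs_endo_axioms.intro vector_space_axioms)
      (simp add: Vector_Spaces.linear_iff vector_space_axioms a.u_add a.u_scale
        u_add u_scale scale_right_diff_distrib)
  have aa: "a (a v) = - (P1 *s a v) - P0 *s v"
    using quad[of v] by (simp add: algebra_simps eq_neg_iff_add_eq_0)
  have "poly_endo scale [:Q0, Q1, 1:] (\<lambda>x. a x - u x) v =
    ((Q1 - P1) *s a v - u (a v) + [:Q0 - P0, - Q1, 1:] \<star> v) - a (u v)"
    by (simp add: D.act_pCons act_pCons a.u_add a.u_diff a.u_scale u_add u_diff u_minus u_scale aa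
        scale_left_diff_distrib scale_right_diff_distrib algebra_simps)
  then show ?thesis by auto
qed

end

section \<open>Equivalence\<close>

context symplectic_endo
begin

text \<open>With \<open>u1\<close> as \<open>a\<close>, the commutation relation rewritten at u - z
  becomes the hypothesis \<open>rel\<close> of \<open>four_dvd_jordan_cells\<close>, because q(t) =
  p(t + z).\<close>

lemma four_dvd_if_difference:
  assumes p: "Factorial_Ring.irreducible [:P0, P1, 1:]" and q: "Factorial_Ring.irreducible [:Q0, Q1, 1:]"
    and diff: "symplectic_difference scale [:P0, P1, 1:] [:Q0, Q1, 1:] b u"
    and z: "to_ac z \<in> root_diff [:P0, P1, 1:] [:Q0, Q1, 1:]" and "odd k"
  shows "4 dvd jordan_cells scale u z k"
proof -
  obtain u1 u2 where u12: "form_alternating scale b u1" "\<And>x. u x = u1 x - u2 x"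
    "\<And>x. poly_endo scale [:P0, P1, 1:] u1 x = 0" "\<And>x. poly_endo scale [:Q0, Q1, 1:] u2 x = 0"
    using diff unfolding symplectic_difference_def by blast
  have lin: "Vector_Spaces.linear scale scale u1"
    using u12(1) by (simp add: form_alternating_def)
  interpret u1: vs_endo scale u1
    by (intro vs_endo.intro vs_endo_axioms.intro vector_space_axioms lin)
  have quad: "u1 (u1 v) + P1 *s u1 v + P0 *s v = 0" for v
    using u12(3)[of v] by (simp add: u1.act_monic_quadratic)
  have "u2 = (\<lambda>x. u1 x - u x)"
    by (simp add: u12(2))
  then have rel: "u1 (u v) = (Q1 - P1) *s u1 v - u (u1 v) + [:Q0 - P0, - Q1, 1:] \<star> v" for v
    using u12(4)[of v] relation_iff[OF lin quad, of Q0 Q1 v] by simp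
  have zq: "Q1 = P1 + z + z" "Q0 = P0 + P1 * z + z * z"
    using root_diff_in_base[OF p q z] by (simp_all add: power2_eq_square)
  obtain n d x y where gens: "symplectic_generators UNIV n d x y"
    using symplectic_generators_exist[of UNIV] b_nondegenerate by (auto simp: nondegenerate_on_def)
  show ?thesis
  proof (rule four_dvd_jordan_cells[OF u12(1) _ _ _ elementary_divisor_list_symplectic[OF gens] \<open>odd k\<close>])
    show "u1 (u1 v) = (- P1) *s u1 v + (- P0) *s v" for v
    proof -
      have "u1 (u1 v) = - (P1 *s u1 v + P0 *s v)"
        using quad[of v] by (simp only: eq_neg_iff_add_eq_0 add.assoc)
      then show ?thesis by simp
    qed
    show "t\<^sup>2 + P1 * t + P0 \<noteq> 0" for t
      by (rule irreducible_quadratic_no_root[OF p])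
    show "u1 ([:- z, 1:] \<star> v) + [:- z, 1:] \<star> u1 v =
      [:- z, 1:] \<star> [:- z, 1:] \<star> v - P1 *s ([:- z, 1:] \<star> v)" for v
      by (simp add: act_pCons u1.u_add u1.u_diff u1.u_minus u1.u_scale u_add u_diff u_minus u_scale rel zq
          scale_left_distrib scale_left_diff_distrib scale_right_distrib scale_right_diff_distrib
          algebra_simps)
        (simp only: mult_2_right scale_left_distrib add_ac)
  qed
qed

lemma difference_if_four_dvd:
  assumes p: "Factorial_Ring.irreducible [:P0, P1, 1:]" and q: "Factorial_Ring.irreducible [:Q0, Q1, 1:]"
    and split: "splitting_field [:P0, P1, 1:] = splitting_field [:Q0, Q1, 1:]"
    and exc: "exceptional scale Basis [:P0, P1, 1:] [:Q0, Q1, 1:] u"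
    and cells: "\<And>z k. to_ac z \<in> root_diff [:P0, P1, 1:] [:Q0, Q1, 1:] \<Longrightarrow> odd k \<Longrightarrow>
      4 dvd jordan_cells scale u z k"
  shows "symplectic_difference scale [:P0, P1, 1:] [:Q0, Q1, 1:] b u"
proof -
  let ?RD = "root_diff [:P0, P1, 1:] [:Q0, Q1, 1:]"
  obtain n d x y where gens: "symplectic_generators UNIV n d x y"
    using symplectic_generators_exist[of UNIV] b_nondegenerate by (auto simp: nondegenerate_on_def)
  \<comment> \<open>The blocks of odd powers of t - z; on all others \<open>d i\<close> is a power
    of some t^2 - \<delta> t + N.\<close>
  define S where "S = {i. i < n \<and> (\<exists>z j. d i = [:- z, 1:] ^ (2 * j + 1) \<and> to_ac z \<in> ?RD)}"
  have even: "\<exists>N m. d i = [:N, - (Q1 - P1), 1:] ^ m" if i: "i < n" "i \<notin> S" for i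
  proof -
    obtain \<pi> e where \<pi>: "Polynomial.lead_coeff \<pi> = 1" "Factorial_Ring.irreducible \<pi>" "e > 0" "d i = \<pi> ^ e"
      using gens i(1) unfolding symplectic_generators_def by blast
    \<comment> \<open>A nonzero vector killed by \<open>\<pi>\<close>: the eigenvalue it yields is a
      difference of roots by exceptionality, which restricts \<open>\<pi>\<close>.\<close>
    have "\<pi> ^ (e - 1) \<star> x i \<noteq> 0"
    proof
      assume "\<pi> ^ (e - 1) \<star> x i = 0"
      then have "(\<Sum>j<n. (if j = i then \<pi> ^ (e - 1) else 0) \<star> x j + 0 \<star> y j) = 0"
        by (intro sum.neutral) auto
      from symplectic_generators_kernel[OF gens this i(1)] have "\<pi> ^ e dvd \<pi> ^ (e - 1)"
        using \<pi>(4) by simp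
      moreover have "\<pi> \<noteq> 0" "\<not> is_unit \<pi>"
        using \<pi>(2) by (auto simp: Factorial_Ring.irreducible_def)
      ultimately have "e \<le> e - 1"
        by (auto simp: dvd_power_iff)
      then show False using \<pi>(3) by simp
    qed
    moreover have "\<pi> \<star> \<pi> ^ (e - 1) \<star> x i = 0"
    proof -
      have "\<pi> * \<pi> ^ (e - 1) = \<pi> ^ e"
        using \<pi>(3) by (simp flip: power_Suc)
      moreover have "d i \<star> x i = 0"
        using gens i(1) unfolding symplectic_generators_def by blast
      ultimately show ?thesis
        by (simp only: \<pi>(4) flip: act_mult)
    qed
    moreover have "\<pi> \<noteq> 0" using \<pi>(2) by auto
    ultimately obtain \<theta> where "ac_eval \<pi> \<theta> = 0" "eigenvalue_in_closure scale Basis u \<theta>"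
      using eigenvalue_of_annihilator by blast
    then have "\<theta> \<in> ?RD"
      using exc unfolding exceptional_def by blast
    then consider z where "\<pi> = [:- z, 1:]" "to_ac z \<in> ?RD" | N where "\<pi> = [:N, - (Q1 - P1), 1:]"
      using root_diff_minimal_polynomial[OF p q split _ \<pi>(1,2) \<open>ac_eval \<pi> \<theta> = 0\<close>] by blast
    then show ?thesis
    proof cases
      case (1 z)
      have "even e"
      proof (rule ccontr)
        assume "odd e"
        then obtain j where "e = 2 * j + 1" by (elim oddE)
        then have "i \<in> S" using 1 i \<pi>(4) by (auto simp: S_def simp del: power_Suc)
        with i show False by blast
      qed
      \<comment> \<open>An even power of t - z is a power of t^2 - 2 z t + z^2, and 2 z = Q1 -
        P1.\<close>
      then obtain j where "e = 2 * j" by (elim evenE)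
      then have "d i = [:z\<^sup>2, - (2 * z), 1:] ^ j"
        by (simp only: \<pi>(4) 1(1) linear_squared)
      then show ?thesis
        using root_diff_in_base[OF p q 1(2)] by auto
    next
      case 2
      then show ?thesis using \<pi>(4) by blast
    qed
  qed
  have "\<forall>i\<in>S. \<exists>z. (\<exists>j. d i = [:- z, 1:] ^ (2 * j + 1)) \<and> to_ac z \<in> ?RD"
    unfolding S_def by blast
  then obtain z where z: "\<And>i. i \<in> S \<Longrightarrow> \<exists>j. d i = [:- z i, 1:] ^ (2 * j + 1)"
    "\<And>i. i \<in> S \<Longrightarrow> to_ac (z i) \<in> ?RD"
    by (auto dest!: bchoice)
  \<comment> \<open>The cell count is twice the number of blocks with this \<open>d i\<close>, so
    divisibility by 4 makes that number even.\<close>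
  have "even (card {j \<in> S. d j = d i})" if i: "i \<in> S" for i
  proof -
    obtain k where k: "d i = [:- z i, 1:] ^ (2 * k + 1)" using z(1)[OF i] by blast
    have "\<exists>z j. d i = [:- z, 1:] ^ (2 * j + 1) \<and> to_ac z \<in> ?RD"
      using i unfolding S_def by blast
    then have "j \<in> S" if "j < n" "d j = d i" for j
      unfolding S_def mem_Collect_eq that(2) using that(1) by blast
    then have "{j \<in> S. d j = d i} = {j. j < n \<and> d j = d i}"
      unfolding S_def by blast
    moreover have "count (mset (map d [0..<n])) (d i) = card {j. j < n \<and> d j = d i}"
    proof -
      have "{j. j < n \<and> d i = map d [0..<n] ! j} = {j. j < n \<and> d j = d i}"
        by auto
      then show ?thesis
        by (simp only: count_mset count_list_eq_length_filter length_filter_conv_card length_map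
            length_upt diff_zero)
    qed
    moreover have "jordan_cells scale u (z i) (2 * k + 1) =
        count (mset (map d [0..<n] @ map d [0..<n])) ([:- z i, 1:] ^ (2 * k + 1))"
      by (rule jordan_cells_eq(1)[OF elementary_divisor_list_symplectic[OF gens]]) simp
    moreover have "4 dvd jordan_cells scale u (z i) (2 * k + 1)"
      by (rule cells[OF z(2)[OF i]]) simp
    ultimately have "4 dvd 2 * card {j \<in> S. d j = d i}"
      unfolding k[symmetric] mset_append count_union by (simp only: mult_2)
    then show ?thesis by presburger
  qed
  moreover have "finite S" by (simp add: S_def)
  ultimately obtain \<sigma> where \<sigma>: "\<forall>i\<in>S. \<sigma> i \<in> S \<and> \<sigma> i \<noteq> i \<and> \<sigma> (\<sigma> i) = i \<and> d (\<sigma> i) = d i"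
    using involution_of_even_fibres by blast
  have "\<exists>a. form_alternating scale b a \<and> (\<forall>v. a (a v) + P1 *s a v + P0 *s v = 0) \<and>
    (\<forall>v. a (u v) = (Q1 - P1) *s a v - u (a v) + [:Q0 - P0, - Q1, 1:] \<star> v)"
  proof (rule quadratic_alternating_exists[OF gens even _ z(1)])
    show "S \<subseteq> {..<n}" by (auto simp: S_def)
    show "Q1 = P1 + 2 * z i" "Q0 = P0 + P1 * z i + (z i)\<^sup>2" if "i \<in> S" for i
      using root_diff_in_base[OF p q z(2)[OF that]] by blast+
    show "\<sigma> i \<in> S \<and> \<sigma> i \<noteq> i \<and> \<sigma> (\<sigma> i) = i \<and> d (\<sigma> i) = d i" if "i \<in> S" for i
      using \<sigma> that by blast
  qed
  then obtain a where a: "form_alternating scale b a" "\<And>v. a (a v) + P1 *s a v + P0 *s v = 0"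
    "\<And>v. a (u v) = (Q1 - P1) *s a v - u (a v) + [:Q0 - P0, - Q1, 1:] \<star> v"
    by blast
  have lin: "Vector_Spaces.linear scale scale a"
    using a(1) by (simp add: form_alternating_def)
  interpret a: vs_endo scale a
    by (intro vs_endo.intro vs_endo_axioms.intro vector_space_axioms lin)
  have "form_alternating scale b (\<lambda>v. a v - u v)"
    using a(1) by (simp add: form_alternating_def Vector_Spaces.linear_iff vector_space_axioms
        a.u_add a.u_scale u_add u_scale scale_right_diff_distrib b_diff_right)
  moreover have "poly_endo scale [:P0, P1, 1:] a v = 0" for v
    by (simp only: a.act_monic_quadratic a(2))
  moreover have "poly_endo scale [:Q0, Q1, 1:] (\<lambda>v. a v - u v) v = 0" for v
    using relation_iff[OF lin a(2)] a(3) by blast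
  ultimately show ?thesis
    unfolding symplectic_difference_def using pair a(1)
    by (intro conjI exI[of _ a] exI[of _ "\<lambda>v. a v - u v"]) auto
qed

end

theorem theorem5p3:
  fixes scale :: "'a::field \<Rightarrow> 'v::ab_group_add \<Rightarrow> 'v"
    and Basis :: "'v set"
    and p q :: "'a poly"
    and b :: "'v \<Rightarrow> 'v \<Rightarrow> 'a"
    and u :: "'v \<Rightarrow> 'v"
  assumes "finite_dimensional_vector_space scale Basis"
    and "Polynomial.lead_coeff p = 1" and "Polynomial.degree p = 2"
    and "Polynomial.lead_coeff q = 1" and "Polynomial.degree q = 2"
    and "Factorial_Ring.irreducible p" and "Factorial_Ring.irreducible q"
    and "splitting_field p = splitting_field q"
    and "symplectic_pair scale b u"
    and "exceptional scale Basis p q u"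
  shows "symplectic_difference scale p q b u \<longleftrightarrow>
    (\<forall>z k. to_ac z \<in> root_diff p q \<longrightarrow> odd k \<longrightarrow> 4 dvd jordan_cells scale u z k)"
proof -
  interpret finite_dimensional_vector_space scale Basis by fact
  have lin: "Vector_Spaces.linear scale scale u"
    using assms(10) by (simp add: exceptional_def)
  interpret symplectic_endo scale u Basis b
    by (intro symplectic_endo.intro fd_endo.intro vs_endo.intro vs_endo_axioms.intro
        symplectic_endo_axioms.intro vector_space_axioms finite_dimensional_vector_space_axioms
        lin assms(9))
  obtain P0 P1 where p: "p = [:P0, P1, 1:]"
    using monic_quadratic[OF assms(2,3)] by blast
  obtain Q0 Q1 where q: "q = [:Q0, Q1, 1:]"
    using monic_quadratic[OF assms(4,5)] by blast
  show ?thesis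
    using four_dvd_if_difference difference_if_four_dvd assms(6-8,10) unfolding p q by blast
qed

end
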